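(* Let $\Omega\subset\mathbb R^2$ be a bounded open set and $\|\cdot\|$ a strictly convex norm on $\mathbb R^2$ that is analytic on $\mathbb R^2\setminus\{0\}$. Let $m:\Omega\to\mathbb R^2$ be measurable with $\|m\|=1$ a.e. and $\nabla\cdot m=0$ in $\mathcal D'(\Omega)$. If for every open $\Omega'\subset\subset\Omega$ \[\sup_{|h|<\mathrm{dist}(\Omega',\partial\Omega)}\frac1{|h|}\int_{\Omega'}\Pi\big(m(x+h),m(x)\big)\,dx<\infty,\] then $\nabla\cdot\Phi(m)\in\mathcal M_{loc}(\Omega)$ for all $\Phi\in\mathrm{ENT}$.
   Context: $\mathsf B=\{\|z\|<1\}$, normalized so that $\partial\mathsf B$ has length $2\pi$; $\gamma:\mathbb R/2\pi\mathbb Z\to\partial\mathsf B$ is the counterclockwise arc-length parametrization. $\mathrm{ENT}=\{\Phi\in C^1(\partial\mathsf B;\mathbb R^2):\frac{d}{d\theta}\Phi(\gamma(\theta))=\lambda_\Phi(\theta)\gamma'(\theta)$ for some $\lambda_\Phi\in C^1(\mathbb R/2\pi\mathbb Z)\}$. $\mathcal M_{loc}(\Omega)$ denotes locally finite Radon measures. $\alpha:\mathbb R\to\mathbb R$ is continuous with $\gamma'(\theta)=e^{i\alpha(\theta)}$ (identifying $\mathbb R^2$ with $\mathbb C$). $\Pi(\gamma(\theta_1),\gamma(\theta_2))=\int_{\theta_1}^{\theta_2}\int_{\theta_1}^{\theta_2}|\alpha(t)-\alpha(s)|\,dt\,ds$ for $|\theta_1-\theta_2|\le\pi$. *)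

theory Defs
  imports "HOL-Complex_Analysis.Complex_Analysis"
begin

definition is_norm_R2 :: "(complex \<Rightarrow> real) \<Rightarrow> bool" where
  "is_norm_R2 N \<longleftrightarrow>
     (\<forall>x. N x = 0 \<longleftrightarrow> x = 0) \<and>
     (\<forall>x y. N (x + y) \<le> N x + N y) \<and>
     (\<forall>(c::real) x. N (c *\<^sub>R x) = \<bar>c\<bar> * N x)"

definition strictly_convex_norm :: "(complex \<Rightarrow> real) \<Rightarrow> bool" where
  "strictly_convex_norm N \<longleftrightarrow>
     (\<forall>x y. N x = 1 \<and> N y = 1 \<and> x \<noteq> y \<longrightarrow> N ((1/2) *\<^sub>R (x + y)) < 1)"

definition real_analytic_at :: "(complex \<Rightarrow> real) \<Rightarrow> complex \<Rightarrow> bool" where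
  "real_analytic_at f p \<longleftrightarrow>
     (\<exists>r>0. \<exists>c :: nat \<Rightarrow> nat \<Rightarrow> real. \<forall>z \<in> ball p r.
        ((\<lambda>(i, j). c i j * (Re (z - p)) ^ i * (Im (z - p)) ^ j) has_sum f z) UNIV)"

coinductive smooth_R2 :: "(complex \<Rightarrow> real) \<Rightarrow> bool" where
  "\<lbrakk>\<forall>x. f differentiable (at x); continuous_on UNIV f;
    \<forall>v. smooth_R2 (\<lambda>x. frechet_derivative f (at x) v)\<rbrakk> \<Longrightarrow> smooth_R2 f"

definition test_fn :: "complex set \<Rightarrow> (complex \<Rightarrow> real) \<Rightarrow> bool" where
  "test_fn \<Omega> \<phi> \<longleftrightarrow> smooth_R2 \<phi> \<and> compact (closure {x. \<phi> x \<noteq> 0})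
                     \<and> closure {x. \<phi> x \<noteq> 0} \<subseteq> \<Omega>"

definition div_zero :: "complex set \<Rightarrow> (complex \<Rightarrow> complex) \<Rightarrow> bool" where
  "div_zero \<Omega> F \<longleftrightarrow>
     (\<forall>\<phi>. test_fn \<Omega> \<phi> \<longrightarrow>
        (LINT x|lebesgue. frechet_derivative \<phi> (at x) (F x)) = 0)"

text \<open>div F is a locally finite (signed) Radon measure on Omega: it is the
  difference of two locally finite Borel measures concentrated on Omega.\<close>

definition div_is_Mloc :: "complex set \<Rightarrow> (complex \<Rightarrow> complex) \<Rightarrow> bool" where
  "div_is_Mloc \<Omega> F \<longleftrightarrow>
     (\<exists>\<mu>1 \<mu>2 :: complex measure.
        sets \<mu>1 = sets borel \<and> sets \<mu>2 = sets borel \<and>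
        emeasure \<mu>1 (UNIV - \<Omega>) = 0 \<and> emeasure \<mu>2 (UNIV - \<Omega>) = 0 \<and>
        (\<forall>K. compact K \<and> K \<subseteq> \<Omega> \<longrightarrow> emeasure \<mu>1 K < \<infinity> \<and> emeasure \<mu>2 K < \<infinity>) \<and>
        (\<forall>\<phi>. test_fn \<Omega> \<phi> \<longrightarrow>
           (LINT x|lebesgue. frechet_derivative \<phi> (at x) (F x))
             = - ((\<integral>x. \<phi> x \<partial>\<mu>1) - (\<integral>x. \<phi> x \<partial>\<mu>2))))"

text \<open>gamma : R -> dB is the 2pi-periodic, counterclockwise, arc-length
  parametrization of the boundary of the unit ball {N < 1}, whose length is 2pi.\<close>

definition arclength_param :: "(complex \<Rightarrow> real) \<Rightarrow> (real \<Rightarrow> complex) \<Rightarrow> bool" where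
  "arclength_param N \<gamma> \<longleftrightarrow>
     (\<forall>t. \<gamma> (t + 2 * pi) = \<gamma> t) \<and>
     range \<gamma> = {z. N z = 1} \<and>
     inj_on \<gamma> {0..<2 * pi} \<and>
     \<gamma> C1_differentiable_on UNIV \<and>
     (\<forall>t. norm (vector_derivative \<gamma> (at t)) = 1) \<and>
     winding_number (\<lambda>s. \<gamma> (2 * pi * s)) 0 = 1"

definition angle_fn :: "(real \<Rightarrow> complex) \<Rightarrow> (real \<Rightarrow> real) \<Rightarrow> bool" where
  "angle_fn \<gamma> \<alpha> \<longleftrightarrow> continuous_on UNIV \<alpha> \<and>
     (\<forall>t. vector_derivative \<gamma> (at t) = cis (\<alpha> t))"

definition Pi_cost :: "(real \<Rightarrow> complex) \<Rightarrow> (real \<Rightarrow> real) \<Rightarrow> complex \<Rightarrow> complex \<Rightarrow> real" where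
  "Pi_cost \<gamma> \<alpha> p q = (SOME v. \<exists>t1 t2. \<gamma> t1 = p \<and> \<gamma> t2 = q \<and> \<bar>t1 - t2\<bar> \<le> pi \<and>
      v = integral {min t1 t2..max t1 t2}
            (\<lambda>t. integral {min t1 t2..max t1 t2} (\<lambda>s. \<bar>\<alpha> t - \<alpha> s\<bar>)))"

definition ENT :: "(real \<Rightarrow> complex) \<Rightarrow> (complex \<Rightarrow> complex) \<Rightarrow> bool" where
  "ENT \<gamma> \<Phi> \<longleftrightarrow>
     continuous_on (range \<gamma>) \<Phi> \<and>
     (\<lambda>t. \<Phi> (\<gamma> t)) C1_differentiable_on UNIV \<and>
     (\<exists>lam::real \<Rightarrow> real. (\<forall>t. lam (t + 2 * pi) = lam t) \<and> lam C1_differentiable_on UNIV \<and>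
        (\<forall>t. ((\<lambda>t. \<Phi> (\<gamma> t)) has_vector_derivative
               (lam t *\<^sub>R vector_derivative \<gamma> (at t))) (at t)))"

end

theory Submission
  imports Defs "HOL-Probability.Probability"
begin

text \<open>
  Mollify \<open>m\<close> at scale \<open>\<epsilon>\<close> and extend an entropy \<open>\<Phi>\<close> to a map \<open>\<Psi>\<close> of the plane whose differential
  is a multiple of the identity up to an error proportional to the deficit \<open>1 - N\<close>. As the
  mollification \<open>M\<close> is divergence free, \<open>div \<Psi>(M)\<close> is bounded by \<open>(1 - N M) |DM|\<close>. At each point this
  product is at most \<open>1/\<epsilon>\<close> times the average of the cost over pairs of values of \<open>m\<close> in the
  \<open>\<epsilon>\<close>-ball: lift the values to angles with mean \<open>c\<close> and measure both factors from \<open>\<gamma> c\<close>; since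
  the angle \<open>\<alpha>\<close> of the tangent is monotone, the cost of two points on opposite sides of \<open>c\<close>
  dominates the products of their distances to \<open>c\<close> and their deficits, and both sides have the
  same first moment. Hence \<open>div \<Psi>(M)\<close> is bounded in \<open>L\<^sup>1\<close> locally, uniformly in \<open>\<epsilon>\<close>, and a weak
  limit of these densities is the required measure. Weak compactness in the plane is reduced to
  Helly's theorem on the line by a space-filling curve with a Borel right inverse.
\<close>

section \<open>A square-filling curve\<close>

text \<open>The powers of \<epsilon> balance exactly. A kernel of size \<epsilon>^-2 in the deficit
  and its gradient of size \<epsilon>^-3 in DM cost \<epsilon>^-5; integrating the pair cost over a
  centre and two points of its ball gives \<epsilon>^5 back, namely one \<epsilon> from the
  hypothesis and two areas. Neither factor is estimated alone. Both factors accept an arbitrary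
  reference point \<gamma> c. The deficit is nonlinear in M, but N is bounded below by the linear
  support functional at \<gamma> c, which commutes with averaging; in DM the constant \<gamma> c can
  be subtracted because the derivative of the kernel has integral 0. This freedom allows c to be a
  mean angle. A mean of angles makes no sense on the whole circle. The circle is cut open around a
  value whose average cost is at most the overall mean; values far from it are expensive, so their
  measure is small. The given data are awkward: \<open>Pi_cost\<close> is an unspecified choice at
  antipodal points, and \<open>m\<close> is known only almost everywhere. A Borel minorant replaces
  the cost and a Borel angle replaces the field before any Fubini argument.\<close>

definition schoenberg_wave :: "real \<Rightarrow> real" where
  "schoenberg_wave t = max 0 (min 1 (1/2 - cos (pi * t)))"

text \<open>Schoenberg's curve, with his piecewise linear wave replaced by a clipped cosine that is
  0 on [0, 1/3], 1 on [2/3, 1], even, and of period 2. The parameter \<open>b\<close> selects a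
  coordinate: since 9^k = 3^(2k), \<open>b = 1\<close> reads the digits in even positions and
  \<open>b = 3\<close> those in odd positions.\<close>

definition schoenberg :: "real \<Rightarrow> real \<Rightarrow> real" where
  "schoenberg b t = (\<Sum>k. schoenberg_wave (b * 9 ^ k * t) / 2 ^ Suc k)"

text \<open>For digits in {0, 1} this is the point of the Cantor set with ternary digits
  \<open>2 * a k\<close>.\<close>

definition ternary :: "(nat \<Rightarrow> real) \<Rightarrow> real" where
  "ternary a = (\<Sum>k. 2 * a k / 3 ^ Suc k)"

definition binary_digit :: "real \<Rightarrow> nat \<Rightarrow> real" where
  "binary_digit x k = of_int (\<lfloor>2 ^ Suc k * x\<rfloor> - 2 * \<lfloor>2 ^ k * x\<rfloor>)"

lemma schoenberg_wave_bounds: "0 \<le> schoenberg_wave t" "schoenberg_wave t \<le> 1"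
  by (auto simp: schoenberg_wave_def)

lemma schoenberg_wave_periodic: "n \<in> \<int> \<Longrightarrow> schoenberg_wave (2 * n + t) = schoenberg_wave t"
proof -
  assume "n \<in> \<int>"
  then obtain k where "n = of_int k" by (auto elim: Ints_cases)
  then have "pi * (2 * n + t) = pi * t + 2 * pi * of_int k" by (simp add: algebra_simps)
  then have "cos (pi * (2 * n + t)) = cos (pi * t)"
    by (simp only: cos_add cos_int_2pin sin_int_2pin)
  then show ?thesis by (simp add: schoenberg_wave_def)
qed

lemma continuous_schoenberg_wave: "continuous_on UNIV schoenberg_wave"
  unfolding schoenberg_wave_def by (intro continuous_intros)

lemma half_powers_sums: "(\<lambda>k. (1::real) / 2 ^ Suc k) sums 1"
  using power_half_series by (simp add: power_one_over)

lemma continuous_schoenberg: "continuous_on UNIV (schoenberg b)"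
proof -
  have "uniform_limit UNIV (\<lambda>n t. \<Sum>k<n. schoenberg_wave (b * 9 ^ k * t) / 2 ^ Suc k)
     (\<lambda>t. \<Sum>k. schoenberg_wave (b * 9 ^ k * t) / 2 ^ Suc k) sequentially"
    by (rule Weierstrass_m_test[where M = "\<lambda>k. 1 / 2 ^ Suc k"])
       (use half_powers_sums in \<open>auto simp: schoenberg_wave_bounds sums_iff divide_right_mono\<close>)
  then show ?thesis
    unfolding schoenberg_def
    by (rule uniform_limit_theorem[rotated])
       (auto intro!: always_eventually continuous_intros continuous_on_compose2[OF continuous_schoenberg_wave])
qed

lemma ternary_sums:
  assumes "\<And>k. a k \<in> {0, 1}"
  shows "summable (\<lambda>k. 2 * a k / 3 ^ Suc k)" "0 \<le> ternary a" "ternary a \<le> 1"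
proof -
  have g: "(\<lambda>k. (2::real) / 3 ^ Suc k) sums 1"
    using sums_mult[OF geometric_sums[of "1/3::real"], of "2/3"] by (simp add: power_one_over)
  have le: "2 * a k / 3 ^ Suc k \<le> 2 / 3 ^ Suc k" "0 \<le> 2 * a k / 3 ^ Suc k" for k
    using assms[of k] by auto
  show s: "summable (\<lambda>k. 2 * a k / 3 ^ Suc k)"
    by (rule summable_comparison_test'[where g="\<lambda>k. 2 / 3 ^ Suc k"])
       (use g le in \<open>simp_all only: real_norm_def abs_of_nonneg sums_iff\<close>)
  show "0 \<le> ternary a" unfolding ternary_def using le s by (intro suminf_nonneg)
  show "ternary a \<le> 1" unfolding ternary_def
    using suminf_le[OF le(1) s] g by (auto simp: sums_iff)
qed

lemma ternary_shift:
  assumes "\<And>k. a k \<in> {0, 1}"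
  shows "3 * ternary a = 2 * a 0 + ternary (a \<circ> Suc)"
proof -
  have "ternary a = 2 * a 0 / 3 + (\<Sum>k. 2 * a (Suc k) / 3 ^ Suc (Suc k))"
    unfolding ternary_def using suminf_split_head[OF ternary_sums(1)[of a, OF assms]] by simp
  moreover have "3 * (\<Sum>k. 2 * a (Suc k) / 3 ^ Suc (Suc k)) = (\<Sum>k. 3 * (2 * a (Suc k) / 3 ^ Suc (Suc k)))"
    by (rule suminf_mult[symmetric])
       (rule summable_Suc_iff[THEN iffD2, OF ternary_sums(1)[of a, OF assms]])
  moreover have "3 * (2 * a (Suc k) / 3 ^ Suc (Suc k)) = 2 * a (Suc k) / 3 ^ Suc k" for k
    by simp
  ultimately show ?thesis unfolding ternary_def o_def by simp
qed

text \<open>Multiplying by \<open>3 ^ k\<close> shifts the digits and splits off an even integer,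
  hence a multiple of the period. What remains lies in [0, 1/3] or in [2/3, 1] according to its
  leading digit, and on both intervals the wave is constant.\<close>

lemma schoenberg_wave_ternary:
  assumes "\<And>k. a k \<in> {0, 1}"
  shows "schoenberg_wave (3 ^ k * ternary a) = a k"
  using assms
proof (induction k arbitrary: a)
  case 0
  define r where "r = ternary (a \<circ> Suc) / 3"
  have r: "0 \<le> r" "r \<le> 1/3"
    using ternary_sums(2,3)[of "a \<circ> Suc"] 0 by (auto simp: r_def)
  have t: "ternary a = 2 * a 0 / 3 + r"
    using ternary_shift[of a] 0 by (auto simp: r_def)
  have c: "cos (pi * r) \<ge> 1/2"
    using cos_monotone_0_pi_le[of "pi * r" "pi / 3"] r cos_60 by simp
  consider "a 0 = 0" | "a 0 = 1" using 0[of 0] by auto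
  then show ?case
  proof cases
    case 1
    then show ?thesis using c t by (simp add: schoenberg_wave_def)
  next
    case 2
    \<comment> \<open>The point lies in [2/3, 1]; its mirror image under t -> 1 - t lies in
      [0, 1/3], where the cosine is at least 1/2.\<close>
    have "cos (pi - pi * ternary a) \<ge> 1/2"
      using cos_monotone_0_pi_le[of "pi - pi * ternary a" "pi / 3"] r cos_60 2
        mult_left_mono[of "2/3" "ternary a" pi] mult_left_mono[of "ternary a" 1 pi]
      by (simp add: t)
    then show ?thesis using 2 by (simp add: schoenberg_wave_def)
  qed
next
  case (Suc k)
  have "schoenberg_wave (3 ^ Suc k * ternary a)
      = schoenberg_wave (2 * (3 ^ k * a 0) + 3 ^ k * ternary (a \<circ> Suc))"
    using arg_cong[OF ternary_shift[OF Suc.prems], of "(*) (3 ^ k)"] Suc.prems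
    by (simp add: distrib_left mult.assoc mult.left_commute mult.commute[of _ 3])
  also have "\<dots> = schoenberg_wave (3 ^ k * ternary (a \<circ> Suc))"
    using Suc.prems[of 0] by (intro schoenberg_wave_periodic) auto
  also have "\<dots> = a (Suc k)" using Suc.IH[of "a \<circ> Suc"] Suc.prems by (simp add: o_def)
  finally show ?case .
qed

lemma binary_digit_cases: "binary_digit x k \<in> {0, 1}"
proof -
  have "\<lfloor>2 ^ Suc k * x\<rfloor> - 2 * \<lfloor>2 ^ k * x\<rfloor> \<in> {0, 1}" by (simp add: mult.assoc) linarith
  then show ?thesis unfolding binary_digit_def by force
qed

text \<open>The partial sums telescope to the floor of 2^n x divided by 2^n; the range of
  \<open>x\<close> makes the initial floor vanish.\<close>

lemma binary_digit_sums:
  assumes "0 \<le> x" "x < 1"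
  shows "(\<lambda>k. binary_digit x k / 2 ^ Suc k) sums x"
proof -
  have p: "(\<Sum>k<n. binary_digit x k / 2 ^ Suc k) = of_int \<lfloor>2 ^ n * x\<rfloor> / 2 ^ n" for n
  proof (induction n)
    case 0
    then show ?case using assms by (simp add: floor_eq_iff)
  qed (simp add: binary_digit_def field_simps)
  have "(\<lambda>n. of_int \<lfloor>2 ^ n * x\<rfloor> / 2 ^ n) \<longlonglongrightarrow> x"
  proof (rule real_tendsto_sandwich)
    show "\<forall>\<^sub>F n in sequentially. x - (1/2) ^ n \<le> of_int \<lfloor>2 ^ n * x\<rfloor> / 2 ^ n"
    proof (rule always_eventually, rule)
      fix n
      have "2 ^ n * x - 1 \<le> of_int \<lfloor>2 ^ n * x\<rfloor>" by linarith
      then have "(2 ^ n * x - 1) / 2 ^ n \<le> of_int \<lfloor>2 ^ n * x\<rfloor> / 2 ^ n"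
        by (intro divide_right_mono) auto
      then show "x - (1/2) ^ n \<le> of_int \<lfloor>2 ^ n * x\<rfloor> / 2 ^ n"
        by (simp add: diff_divide_distrib power_one_over)
    qed
    show "\<forall>\<^sub>F n in sequentially. of_int \<lfloor>2 ^ n * x\<rfloor> / 2 ^ n \<le> x"
      by (rule always_eventually) (simp add: field_simps)
    show "(\<lambda>n. x - (1/2) ^ n) \<longlonglongrightarrow> x"
      by (rule tendsto_eq_intros LIMSEQ_power_zero | simp)+
  qed auto
  then show ?thesis unfolding sums_def p .
qed

text \<open>The right inverse \<open>s\<close> interleaves the binary digits of the two coordinates
  and stores them as a point of the Cantor set, from which the curve reads them off again. Each
  digit is a Borel function, hence so is \<open>s\<close>. The square is half-open because the digit
  expansion recovers coordinates below 1 only.\<close>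

lemma square_filling_curve:
  obtains p :: "real \<Rightarrow> complex" and s :: "complex \<Rightarrow> real"
  where "continuous_on UNIV p" "s \<in> borel_measurable borel" "\<And>z. s z \<in> {0..1}"
    "\<And>z. \<lbrakk>0 \<le> Re z; Re z < 1; 0 \<le> Im z; Im z < 1\<rbrakk> \<Longrightarrow> p (s z) = z"
proof
  define a where "a z j = (if even j then binary_digit (Re z) (j div 2) else binary_digit (Im z) (j div 2))" for z j
  have a: "a z j \<in> {0, 1}" for z j unfolding a_def using binary_digit_cases by metis
  define p where "p t = Complex (schoenberg 1 t) (schoenberg 3 t)" for t
  define s where "s z = ternary (a z)" for z
  show "continuous_on UNIV p"
    unfolding p_def
    by (rule continuous_on_Complex) (use continuous_schoenberg in \<open>auto\<close>)
  show "s \<in> borel_measurable borel"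
  proof -
    have "(\<lambda>x. binary_digit x k) \<in> borel_measurable borel" for k
      unfolding binary_digit_def by measurable
    then have "(\<lambda>z. a z j) \<in> borel_measurable borel" for j
      unfolding a_def by (cases "even j") (auto intro: measurable_compose[rotated])
    then show ?thesis unfolding s_def ternary_def by measurable
  qed
  show "s z \<in> {0..1}" for z using ternary_sums(2,3)[OF a] by (simp add: s_def)
  fix z assume z: "0 \<le> Re z" "Re z < 1" "0 \<le> Im z" "Im z < 1"
  have w: "schoenberg_wave (3 ^ k * s z) = a z k" for k
    unfolding s_def by (rule schoenberg_wave_ternary[OF a])
  have 9: "(9::real) ^ k = 3 ^ (2 * k)" for k by (simp add: power_mult)
  have "schoenberg 1 (s z) = Re z"
    using w[of "2 * _"] binary_digit_sums[OF z(1,2)]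
    by (simp add: schoenberg_def 9 a_def sums_iff)
  moreover have "schoenberg 3 (s z) = Im z"
    using w[of "Suc (2 * _)"] binary_digit_sums[OF z(3,4)]
    by (simp add: schoenberg_def 9 a_def sums_iff)
  ultimately show "p (s z) = z" by (simp add: p_def complex_eq_iff)
qed

section \<open>Compactness of locally bounded densities\<close>

text \<open>Transported to the line by the Borel inverse of the curve, the densities become measures
  on a bounded interval, where tightness is automatic and Helly's theorem applies. The curve is
  continuous, so it carries the limit back and turns continuous test functions into continuous
  ones.\<close>

lemma bounded_densities_weakly_compact:
  fixes f :: "nat \<Rightarrow> complex \<Rightarrow> real"
  assumes [measurable]: "\<And>n. f n \<in> borel_measurable borel" and nn: "\<And>n x. 0 \<le> f n x"
    and B: "bounded B" "\<And>n x. x \<notin> B \<Longrightarrow> f n x = 0"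
    and M: "\<And>n. (\<integral>\<^sup>+x. ennreal (f n x) \<partial>lborel) \<le> ennreal M"
  obtains r :: "nat \<Rightarrow> nat" and \<nu> :: "complex measure"
  where "strict_mono r" "finite_measure \<nu>" "sets \<nu> = sets borel"
    "\<And>g K. \<lbrakk>continuous_on UNIV g; \<And>x. \<bar>g x\<bar> \<le> (K::real)\<rbrakk> \<Longrightarrow>
       (\<lambda>n. \<integral>x. g x * f (r n) x \<partial>lborel) \<longlonglongrightarrow> (\<integral>x. g x \<partial>\<nu>)"
proof -
  obtain p :: "real \<Rightarrow> complex" and s :: "complex \<Rightarrow> real"
    where p: "continuous_on UNIV p" and [measurable]: "s \<in> borel_measurable borel"
    and s01: "\<And>z. s z \<in> {0..1}"
    and ps: "\<And>z. \<lbrakk>0 \<le> Re z; Re z < 1; 0 \<le> Im z; Im z < 1\<rbrakk> \<Longrightarrow> p (s z) = z"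
    by (rule square_filling_curve) (rule that)
  obtain R where R: "R > 0" "\<And>z. z \<in> B \<Longrightarrow> norm z < R"
    using B(1) by (metis bounded_pos_less)
  define Q where "Q = {z. \<bar>Re z\<bar> < R \<and> \<bar>Im z\<bar> < R}"
  have [measurable]: "Q \<in> sets borel" unfolding Q_def by measurable
  have BQ: "z \<in> Q" if "z \<in> B" for z
    using R(2)[OF that] abs_Re_le_cmod[of z] abs_Im_le_cmod[of z] by (auto simp: Q_def)
  define q where "q t = (2 * R) *\<^sub>R p t - Complex R R" for t
  \<comment> \<open>The value 2 is a parking place, separated from the image [0, 1] of the
    square.\<close>
  define S where "S z = (if z \<in> Q then s ((1 / (2 * R)) *\<^sub>R (z + Complex R R)) else 2)" for z
  have [measurable]: "S \<in> borel_measurable borel" unfolding S_def by measurable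
  have q: "continuous_on UNIV q" unfolding q_def by (intro continuous_intros p)
  then have [measurable]: "q \<in> borel_measurable borel" by (rule borel_measurable_continuous_onI)
  have qS: "q (S z) = z" if "z \<in> Q" for z
  proof -
    let ?y = "(1 / (2 * R)) *\<^sub>R (z + Complex R R)"
    have "p (s ?y) = ?y" using that R(1) by (intro ps) (auto simp: Q_def)
    then show ?thesis using that R(1) by (simp add: q_def S_def)
  qed
  define M1 where "M1 = max M 1"
  have M1: "M1 > 0" "(\<integral>\<^sup>+x. ennreal (f n x) \<partial>lborel) \<le> ennreal M1" for n
    using M[of n] by (auto simp: M1_def intro: order_trans ennreal_leI)
  define c where "c n = (\<integral>\<^sup>+x. ennreal (f n x) \<partial>lborel)" for n
  \<comment> \<open>Helly's theorem is applied to probability measures, so missing mass is placed on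
    this ball. There Re z is at least 2R, so the ball misses \<open>Q\<close> and \<open>S\<close>
    sends all of it to 2.\<close>
  define U :: "complex set" where "U = cball (Complex (3 * R) 0) R"
  have U: "emeasure lborel U \<noteq> 0" "emeasure lborel U \<noteq> \<infinity>" "U \<in> sets borel"
  proof -
    have "measure lborel U > 0" unfolding U_def using R(1) by (intro content_cball_pos)
    then show "emeasure lborel U \<noteq> 0" by (auto simp: measure_def)
    show "emeasure lborel U \<noteq> \<infinity>" unfolding U_def
      using emeasure_bounded_finite[OF bounded_cball] by (metis less_irrefl)
  qed (simp add: U_def)
  note [measurable] = U(3)
  have UQ: "z \<notin> Q" if "z \<in> U" for z
  proof -
    have "\<bar>Re (Complex (3 * R) 0 - z)\<bar> \<le> R"
      using that abs_Re_le_cmod[of "Complex (3 * R) 0 - z"] by (simp add: U_def dist_norm)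
    then show ?thesis using R(1) by (auto simp: Q_def)
  qed
  define h where "h n x = ennreal (f n x) / M1 + (1 - c n / M1) * (indicator U x / emeasure lborel U)" for n x
  have [measurable]: "h n \<in> borel_measurable borel" for n unfolding h_def by measurable
  define P where "P n = distr (density lborel (h n)) borel S" for n
  have cle: "c n / M1 \<le> 1" for n
    using M1 by (simp add: c_def divide_le_posI_ennreal)
  have prob: "prob_space (density lborel (h n))" for n
  proof
    have "(\<integral>\<^sup>+x. h n x \<partial>lborel) = c n / M1 + (1 - c n / M1) * (emeasure lborel U / emeasure lborel U)"
      unfolding h_def c_def
      by (simp add: nn_integral_add nn_integral_cmult nn_integral_divide)
    also have "\<dots> = 1" using U cle[of n] by (simp add: ennreal_divide_self less_top add_diff_inverse_ennreal)
    finally show "emeasure (density lborel (h n)) (space (density lborel (h n))) = 1"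
      by (simp add: emeasure_density)
  qed
  have Srange: "S z \<in> {0..2}" for z using s01[of "(1 / (2 * R)) *\<^sub>R (z + Complex R R)"] by (auto simp: S_def)
  have rd: "real_distribution (P n)" for n
    unfolding P_def by (intro prob_space.real_distribution_distr prob) simp
  have "tight P"
    unfolding tight_def
  proof (intro conjI allI impI)
    fix e :: real assume "e > 0"
    have "measure (P n) {-1<..3} = 1" for n
    proof -
      have "- 1 < S z" "S z \<le> 3" for z using Srange[of z] by auto
      then have "S -` {-1<..3} = UNIV" by auto
      then show ?thesis
        using prob_space.prob_space[OF prob[of n]] by (simp add: P_def measure_distr)
    qed
    then show "\<exists>a b. a < b \<and> (\<forall>n. measure (P n) {a<..b} > 1 - e)"
      using \<open>e > 0\<close> by (intro exI[of _ "-1"] exI[of _ 3]) auto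
  qed (rule rd)
  from tight_imp_convergent_subsubsequence[OF this strict_mono_id]
  obtain r L where r: "strict_mono r" and L: "real_distribution L" and conv: "weak_conv_m (P \<circ> id \<circ> r) L"
    by auto
  interpret L: real_distribution L by fact
  \<comment> \<open>Equal to 1 on [0, 1] and to 0 at 2: multiplying by it deletes the padding mass
    while remaining continuous.\<close>
  define \<eta> :: "real \<Rightarrow> real" where "\<eta> t = max 0 (min 1 (2 - t))" for t
  have \<eta>: "0 \<le> \<eta> t" "\<eta> t \<le> 1" for t by (auto simp: \<eta>_def)
  have \<eta>c: "continuous_on UNIV \<eta>" unfolding \<eta>_def by (intro continuous_intros)
  then have [measurable]: "\<eta> \<in> borel_measurable borel" by (rule borel_measurable_continuous_onI)
  define \<nu> where "\<nu> = distr (density L (\<lambda>t. ennreal (M1 * \<eta> t))) borel q"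
  show thesis
  proof (rule that[OF r, of \<nu>])
    show "sets \<nu> = sets borel" by (simp add: \<nu>_def)
    have "(\<integral>\<^sup>+t. ennreal (M1 * \<eta> t) \<partial>L) \<le> (\<integral>\<^sup>+t. ennreal M1 \<partial>L)"
      using \<eta> M1 by (intro nn_integral_mono ennreal_leI) (auto intro: mult_left_le)
    also have "\<dots> < \<infinity>" using L.emeasure_space_1 by simp
    finally show "finite_measure \<nu>"
      unfolding \<nu>_def by (intro finite_measureI) (simp add: emeasure_distr emeasure_density space_density)
  next
    fix g :: "complex \<Rightarrow> real" and K assume g: "continuous_on UNIV g" and gK: "\<And>x. \<bar>g x\<bar> \<le> K"
    have [measurable]: "g \<in> borel_measurable borel" using g by (rule borel_measurable_continuous_onI)
    have "(\<lambda>n. integral\<^sup>L ((P \<circ> id \<circ> r) n) (\<lambda>t. M1 * \<eta> t * g (q t))) \<longlonglongrightarrow> (\<integral>t. M1 * \<eta> t * g (q t) \<partial>L)"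
    proof (rule weak_conv_imp_integral_bdd_continuous_conv)
      show "real_distribution ((P \<circ> id \<circ> r) n)" for n by (simp add: rd)
      show "isCont (\<lambda>t. M1 * \<eta> t * g (q t)) t" for t
      proof -
        have "continuous_on UNIV (\<lambda>t. M1 * \<eta> t * g (q t))"
          by (intro continuous_on_mult continuous_on_const \<eta>c continuous_on_compose2[OF g q]) auto
        then show ?thesis by (simp add: continuous_on_eq_continuous_at)
      qed
      show "norm (M1 * \<eta> t * g (q t)) \<le> M1 * 1 * K" for t
        unfolding norm_mult using M1 \<eta>[of t] gK[of "q t"]
        by (intro mult_mono) auto
    qed (rule L conv)+
    moreover have "(\<integral>t. M1 * \<eta> t * g (q t) \<partial>L) = (\<integral>x. g x \<partial>\<nu>)"
      unfolding \<nu>_def using M1 \<eta> by (simp add: integral_distr integral_density)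
    moreover have "integral\<^sup>L ((P \<circ> id \<circ> r) n) (\<lambda>t. M1 * \<eta> t * g (q t)) = (\<integral>x. g x * f (r n) x \<partial>lborel)" for n
    proof -
      \<comment> \<open>The change of density for Bochner integrals is applied with a real density,
        so \<open>h\<close> has to be finite everywhere.\<close>
      have hfin: "h m x < \<infinity>" for m x
      proof -
        have "1 - c m / M1 < top" by (rule le_less_trans[of _ 1]) (auto simp: diff_le_self_ennreal)
        moreover have "1 / emeasure lborel U < top" "ennreal (f m x) / M1 < top"
          using U M1 by (simp_all add: ennreal_divide_eq_top_iff flip: less_top)
        ultimately show ?thesis by (auto simp: h_def indicator_def ennreal_mult_less_top)
      qed
      have "integral\<^sup>L ((P \<circ> id \<circ> r) n) (\<lambda>t. M1 * \<eta> t * g (q t))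
        = (\<integral>x. M1 * \<eta> (S x) * g (q (S x)) \<partial>density lborel (\<lambda>x. ennreal (enn2real (h (r n) x))))"
        using hfin by (simp add: P_def integral_distr)
      also have "\<dots> = (\<integral>x. enn2real (h (r n) x) * (M1 * \<eta> (S x) * g (q (S x))) \<partial>lborel)"
        by (subst integral_density) auto
      also have "\<dots> = (\<integral>x. g x * f (r n) x \<partial>lborel)"
      proof (rule Bochner_Integration.integral_cong)
        fix x
        show "enn2real (h (r n) x) * (M1 * \<eta> (S x) * g (q (S x))) = g x * f (r n) x"
        proof (cases "x \<in> Q")
          case True
          then have "S x \<le> 1" using s01 by (auto simp: S_def)
          then have "\<eta> (S x) = 1" by (simp add: \<eta>_def)
          moreover have "x \<notin> U" using UQ True by blast
          then have "h (r n) x = ennreal (f (r n) x / M1)"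
            using M1 nn by (simp add: h_def divide_ennreal)
          ultimately show ?thesis using M1 nn True by (simp add: qS enn2real_ennreal)
        next
          case False
          then have "\<eta> (S x) = 0" "f (r n) x = 0" using BQ B(2)[of x] by (auto simp: \<eta>_def S_def)
          then show ?thesis by simp
        qed
      qed simp
      finally show ?thesis .
    qed
    ultimately show "(\<lambda>n. \<integral>x. g x * f (r n) x \<partial>lborel) \<longlonglongrightarrow> (\<integral>x. g x \<partial>\<nu>)" by simp
  qed
qed

text \<open>A weight that decays fast enough towards the boundary merges the bounds on all compact
  sets into one global bound. Compactness is then applied once, without a diagonal argument over an
  exhaustion.\<close>

lemma exhausting_weight:
  fixes f :: "nat \<Rightarrow> complex \<Rightarrow> real"
  assumes \<Omega>: "open \<Omega>" "bounded \<Omega>" and [measurable]: "\<And>n. f n \<in> borel_measurable borel"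
    and bnd: "\<And>K. \<lbrakk>compact K; K \<subseteq> \<Omega>\<rbrakk> \<Longrightarrow> \<exists>C. \<forall>n. (\<integral>\<^sup>+x\<in>K. ennreal \<bar>f n x\<bar> \<partial>lborel) \<le> ennreal C"
  obtains w :: "complex \<Rightarrow> real"
  where "continuous_on UNIV w" "\<And>x. x \<in> \<Omega> \<Longrightarrow> 0 < w x" "\<And>x. x \<notin> \<Omega> \<Longrightarrow> w x = 0"
    "\<And>n. (\<integral>\<^sup>+x. ennreal (w x * \<bar>f n x\<bar>) \<partial>lborel) \<le> 2"
proof -
  have ne: "- \<Omega> \<noteq> {}" using \<Omega>(2) not_bounded_UNIV by (metis Compl_empty_eq double_complement)
  define d where "d x = infdist x (- \<Omega>)" for x
  have dc: "continuous_on UNIV d" unfolding d_def by (intro continuous_intros)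
  have d0: "d x = 0" if "x \<notin> \<Omega>" for x using that by (simp add: d_def)
  have dp: "d x > 0" if "x \<in> \<Omega>" for x
    using that \<Omega>(1) ne unfolding d_def by (intro infdist_pos_not_in_closed) auto
  define K where "K j = {x. 1 / real (Suc j) \<le> d x}" for j
  have Ksub: "K j \<subseteq> \<Omega>" for j
  proof
    fix x assume "x \<in> K j"
    moreover have "0 < 1 / real (Suc j)" by simp
    ultimately show "x \<in> \<Omega>" using d0[of x] by (force simp: K_def)
  qed
  have "closed (K j)" for j unfolding K_def using dc by (intro closed_Collect_le) auto
  then have Kc: "compact (K j)" for j
    using bounded_subset[OF \<Omega>(2) Ksub] by (simp add: compact_eq_bounded_closed)
  then have [measurable]: "K j \<in> sets borel" for j by (simp add: borel_compact)
  have "\<forall>j. \<exists>C. \<forall>n. (\<integral>\<^sup>+x\<in>K j. ennreal \<bar>f n x\<bar> \<partial>lborel) \<le> ennreal C"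
    using bnd Kc Ksub by blast
  then obtain C' where C': "\<And>j n. (\<integral>\<^sup>+x\<in>K j. ennreal \<bar>f n x\<bar> \<partial>lborel) \<le> ennreal (C' j)" by metis
  define C where "C j = max 0 (C' j)" for j
  have C: "C j \<ge> 0" "(\<integral>\<^sup>+x\<in>K j. ennreal \<bar>f n x\<bar> \<partial>lborel) \<le> ennreal (C j)" for j n
    using C'[where j=j and n=n] by (auto simp: C_def intro: order_trans ennreal_leI)
  \<comment> \<open>Dividing by \<open>1 + C j\<close> serves twice:
    \<open>a j \<le> (1/2) ^ j\<close> makes the series for the weight converge uniformly, and
    \<open>a j * C j \<le> (1/2) ^ j\<close> bounds the weighted masses by a geometric series with
    sum 2.\<close>
  define a where "a j = (1/2) ^ j / (1 + C j)" for j
  have a: "0 < a j" "a j \<le> (1/2) ^ j" "a j * C j \<le> (1/2) ^ j" for j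
  proof -
    have 1: "0 < 1 + C j" using C(1)[of j] by simp
    then show "0 < a j" by (simp add: a_def)
    have "(1/2) ^ j * 1 \<le> (1/2) ^ j * (1 + C j)" "(1/2) ^ j * C j \<le> (1/2) ^ j * (1 + C j)"
      using C(1)[of j] by (auto intro: mult_left_mono)
    then show "a j \<le> (1/2) ^ j" "a j * C j \<le> (1/2) ^ j"
      using 1 by (simp_all add: a_def pos_divide_le_eq)
  qed
  define b where "b j x = min 1 (max 0 (d x - 1 / real (Suc j)))" for j x
  have b: "0 \<le> b j x" "b j x \<le> 1" for j x by (auto simp: b_def)
  have bK: "b j x \<le> indicator (K j) x" for j x by (cases "x \<in> K j") (auto simp: b_def K_def)
  have ab: "0 \<le> a j * b j x" "a j * b j x \<le> (1/2) ^ j" for j x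
    using a[of j] b[of j x] mult_mono[of "a j" "(1/2)^j" "b j x" 1] by auto
  have sm: "summable (\<lambda>j. a j * b j x)" for x
    by (rule summable_comparison_test'[where g="\<lambda>j. (1/2) ^ j"]) (use ab in auto)
  define w where "w x = (\<Sum>j. a j * b j x)" for x
  show thesis
  proof (rule that[of w])
    have bc: "continuous_on UNIV (b j)" for j unfolding b_def by (intro continuous_intros dc)
    have "uniform_limit UNIV (\<lambda>n x. \<Sum>j<n. a j * b j x) w sequentially"
      unfolding w_def
      by (rule Weierstrass_m_test[where M = "\<lambda>j. (1/2) ^ j"]) (use ab in auto)
    then show "continuous_on UNIV w"
      by (rule uniform_limit_theorem[rotated])
         (auto intro!: always_eventually continuous_intros bc)
    show "w x > 0" if x: "x \<in> \<Omega>" for x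
    proof -
      obtain j where "1 / real (Suc j) < d x"
        using dp[OF x] nat_approx_posE by metis
      then have "a j * b j x > 0" using a[of j] by (auto simp: b_def)
      then show ?thesis unfolding w_def using ab sm by (intro suminf_pos2[where i=j]) auto
    qed
    show "w x = 0" if "x \<notin> \<Omega>" for x
      unfolding w_def using d0[OF that] by (simp add: b_def)
    fix n
    have [measurable]: "b j \<in> borel_measurable borel" for j using bc by (rule borel_measurable_continuous_onI)
    have "(\<integral>\<^sup>+x. ennreal (w x * \<bar>f n x\<bar>) \<partial>lborel) = (\<integral>\<^sup>+x. (\<Sum>j. ennreal (a j * b j x * \<bar>f n x\<bar>)) \<partial>lborel)"
    proof (rule nn_integral_cong)
      fix x
      show "ennreal (w x * \<bar>f n x\<bar>) = (\<Sum>j. ennreal (a j * b j x * \<bar>f n x\<bar>))"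
        unfolding w_def using ab sm
        by (subst suminf_ennreal2) (auto intro: summable_mult2 simp: suminf_mult2)
    qed
    also have "\<dots> = (\<Sum>j. \<integral>\<^sup>+x. ennreal (a j * b j x * \<bar>f n x\<bar>) \<partial>lborel)"
      by (rule nn_integral_suminf) measurable
    also have "\<dots> \<le> (\<Sum>j. ennreal ((1/2) ^ j))"
    proof (intro suminf_le allI)
      fix j
      have "(\<integral>\<^sup>+x. ennreal (a j * b j x * \<bar>f n x\<bar>) \<partial>lborel)
          \<le> (\<integral>\<^sup>+x. ennreal (a j) * (ennreal \<bar>f n x\<bar> * indicator (K j) x) \<partial>lborel)"
      proof (rule nn_integral_mono)
        fix x
        have "a j * b j x * \<bar>f n x\<bar> \<le> a j * (\<bar>f n x\<bar> * indicator (K j) x)"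
          using mult_left_mono[OF mult_right_mono[OF bK[of j x], of "\<bar>f n x\<bar>"], of "a j"] a[of j]
          by (simp add: mult_ac)
        then show "ennreal (a j * b j x * \<bar>f n x\<bar>) \<le> ennreal (a j) * (ennreal \<bar>f n x\<bar> * indicator (K j) x)"
          using a[of j] by (auto simp: indicator_def ennreal_leI ennreal_neg mult_le_0_iff mult.assoc simp flip: ennreal_mult split: if_splits)
      qed
      also have "\<dots> = ennreal (a j) * (\<integral>\<^sup>+x\<in>K j. ennreal \<bar>f n x\<bar> \<partial>lborel)"
        by (rule nn_integral_cmult) measurable
      also have "\<dots> \<le> ennreal (a j) * ennreal (C j)"
        by (intro mult_left_mono C(2)) auto
      also have "\<dots> \<le> ennreal ((1/2) ^ j)"
        using a[of j] C(1)[of j] by (simp flip: ennreal_mult add: ennreal_leI)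
      finally show "(\<integral>\<^sup>+x. ennreal (a j * b j x * \<bar>f n x\<bar>) \<partial>lborel) \<le> ennreal ((1/2) ^ j)" .
    qed auto
    also have "\<dots> = ennreal (\<Sum>j. (1/2) ^ j)"
      by (intro suminf_ennreal2) auto
    also have "\<dots> = 2"
      using geometric_sums[of "1/2::real"] by (simp add: sums_iff)
    finally show "(\<integral>\<^sup>+x. ennreal (w x * \<bar>f n x\<bar>) \<partial>lborel) \<le> 2" .
  qed
qed

text \<open>The weighted positive and negative parts converge along a common subsequence, and
  dividing the limits by the weight undoes the weighting. The weight has a positive minimum on each
  nonempty compact subset of \<Omega>, so the quotients stay locally finite.\<close>

lemma locally_bounded_densities_compact:
  fixes f :: "nat \<Rightarrow> complex \<Rightarrow> real"
  assumes \<Omega>: "open \<Omega>" "bounded \<Omega>" and f[measurable]: "\<And>n. f n \<in> borel_measurable borel"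
    and bnd: "\<And>K. \<lbrakk>compact K; K \<subseteq> \<Omega>\<rbrakk> \<Longrightarrow> \<exists>C. \<forall>n. (\<integral>\<^sup>+x\<in>K. ennreal \<bar>f n x\<bar> \<partial>lborel) \<le> ennreal C"
  obtains r :: "nat \<Rightarrow> nat" and \<mu>1 \<mu>2 :: "complex measure"
  where "strict_mono r" "sets \<mu>1 = sets borel" "sets \<mu>2 = sets borel"
    "emeasure \<mu>1 (UNIV - \<Omega>) = 0" "emeasure \<mu>2 (UNIV - \<Omega>) = 0"
    "\<And>K. \<lbrakk>compact K; K \<subseteq> \<Omega>\<rbrakk> \<Longrightarrow> emeasure \<mu>1 K < \<infinity> \<and> emeasure \<mu>2 K < \<infinity>"
    "\<And>\<phi>. \<lbrakk>continuous_on UNIV \<phi>; compact (closure {x. \<phi> x \<noteq> 0}); closure {x. \<phi> x \<noteq> 0} \<subseteq> \<Omega>\<rbrakk> \<Longrightarrow>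
       (\<lambda>n. \<integral>x. \<phi> x * f (r n) x \<partial>lborel) \<longlonglongrightarrow> (\<integral>x. \<phi> x \<partial>\<mu>1) - (\<integral>x. \<phi> x \<partial>\<mu>2)"
proof -
  obtain w :: "complex \<Rightarrow> real"
    where wc: "continuous_on UNIV w" and wp: "\<And>x. x \<in> \<Omega> \<Longrightarrow> 0 < w x" and w0: "\<And>x. x \<notin> \<Omega> \<Longrightarrow> w x = 0"
      and wf: "\<And>n. (\<integral>\<^sup>+x. ennreal (w x * \<bar>f n x\<bar>) \<partial>lborel) \<le> 2"
    using exhausting_weight[OF assms] by blast
  have [measurable]: "w \<in> borel_measurable borel" using wc by (rule borel_measurable_continuous_onI)
  have [measurable]: "\<Omega> \<in> sets borel" using \<Omega>(1) by simp
  have wnn: "0 \<le> w x" for x using wp[of x] w0[of x] by fastforce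
  define F1 F2 where "F1 n x = w x * max 0 (f n x)" and "F2 n x = w x * max 0 (- f n x)" for n x
  have [measurable]: "F1 n \<in> borel_measurable borel" "F2 n \<in> borel_measurable borel" for n
    unfolding F1_def F2_def by measurable
  have Fnn: "0 \<le> F1 n x" "0 \<le> F2 n x" for n x using wnn by (auto simp: F1_def F2_def)
  have F0: "F1 n x = 0" "F2 n x = 0" if "x \<notin> \<Omega>" for n x using w0[OF that] by (auto simp: F1_def F2_def)
  have Fle: "F1 n x \<le> w x * \<bar>f n x\<bar>" "F2 n x \<le> w x * \<bar>f n x\<bar>" for n x
    using wnn[of x] by (auto simp: F1_def F2_def intro!: mult_left_mono)
  have F2: "(\<integral>\<^sup>+x. ennreal (F1 n x) \<partial>lborel) \<le> ennreal 2" "(\<integral>\<^sup>+x. ennreal (F2 n x) \<partial>lborel) \<le> ennreal 2" for n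
    using Fle wf[of n] by (auto intro!: order_trans[OF nn_integral_mono wf] ennreal_leI)
  have Fint: "integrable lborel (F1 n)" "integrable lborel (F2 n)" for n
    using F2[of n] Fnn by (auto intro!: integrableI_nonneg le_less_trans[OF F2(1)] le_less_trans[OF F2(2)])
  obtain r1 \<nu>1 where r1: "strict_mono r1" and fin1: "finite_measure \<nu>1" and sets1: "sets \<nu>1 = sets borel"
    and conv1: "\<And>g K. \<lbrakk>continuous_on UNIV g; \<And>x. \<bar>g x\<bar> \<le> (K::real)\<rbrakk> \<Longrightarrow>
       (\<lambda>n. \<integral>x. g x * F1 (r1 n) x \<partial>lborel) \<longlonglongrightarrow> (\<integral>x. g x \<partial>\<nu>1)"
    using bounded_densities_weakly_compact[of F1 \<Omega> 2] F0 F2 Fnn \<Omega>(2) by auto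
  obtain r2 \<nu>2 where r2: "strict_mono r2" and fin2: "finite_measure \<nu>2" and sets2: "sets \<nu>2 = sets borel"
    and conv2: "\<And>g K. \<lbrakk>continuous_on UNIV g; \<And>x. \<bar>g x\<bar> \<le> (K::real)\<rbrakk> \<Longrightarrow>
       (\<lambda>n. \<integral>x. g x * F2 (r1 (r2 n)) x \<partial>lborel) \<longlonglongrightarrow> (\<integral>x. g x \<partial>\<nu>2)"
    using bounded_densities_weakly_compact[of "\<lambda>n. F2 (r1 n)" \<Omega> 2] F0 F2 Fnn \<Omega>(2) by auto
  \<comment> \<open>The indicator discards limit mass that may have accumulated on the boundary,
    where the weight vanishes.\<close>
  define h where "h x = indicator \<Omega> x / w x" for x
  have [measurable]: "h \<in> borel_measurable borel" unfolding h_def by measurable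
  have hnn: "0 \<le> h x" for x using wnn by (simp add: h_def)
  define D where "D \<nu> = density \<nu> (\<lambda>x. ennreal (h x))" for \<nu>
  have out: "emeasure (D \<nu>) (UNIV - \<Omega>) = 0" if "sets \<nu> = sets borel" for \<nu>
    unfolding D_def using that
    by (subst emeasure_density) (auto simp: measurable_cong_sets[OF that] h_def nn_integral_0_iff_AE indicator_def intro!: AE_I2)
  have cpt: "emeasure (D \<nu>) K < \<infinity>" if \<nu>: "sets \<nu> = sets borel" "finite_measure \<nu>"
    and K: "compact K" "K \<subseteq> \<Omega>" for \<nu> K
  proof (cases "K = {}")
    case False
    obtain k where k: "k \<in> K" "\<forall>x\<in>K. w k \<le> w x"
      using continuous_attains_inf[OF K(1) False continuous_on_subset[OF wc subset_UNIV]] by blast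
    have wk: "w k > 0" using wp k K by blast
    have Km: "K \<in> sets \<nu>" using K \<nu> by (simp add: borel_compact)
    have "emeasure (D \<nu>) K = (\<integral>\<^sup>+x. ennreal (h x) * indicator K x \<partial>\<nu>)"
      unfolding D_def using \<nu> Km by (subst emeasure_density) (auto simp: measurable_cong_sets[OF \<nu>(1)])
    also have "\<dots> \<le> (\<integral>\<^sup>+x. ennreal (1 / w k) * indicator K x \<partial>\<nu>)"
    proof (rule nn_integral_mono)
      fix x
      have "h x \<le> 1 / w k" if "x \<in> K"
        using bspec[OF k(2) that] wk K(2) that by (auto simp: h_def subsetD intro!: divide_left_mono mult_pos_pos)
      then show "ennreal (h x) * indicator K x \<le> ennreal (1 / w k) * indicator K x"
        by (auto simp: indicator_def ennreal_leI)
    qed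
    also have "\<dots> = ennreal (1 / w k) * emeasure \<nu> K" using Km by (rule nn_integral_cmult_indicator)
    also have "\<dots> < \<infinity>"
      using finite_measure.emeasure_finite[OF \<nu>(2)] by (simp add: ennreal_mult_less_top less_top)
    finally show ?thesis .
  qed simp
  show thesis
  proof (rule that[of "r1 \<circ> r2" "D \<nu>1" "D \<nu>2"])
    show "strict_mono (r1 \<circ> r2)" using r1 r2 by (rule strict_mono_o)
    show "sets (D \<nu>1) = sets borel" "sets (D \<nu>2) = sets borel" using sets1 sets2 by (simp_all add: D_def)
    show "emeasure (D \<nu>1) (UNIV - \<Omega>) = 0" "emeasure (D \<nu>2) (UNIV - \<Omega>) = 0" using out sets1 sets2 by auto
    show "emeasure (D \<nu>1) K < \<infinity> \<and> emeasure (D \<nu>2) K < \<infinity>" if "compact K" "K \<subseteq> \<Omega>" for K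
      using cpt that sets1 sets2 fin1 fin2 by blast
    fix \<phi> :: "complex \<Rightarrow> real"
    assume \<phi>: "continuous_on UNIV \<phi>" "compact (closure {x. \<phi> x \<noteq> 0})" "closure {x. \<phi> x \<noteq> 0} \<subseteq> \<Omega>"
    \<comment> \<open>Since \<phi> has compact support in \<Omega>, the quotient is continuous and
      bounded. Outside \<Omega> both terms vanish and the convention for division by 0 gives the
      right value 0.\<close>
    define g where "g x = \<phi> x / w x" for x
    have [measurable]: "\<phi> \<in> borel_measurable borel" using \<phi>(1) by (rule borel_measurable_continuous_onI)
    have z: "\<phi> x = 0" if "x \<notin> closure {x. \<phi> x \<noteq> 0}" for x
      using that closure_subset[of "{x. \<phi> x \<noteq> 0}"] by blast
    have gc: "continuous_on UNIV g"
    proof -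
      have "continuous_on \<Omega> g" unfolding g_def
        by (intro continuous_intros continuous_on_subset[OF \<phi>(1)] continuous_on_subset[OF wc])
           (use wp in force)+
      moreover have "continuous_on (- closure {x. \<phi> x \<noteq> 0}) g"
      proof (subst continuous_on_cong[OF refl])
        show "g x = 0" if "x \<in> - closure {x. \<phi> x \<noteq> 0}" for x
          using z[of x] that unfolding g_def by (metis ComplD div_0)
      qed (rule continuous_on_const)
      moreover have "\<Omega> \<union> - closure {x. \<phi> x \<noteq> 0} = UNIV" using \<phi>(3) by blast
      ultimately show ?thesis
        using continuous_on_open_Un[of \<Omega> "- closure {x. \<phi> x \<noteq> 0}" g] \<Omega>(1) by (simp add: open_Compl)
    qed
    obtain k where gk: "\<bar>g x\<bar> \<le> k" for x
    proof -
      have "bounded (g ` closure {x. \<phi> x \<noteq> 0})"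
        using gc \<phi>(2) by (intro compact_imp_bounded compact_continuous_image continuous_on_subset[OF gc]) auto
      then obtain k where k: "k > 0" "\<And>x. x \<in> closure {x. \<phi> x \<noteq> 0} \<Longrightarrow> \<bar>g x\<bar> \<le> k"
        unfolding bounded_pos by auto
      show thesis
      proof (rule that[of k])
        fix x show "\<bar>g x\<bar> \<le> k"
          using k z[of x] by (cases "x \<in> closure {x. \<phi> x \<noteq> 0}") (auto simp: g_def)
      qed
    qed
    have [measurable]: "g \<in> borel_measurable borel" using gc by (rule borel_measurable_continuous_onI)
    have gw: "g x * w x = \<phi> x" for x using wp[of x] z[of x] \<phi>(3) by (cases "x \<in> \<Omega>") (auto simp: g_def)
    have gint: "integrable lborel (\<lambda>x. g x * F1 n x)" "integrable lborel (\<lambda>x. g x * F2 n x)" for n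
    proof -
      have "integrable lborel (\<lambda>x. g x * F x)" if F: "integrable lborel F" "\<And>x. 0 \<le> F x" for F
      proof (rule Bochner_Integration.integrable_bound[OF integrable_mult_right[OF F(1), of k]])
        show "(\<lambda>x. g x * F x) \<in> borel_measurable lborel"
          using borel_measurable_integrable[OF F(1)] by simp
        show "AE x in lborel. norm (g x * F x) \<le> norm (k * F x)"
          using gk F(2) by (auto simp: abs_mult intro!: mult_right_mono order_trans[OF gk] AE_I2)
      qed
      then show "integrable lborel (\<lambda>x. g x * F1 n x)" "integrable lborel (\<lambda>x. g x * F2 n x)"
        using Fint Fnn by auto
    qed
    have eq: "(\<integral>x. \<phi> x * f n x \<partial>lborel) = (\<integral>x. g x * F1 n x \<partial>lborel) - (\<integral>x. g x * F2 n x \<partial>lborel)" for n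
    proof -
      have "\<phi> x * f n x = g x * F1 n x - g x * F2 n x" for x
        by (simp add: F1_def F2_def gw[symmetric] max_def algebra_simps)
      then show ?thesis by (simp add: Bochner_Integration.integral_diff gint)
    qed
    have lim: "(\<integral>x. \<phi> x \<partial>D \<nu>) = (\<integral>x. g x \<partial>\<nu>)" if \<nu>: "sets \<nu> = sets borel" for \<nu>
    proof -
      have hg: "(\<lambda>x. h x *\<^sub>R \<phi> x) = g"
      proof
        fix x show "h x *\<^sub>R \<phi> x = g x"
          using z[of x] \<phi>(3) by (cases "x \<in> \<Omega>") (auto simp: h_def g_def)
      qed
      have "(\<integral>x. \<phi> x \<partial>D \<nu>) = (\<integral>x. h x *\<^sub>R \<phi> x \<partial>\<nu>)"
        unfolding D_def using hnn by (subst integral_density) (auto simp: measurable_cong_sets[OF \<nu>])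
      then show ?thesis unfolding hg .
    qed
    have "(\<lambda>n. \<integral>x. g x * F1 (r1 (r2 n)) x \<partial>lborel) \<longlonglongrightarrow> (\<integral>x. g x \<partial>\<nu>1)"
      using LIMSEQ_subseq_LIMSEQ[OF conv1[OF gc gk] r2] by (simp add: o_def)
    from tendsto_diff[OF this conv2[OF gc gk]]
    show "(\<lambda>n. \<integral>x. \<phi> x * f ((r1 \<circ> r2) n) x \<partial>lborel) \<longlonglongrightarrow> (\<integral>x. \<phi> x \<partial>D \<nu>1) - (\<integral>x. \<phi> x \<partial>D \<nu>2)"
      unfolding eq lim[OF sets1] lim[OF sets2] o_def .
  qed
qed

section \<open>A smooth bump function\<close>

text \<open>Coinduction needs a class closed under directional derivatives. The free factor
  \<open>k\<close> provides it: each derivative of the composition only multiplies \<open>k\<close>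
  by \<open>c\<close>.\<close>

lemma smooth_R2_scaled_affine:
  assumes "smooth_R2 f"
  shows "smooth_R2 (\<lambda>x. k * f (c *\<^sub>R x + a))"
proof -
  define X where "X = (\<lambda>g. \<exists>f k. smooth_R2 f \<and> g = (\<lambda>x. k * f (c *\<^sub>R x + a)))"
  have "smooth_R2 h" if "X h" for h
    using that
  proof (coinduction arbitrary: h rule: smooth_R2.coinduct)
    case smooth_R2
    then obtain g l where g: "smooth_R2 g" and h_def: "h = (\<lambda>x. l * g (c *\<^sub>R x + a))"
      unfolding X_def by blast
    have dg: "g differentiable (at x)" and cg: "continuous_on UNIV g"
      and sg: "smooth_R2 (\<lambda>x. frechet_derivative g (at x) v)" for x v
      using g by (auto elim: smooth_R2.cases)
    have D: "(h has_derivative (\<lambda>v. l * frechet_derivative g (at (c *\<^sub>R x + a)) (c *\<^sub>R v))) (at x)" for x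
      unfolding h_def
      by (rule has_derivative_mult_right, rule has_derivative_compose[of "\<lambda>x. c *\<^sub>R x + a", where g = g])
         (use dg in \<open>auto intro!: derivative_eq_intros simp: frechet_derivative_works[symmetric]\<close>)
    have fd: "frechet_derivative h (at x) v = (l * c) * frechet_derivative g (at (c *\<^sub>R x + a)) v" for x v
      by (simp add: frechet_derivative_at[OF D[of x], symmetric] linear_scale[OF linear_frechet_derivative[OF dg]])
    have "\<forall>x. h differentiable (at x)" using D by (auto simp: differentiable_def)
    moreover have "continuous_on UNIV h"
      using D by (meson continuous_at_imp_continuous_on has_derivative_continuous)
    moreover have "X (\<lambda>x. frechet_derivative h (at x) v)" for v
      unfolding X_def fd using sg by blast
    ultimately show ?case by blast
  qed
  then show ?thesis unfolding X_def using assms by blast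
qed

section \<open>Flat exponentials and the algebra they generate\<close>

definition flat_exp :: "real poly \<Rightarrow> real \<Rightarrow> real" where
  "flat_exp P t = (if t > 0 then poly P (1 / t) * exp (- (1 / t)) else 0)"

lemma poly_exp_neg_tendsto_0: "((\<lambda>x::real. poly P x * exp (- x)) \<longlongrightarrow> 0) at_top"
proof -
  have "((\<lambda>x. \<Sum>i\<le>degree P. coeff P i * (x ^ i / exp x)) \<longlongrightarrow> (\<Sum>i\<le>degree P. coeff P i * 0)) at_top"
    by (intro tendsto_intros tendsto_power_div_exp_0)
  moreover have "(\<Sum>i\<le>degree P. coeff P i * (x ^ i / exp x)) = poly P x * exp (- x)" for x
    by (simp only: poly_altdef exp_minus divide_inverse sum_distrib_right mult.assoc)
  ultimately show ?thesis by simp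
qed

text \<open>Differentiating P(1/t) exp(-1/t) replaces P by X^2 (P - P'), so the family is closed
  under derivatives. At 0 the right difference quotient has the same form with polynomial X P and
  tends to 0 because the exponential wins.\<close>

lemma flat_exp_DERIV: "(flat_exp P has_real_derivative flat_exp ([:0, 0, 1:] * (P - pderiv P)) t) (at t)"
proof -
  consider "t > 0" | "t < 0" | "t = 0" by linarith
  then show ?thesis
  proof cases
    case 1
    have i: "((\<lambda>t. 1 / t) has_real_derivative - (1 / t^2)) (at t)"
      using DERIV_inverse[of t] 1 by (simp add: inverse_eq_divide power2_eq_square power_one_over)
    note DERIV_mult[OF DERIV_chain2[OF poly_DERIV i, of P] DERIV_chain2[OF DERIV_exp DERIV_minus[OF i]]]
    then have "((\<lambda>t. poly P (1 / t) * exp (- (1 / t))) has_real_derivative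
        flat_exp ([:0, 0, 1:] * (P - pderiv P)) t) (at t)"
      by (rule DERIV_cong) (use 1 in \<open>simp add: flat_exp_def power2_eq_square algebra_simps\<close>)
    moreover have ev: "\<forall>\<^sub>F x in nhds t. poly P (1 / x) * exp (- (1 / x)) = flat_exp P x"
      using eventually_nhds_in_open[of "{0<..}" t] 1
      by (auto elim!: eventually_mono simp: flat_exp_def)
    ultimately show ?thesis using DERIV_cong_ev[OF refl ev refl] by simp
  next
    case 2
    have ev: "\<forall>\<^sub>F x in nhds t. 0 = flat_exp P x"
      using eventually_nhds_in_open[of "{..<0}" t] 2
      by (auto elim!: eventually_mono simp: flat_exp_def)
    moreover have "((\<lambda>_. 0) has_real_derivative flat_exp ([:0, 0, 1:] * (P - pderiv P)) t) (at t)"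
      using 2 by (simp add: flat_exp_def)
    ultimately show ?thesis using DERIV_cong_ev[OF refl ev refl] by simp
  next
    case 3
    have l: "((\<lambda>x. flat_exp P x / x) \<longlongrightarrow> 0) (at_left 0)"
      by (rule tendsto_eventually)
         (use eventually_at_left[of "-1" "0::real"] in \<open>auto simp: flat_exp_def eventually_at_filter\<close>)
    have "((\<lambda>x. poly (pCons 0 P) (inverse x) * exp (- (inverse x))) \<longlongrightarrow> 0) (at_right 0)"
      by (rule filterlim_compose[OF poly_exp_neg_tendsto_0 filterlim_inverse_at_top_right])
    then have r: "((\<lambda>x. flat_exp P x / x) \<longlongrightarrow> 0) (at_right 0)"
      by (rule Lim_transform_eventually)
         (auto simp: eventually_at_filter flat_exp_def field_simps)
    have "((\<lambda>x. flat_exp P x / x) \<longlongrightarrow> 0) (at 0)"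
      using l r by (simp add: filterlim_split_at)
    then show ?thesis using 3 by (simp add: has_field_derivative_iff flat_exp_def)
  qed
qed

text \<open>The Leibniz rule forces sums and products into the class. So enlarged, it is closed
  under directional derivatives and can serve as invariant for the coinductive notion of
  smoothness.\<close>

inductive bump_algebra :: "(complex \<Rightarrow> real) \<Rightarrow> bool" where
  Re: "bump_algebra (\<lambda>z. flat_exp P (c * Re z + d))"
| Im: "bump_algebra (\<lambda>z. flat_exp P (c * Im z + d))"
| scale: "bump_algebra f \<Longrightarrow> bump_algebra (\<lambda>z. k * f z)"
| add: "bump_algebra f \<Longrightarrow> bump_algebra g \<Longrightarrow> bump_algebra (\<lambda>z. f z + g z)"
| mult: "bump_algebra f \<Longrightarrow> bump_algebra g \<Longrightarrow> bump_algebra (\<lambda>z. f z * g z)"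

lemma bump_algebra_derivative:
  assumes "bump_algebra f"
  shows "\<exists>D. (\<forall>x. (f has_derivative D x) (at x)) \<and> (\<forall>v. bump_algebra (\<lambda>x. D x v))"
  using assms
proof induction
  case (Re P c d)
  let ?Q = "[:0, 0, 1:] * (P - pderiv P)"
  have "((\<lambda>z. flat_exp P (c * Re z + d)) has_derivative
      (\<lambda>v. (c * Re v) * flat_exp ?Q (c * Re x + d))) (at x)" for x
    by (rule has_derivative_compose[OF _ flat_exp_DERIV[THEN has_field_derivative_imp_has_derivative], THEN has_derivative_eq_rhs])
       (auto intro!: derivative_eq_intros simp: fun_eq_iff)
  then show ?case using bump_algebra.scale[OF bump_algebra.Re] by (intro exI conjI allI)
next
  case (Im P c d)
  let ?Q = "[:0, 0, 1:] * (P - pderiv P)"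
  have "((\<lambda>z. flat_exp P (c * Im z + d)) has_derivative
      (\<lambda>v. (c * Im v) * flat_exp ?Q (c * Im x + d))) (at x)" for x
    by (rule has_derivative_compose[OF _ flat_exp_DERIV[THEN has_field_derivative_imp_has_derivative], THEN has_derivative_eq_rhs])
       (auto intro!: derivative_eq_intros simp: fun_eq_iff)
  then show ?case using bump_algebra.scale[OF bump_algebra.Im] by (intro exI conjI allI)
next
  case (scale f k)
  then obtain D where D: "\<forall>x. (f has_derivative D x) (at x)" "\<forall>v. bump_algebra (\<lambda>x. D x v)" by blast
  show ?case
    by (rule exI[of _ "\<lambda>x v. k * D x v"])
       (use D in \<open>auto intro!: bump_algebra.intros has_derivative_mult_right\<close>)
next
  case (add f g)
  then obtain D E where D: "\<forall>x. (f has_derivative D x) (at x)" "\<forall>v. bump_algebra (\<lambda>x. D x v)"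
    "\<forall>x. (g has_derivative E x) (at x)" "\<forall>v. bump_algebra (\<lambda>x. E x v)" by blast
  show ?case
    by (rule exI[of _ "\<lambda>x v. D x v + E x v"])
       (use D in \<open>auto intro!: bump_algebra.add has_derivative_add\<close>)
next
  case (mult f g)
  then obtain D E where D: "\<forall>x. (f has_derivative D x) (at x)" "\<forall>v. bump_algebra (\<lambda>x. D x v)"
    "\<forall>x. (g has_derivative E x) (at x)" "\<forall>v. bump_algebra (\<lambda>x. E x v)" by blast
  show ?case
    by (rule exI[of _ "\<lambda>x v. f x * E x v + D x v * g x"])
       (use D mult.hyps in \<open>auto intro!: bump_algebra.add bump_algebra.mult has_derivative_mult\<close>)
qed

lemma smooth_R2_bump_algebra:
  assumes "bump_algebra f"
  shows "smooth_R2 f"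
  using assms
proof (coinduction arbitrary: f rule: smooth_R2.coinduct)
  case smooth_R2
  then obtain D where D: "\<And>x. (f has_derivative D x) (at x)" "\<And>v. bump_algebra (\<lambda>x. D x v)"
    using bump_algebra_derivative by blast
  have "frechet_derivative f (at x) = D x" for x using frechet_derivative_at[OF D(1)] by simp
  with D show ?case
    by (auto simp: differentiable_def intro!: continuous_at_imp_continuous_on has_derivative_continuous)
qed

text \<open>The product of four flat exponentials, one for each side, is positive exactly on the
  open unit square centred at 0. That square lies in the open unit disc because the modulus is at
  most |Re z| + |Im z|.\<close>

lemma smooth_bump_exists:
  obtains \<rho> :: "complex \<Rightarrow> real"
  where "smooth_R2 \<rho>" "\<And>z. 0 \<le> \<rho> z" "\<And>z. norm z \<ge> 1 \<Longrightarrow> \<rho> z = 0"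
    "integrable lborel \<rho>" "(\<integral>z. \<rho> z \<partial>lborel) = 1"
proof -
  define f where "f z = flat_exp 1 (2 * Re z + 1) * flat_exp 1 (- 2 * Re z + 1)
     * (flat_exp 1 (2 * Im z + 1) * flat_exp 1 (- 2 * Im z + 1))" for z
  have sm: "smooth_R2 f" unfolding f_def by (intro smooth_R2_bump_algebra bump_algebra.intros)
  have nn: "0 \<le> f z" for z by (simp add: f_def flat_exp_def)
  have supp: "f z = 0" if "norm z \<ge> 1" for z
  proof (rule ccontr)
    assume "f z \<noteq> 0"
    then have "\<bar>Re z\<bar> < 1/2" "\<bar>Im z\<bar> < 1/2"
      by (auto simp: f_def flat_exp_def split: if_splits)
    then show False using cmod_le[of z] that by linarith
  qed
  have cont: "continuous_on UNIV f" using sm by (auto elim: smooth_R2.cases)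
  have int: "integrable lborel f"
  proof -
    have "integrable lborel (\<lambda>x. indicator (cball 0 1) x *\<^sub>R f x)"
      by (rule borel_integrable_compact) (auto intro: continuous_on_subset[OF cont])
    moreover have "(\<lambda>x. indicator (cball 0 1) x *\<^sub>R f x) = f"
      using supp by (auto simp: indicator_def fun_eq_iff)
    ultimately show ?thesis by metis
  qed
  have pos: "integral\<^sup>L lborel f > 0"
  proof -
    have "f 0 > 0" by (simp add: f_def flat_exp_def)
    then obtain d where d: "d > 0" "\<And>z. dist z 0 < d \<Longrightarrow> dist (f z) (f 0) < f 0 / 2"
      using cont unfolding continuous_on_iff by (metis UNIV_I half_gt_zero)
    have le: "f 0 / 2 * indicator (ball 0 d) z \<le> f z" for z
      using d(2)[of z] nn[of z] by (auto simp: indicator_def dist_commute dist_real_def abs_if split: if_splits)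
    have fin: "emeasure lborel (ball (0::complex) d) < \<infinity>"
      by (rule emeasure_bounded_finite) simp
    have "0 < f 0 / 2 * measure lborel (ball (0::complex) d)"
      using \<open>f 0 > 0\<close> d(1) content_ball_pos[of d "0::complex"] by (simp add: measure_def)
    also have "\<dots> = (LINT z|lborel. f 0 / 2 * indicator (ball (0::complex) d) z)" by simp
    also have "\<dots> \<le> integral\<^sup>L lborel f"
      by (rule integral_mono) (use int le fin in \<open>auto intro!: integrable_mult_right integrable_real_indicator\<close>)
    finally show ?thesis .
  qed
  show thesis
  proof (rule that[of "\<lambda>z. (1 / integral\<^sup>L lborel f) * f z"])
    show "smooth_R2 (\<lambda>z. 1 / integral\<^sup>L lborel f * f z)"
      using smooth_R2_scaled_affine[OF sm, of "1 / integral\<^sup>L lborel f" 1 0] by simp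
  qed (use nn supp int pos in auto)
qed

section \<open>The unit circle of a strictly convex norm\<close>

text \<open>The determinant of two plane vectors. Paired with a unit tangent it measures the
  component transversal to the tangent, which is how support lines are written below.\<close>

definition cross :: "complex \<Rightarrow> complex \<Rightarrow> real" where
  "cross a b = Re a * Im b - Im a * Re b"

lemma cross_simps:
  "cross (a + b) c = cross a c + cross b c" "cross (a - b) c = cross a c - cross b c"
  "cross a (b + c) = cross a b + cross a c" "cross a (b - c) = cross a b - cross a c"
  "cross (r *\<^sub>R a) b = r * cross a b" "cross a (r *\<^sub>R b) = r * cross a b"
  "cross a a = 0" "cross 0 a = 0" "cross a 0 = 0"
  by (simp_all add: cross_def algebra_simps)

lemma cross_abs_le: "\<bar>cross a b\<bar> \<le> norm a * norm b"
proof -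
  have "cross a b = Im (cnj a * b)" by (simp add: cross_def)
  then show ?thesis using abs_Im_le_cmod[of "cnj a * b"] by (simp add: norm_mult)
qed

lemma cross_cis: "cross (cis s) (cis t) = sin (t - s)"
  by (simp add: cross_def sin_diff)

lemma continuous_on_cross [continuous_intros]:
  "continuous_on S f \<Longrightarrow> continuous_on S g \<Longrightarrow> continuous_on S (\<lambda>x. cross (f x) (g x))"
  unfolding cross_def by (intro continuous_intros)

locale unit_curve =
  fixes N :: "complex \<Rightarrow> real" and \<gamma> :: "real \<Rightarrow> complex" and \<alpha> :: "real \<Rightarrow> real"
  assumes norm_N: "is_norm_R2 N" and strict_N: "strictly_convex_norm N"
    and arclength: "arclength_param N \<gamma>" and angle: "angle_fn \<gamma> \<alpha>"
begin

section \<open>The norm as a continuous convex function\<close>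

lemma N_eq_0: "N x = 0 \<longleftrightarrow> x = 0" and N_triangle: "N (x + y) \<le> N x + N y"
  and N_scale: "N (c *\<^sub>R x) = \<bar>c\<bar> * N x"
  using norm_N by (auto simp: is_norm_R2_def)

lemma N_minus: "N (- x) = N x"
  using N_scale[of "-1" x] by simp

lemma N_nonneg: "0 \<le> N x"
  using N_triangle[of x "- x"] N_eq_0[of 0] by (simp add: N_minus)

lemma N_pos: "x \<noteq> 0 \<Longrightarrow> 0 < N x"
  using N_nonneg[of x] N_eq_0[of x] by linarith

lemma N_diff_le: "\<bar>N x - N y\<bar> \<le> N (x - y)"
  using N_triangle[of "x - y" y] N_triangle[of "y - x" x] N_minus[of "x - y"] by simp

lemma N_le_norm: "N x \<le> (N 1 + N \<i>) * norm x"
proof -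
  have "N x = N (Re x *\<^sub>R 1 + Im x *\<^sub>R \<i>)"
    by (rule arg_cong[where f = N]) (simp add: complex_eq_iff)
  also have "\<dots> \<le> \<bar>Re x\<bar> * N 1 + \<bar>Im x\<bar> * N \<i>"
    using N_triangle[of "Re x *\<^sub>R 1" "Im x *\<^sub>R \<i>"] unfolding N_scale .
  also have "\<dots> \<le> norm x * N 1 + norm x * N \<i>"
    by (intro add_mono mult_right_mono N_nonneg abs_Re_le_cmod abs_Im_le_cmod)
  finally show ?thesis by (simp add: algebra_simps)
qed

lemma continuous_N: "continuous_on S N"
proof -
  have "(N 1 + N \<i>)-lipschitz_on S N"
    by (rule lipschitz_onI)
       (use order_trans[OF N_diff_le N_le_norm] in \<open>auto simp: dist_norm N_nonneg\<close>)
  then show ?thesis by (rule lipschitz_on_continuous_on)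
qed

lemma convex_N_ball: "convex {z. N z < r}" "convex {z. N z \<le> r}"
proof -
  have le: "N (u *\<^sub>R x + v *\<^sub>R y) \<le> u * N x + v * N y" if "0 \<le> u" "0 \<le> v" for u v x y
    using N_triangle[of "u *\<^sub>R x" "v *\<^sub>R y"] that by (simp add: N_scale)
  have lt: "u * a + v * b < r" if "0 \<le> u" "0 \<le> v" "u + v = 1" "a < r" "b < r" for u v a b :: real
    using convex_bound_lt[of a r b u v] that by simp
  show "convex {z. N z < r}"
    by (rule convexI) (auto intro: le_less_trans[OF le lt])
  show "convex {z. N z \<le> r}"
    by (rule convexI) (auto intro: order_trans[OF le convex_bound_le])
qed

section \<open>Periodicity and injectivity of the parametrization\<close>

lemma gamma_periodic: "\<gamma> (t + 2 * pi) = \<gamma> t"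
  and gamma_range: "range \<gamma> = {z. N z = 1}"
  and gamma_inj: "inj_on \<gamma> {0..<2 * pi}"
  and gamma_C1: "\<gamma> C1_differentiable_on UNIV"
  and gamma_winding: "winding_number (\<lambda>s. \<gamma> (2 * pi * s)) 0 = 1"
  using arclength by (auto simp: arclength_param_def)

lemma N_gamma: "N (\<gamma> t) = 1"
  using gamma_range by auto

lemma gamma_nonzero: "\<gamma> t \<noteq> 0"
  using N_gamma[of t] N_eq_0[of 0] by auto

lemma alpha_continuous: "continuous_on S \<alpha>"
  using angle continuous_on_subset unfolding angle_fn_def by blast

lemma gamma_deriv: "(\<gamma> has_vector_derivative cis (\<alpha> t)) (at t)"
  using gamma_C1 angle
  by (metis C1_differentiable_on_def UNIV_I angle_fn_def vector_derivative_at)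

lemma gamma_affine_deriv:
  "((\<lambda>s. \<gamma> (c * s + d)) has_vector_derivative c *\<^sub>R cis (\<alpha> (c * s + d))) (at s)"
proof -
  have "((\<lambda>s. c * s + d) has_vector_derivative c) (at s)"
    unfolding has_real_derivative_iff_has_vector_derivative[symmetric]
    by (auto intro!: derivative_eq_intros)
  from vector_diff_chain_at[OF this gamma_deriv] show ?thesis by (simp add: o_def)
qed

lemma gamma_continuous: "continuous_on S \<gamma>"
  by (meson continuous_at_imp_continuous_on gamma_deriv has_vector_derivative_continuous)

lemma gamma_periodic_int: "\<gamma> (t + 2 * pi * of_int k) = \<gamma> t"
proof (induction k rule: int_induct[where k = 0])
  case (step1 i)
  then show ?case using gamma_periodic[of "t + 2 * pi * of_int i"] by (simp add: algebra_simps)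
next
  case (step2 i)
  then show ?case using gamma_periodic[of "t + 2 * pi * of_int (i - 1)"] by (simp add: algebra_simps)
qed simp

lemma reduce_mod_2pi: obtains k :: int where "t + 2 * pi * of_int k \<in> {0..<2 * pi}"
proof
  define q where "q = t / (2 * pi)"
  have t: "t = 2 * pi * q" by (simp add: q_def)
  have "0 \<le> 2 * pi * (q - of_int \<lfloor>q\<rfloor>)" by simp
  moreover have "2 * pi * (q - of_int \<lfloor>q\<rfloor>) < 2 * pi * 1"
    by (intro mult_strict_left_mono) (linarith, simp)
  ultimately show "t + 2 * pi * of_int (- \<lfloor>q\<rfloor>) \<in> {0..<2 * pi}"
    by (simp add: t algebra_simps)
qed

lemma gamma_eq_iff: "\<gamma> s = \<gamma> t \<longleftrightarrow> (\<exists>k. t = s + 2 * pi * of_int k)"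
proof
  assume eq: "\<gamma> s = \<gamma> t"
  obtain k where k: "s + 2 * pi * of_int k \<in> {0..<2 * pi}" by (rule reduce_mod_2pi)
  obtain l where l: "t + 2 * pi * of_int l \<in> {0..<2 * pi}" by (rule reduce_mod_2pi)
  have "s + 2 * pi * of_int k = t + 2 * pi * of_int l"
    using inj_onD[OF gamma_inj _ k l] eq by (simp add: gamma_periodic_int)
  then have "t = s + 2 * pi * of_int (k - l)" by (simp add: algebra_simps)
  then show "\<exists>k. t = s + 2 * pi * of_int k" by blast
qed (auto simp: gamma_periodic_int)

lemma cis_alpha_periodic: "cis (\<alpha> (t + 2 * pi)) = cis (\<alpha> t)"
proof -
  have "((\<lambda>t. \<gamma> (t + 2 * pi)) has_vector_derivative cis (\<alpha> (t + 2 * pi))) (at t)"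
    using gamma_affine_deriv[of 1 "2 * pi" t] by simp
  then show ?thesis
    using vector_derivative_unique_at[OF _ gamma_deriv[of t]] by (simp add: gamma_periodic)
qed

text \<open>Separate the open unit ball from \<gamma> t. Along the curve the separating functional
  is maximal at \<open>t\<close>, so it annihilates the tangent and is a multiple of the cross
  product with it; the quotient normalizes it to 1 at \<gamma> t. The sign of the denominator is
  left open here and is settled by the orientation in \<open>cross_gamma_pos\<close>.\<close>

lemma support_line:
  "cross (\<gamma> t) (cis (\<alpha> t)) \<noteq> 0 \<and> cross z (cis (\<alpha> t)) / cross (\<gamma> t) (cis (\<alpha> t)) \<le> N z"
proof -
  obtain a b where a: "a \<noteq> 0" and le: "\<And>z. N z < 1 \<Longrightarrow> inner a z \<le> b" and ge: "b \<le> inner a (\<gamma> t)"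
  proof -
    have "{z. N z < 1} \<noteq> {}" using N_eq_0[of 0] by (auto intro!: exI[of _ 0])
    moreover have "{z. N z < 1} \<inter> {\<gamma> t} = {}" using N_gamma by simp
    ultimately obtain a b where "a \<noteq> 0" "\<forall>x\<in>{z. N z < 1}. inner a x \<le> b" "\<forall>x\<in>{\<gamma> t}. b \<le> inner a x"
      using separating_hyperplane_sets[of "{z. N z < 1}" "{\<gamma> t}"] convex_N_ball by auto
    then show thesis using that by auto
  qed
  \<comment> \<open>A small positive multiple of \<open>a\<close> lies in the ball, and the
    functional is positive there.\<close>
  have b: "b > 0"
  proof -
    define e where "e = 1 / (N a + 1)"
    have e: "e > 0" using N_nonneg[of a] by (simp add: e_def)
    have "N (e *\<^sub>R a) < 1" using N_nonneg[of a] by (simp add: N_scale e_def)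
    from le[OF this] have "e * (norm a)^2 \<le> b" by (simp add: power2_norm_eq_inner)
    moreover have "e * (norm a)^2 > 0" using e a by simp
    ultimately show ?thesis by linarith
  qed
  have ba: "inner a z \<le> b * N z" for z
  proof (rule field_le_epsilon)
    fix d :: real assume d: "d > 0"
    define r where "r = N z + d / b"
    have r: "r > 0" "N z < r" using N_nonneg[of z] b d by (auto simp: r_def intro: add_nonneg_pos)
    have "N ((1 / r) *\<^sub>R z) < 1" using r by (simp add: N_scale)
    from le[OF this] have "inner a z \<le> b * r" using r by (simp add: field_simps)
    then show "inner a z \<le> b * N z + d" using b by (simp add: r_def distrib_left)
  qed
  have bt: "inner a (\<gamma> t) = b" using ba[of "\<gamma> t"] ge by (simp add: N_gamma)
  have "inner a (cis (\<alpha> t)) = 0"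
  proof -
    have "((\<lambda>s. inner a (\<gamma> s)) has_real_derivative inner a (cis (\<alpha> t))) (at t)"
      using has_derivative_inner_right[OF gamma_deriv[of t, unfolded has_vector_derivative_def], of a]
      by (simp add: has_field_derivative_def mult_commute_abs)
    moreover have "inner a (\<gamma> s) \<le> inner a (\<gamma> t)" for s
      using ba[of "\<gamma> s"] bt by (simp add: N_gamma)
    ultimately show ?thesis by (intro DERIV_local_max[where d = 1]) auto
  qed
  then have orth: "Re a * cos (\<alpha> t) + Im a * sin (\<alpha> t) = 0" by (simp add: inner_complex_def)
  \<comment> \<open>Being orthogonal to the tangent, \<open>a\<close> is \<open>k\<close> times the
    tangent turned by a right angle.\<close>
  define k where "k = Im a * cos (\<alpha> t) - Re a * sin (\<alpha> t)"
  have az: "inner a z = - k * cross z (cis (\<alpha> t))" for z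
  proof -
    have "Re a = - k * sin (\<alpha> t)" "Im a = k * cos (\<alpha> t)"
      using orth sin_cos_squared_add[of "\<alpha> t"] unfolding k_def by algebra+
    then show ?thesis by (simp add: inner_complex_def cross_def algebra_simps)
  qed
  have "cross (\<gamma> t) (cis (\<alpha> t)) \<noteq> 0" using az[of "\<gamma> t"] b bt by auto
  moreover have "cross z (cis (\<alpha> t)) / cross (\<gamma> t) (cis (\<alpha> t)) = inner a z / b"
    using bt[symmetric] b unfolding az by (auto simp: divide_simps)
  moreover have "inner a z / b \<le> N z" using ba[of z] b by (simp add: field_simps)
  ultimately show ?thesis by simp
qed

section \<open>Orientation and strict monotonicity of the tangent angle\<close>

lemma valid_path_gamma: "valid_path (\<lambda>s. \<gamma> (c * s))"
proof -
  have "(\<lambda>s. \<gamma> (c * s)) C1_differentiable_on UNIV"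
    unfolding C1_differentiable_on_def
  proof (intro exI conjI allI ballI)
    show "((\<lambda>s. \<gamma> (c * s)) has_vector_derivative c *\<^sub>R cis (\<alpha> (c * s))) (at s)" for s
      using gamma_affine_deriv[of c 0 s] by simp
    show "continuous_on UNIV (\<lambda>s. c *\<^sub>R cis (\<alpha> (c * s)))"
      by (intro continuous_intros continuous_on_cis continuous_on_compose2[OF alpha_continuous[of UNIV]]) auto
  qed
  then show ?thesis
    unfolding valid_path_def by (meson C1_differentiable_imp_piecewise C1_differentiable_on_subset subset_UNIV)
qed

text \<open>The place where the counterclockwise orientation enters. The quantity is continuous and
  never 0, so its sign is constant. Were it negative, the reversed path would turn positively around
  0 and its winding number would have nonnegative real part, whereas it is -1.\<close>

lemma cross_gamma_pos: "cross (\<gamma> t) (cis (\<alpha> t)) > 0"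
proof (rule ccontr)
  define D where "D t = cross (\<gamma> t) (cis (\<alpha> t))" for t
  have Dc: "continuous_on S D" for S
    unfolding D_def by (intro continuous_intros gamma_continuous continuous_on_cis alpha_continuous)
  have D0: "D s \<noteq> 0" for s using support_line[of s] by (simp add: D_def)
  assume "\<not> 0 < cross (\<gamma> t) (cis (\<alpha> t))"
  then have "D t < 0" using D0[of t] by (simp add: D_def)
  have neg: "D s < 0" for s
  proof (rule ccontr)
    assume "\<not> D s < 0"
    then have "D s > 0" using D0[of s] by linarith
    moreover have "connected (range D)" using Dc by (intro connected_continuous_image) auto
    ultimately have "0 \<in> range D"
      using \<open>D t < 0\<close> by (meson connectedD_interval rangeI less_imp_le)
    then show False using D0 by auto
  qed
  define g where "g s = \<gamma> (2 * pi * s)" for s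
  have g: "valid_path g" unfolding g_def by (rule valid_path_gamma)
  have rg: "reversepath g = (\<lambda>s. \<gamma> ((- 2 * pi) * s))"
    using gamma_periodic_int[of "(- 2 * pi) * _" 1] by (auto simp: reversepath_def g_def fun_eq_iff algebra_simps)
  have "0 \<notin> path_image g" using gamma_nonzero by (auto simp: path_image_def g_def)
  moreover have "winding_number g 0 = 1" using gamma_winding by (simp add: g_def[abs_def])
  ultimately have "winding_number (reversepath g) 0 = - 1"
    using winding_number_reversepath[OF valid_path_imp_path[OF g]] by simp
  moreover have "0 \<le> Re (winding_number (reversepath g) 0)"
  proof (rule winding_number_pos_le)
    show "valid_path (reversepath g)" unfolding rg by (rule valid_path_gamma)
    show "0 \<notin> path_image (reversepath g)" using gamma_nonzero by (auto simp: path_image_def rg)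
    fix x :: real
    have "((\<lambda>s. \<gamma> ((- 2 * pi) * s)) has_vector_derivative (- 2 * pi) *\<^sub>R cis (\<alpha> ((- 2 * pi) * x))) (at x)"
      using gamma_affine_deriv[of "- 2 * pi" 0 x] by simp
    then have "vector_derivative (reversepath g) (at x) = (- 2 * pi) *\<^sub>R cis (\<alpha> ((- 2 * pi) * x))"
      unfolding rg by (rule vector_derivative_at)
    then show "0 \<le> Im (vector_derivative (reversepath g) (at x) * cnj (reversepath g x - 0))"
      using mult_pos_neg[OF _ neg[of "(- 2 * pi) * x"], of "2 * pi"] by (simp add: rg D_def cross_def algebra_simps)
  qed
  ultimately show False by simp
qed

lemma cross_gamma_le: "cross (\<gamma> s) (cis (\<alpha> t)) \<le> cross (\<gamma> t) (cis (\<alpha> t))"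
  using support_line[of t "\<gamma> s"] cross_gamma_pos[of t] by (simp add: N_gamma)

text \<open>Suppose the angle dropped from m + e to m - e. The support lines at the two ends force
  the chord to have a nonpositive component in direction \<open>m\<close>. All tangents in between
  are within angle 1 of \<open>m\<close>, so by the mean value theorem the component is
  positive.\<close>

lemma alpha_mono_local:
  assumes "a < b" and osc: "\<And>x y. \<lbrakk>x \<in> {a..b}; y \<in> {a..b}\<rbrakk> \<Longrightarrow> \<bar>\<alpha> x - \<alpha> y\<bar> < 1"
  shows "\<alpha> a \<le> \<alpha> b"
proof (rule ccontr)
  assume "\<not> \<alpha> a \<le> \<alpha> b"
  define m where "m = (\<alpha> a + \<alpha> b) / 2"
  define e where "e = (\<alpha> a - \<alpha> b) / 2"
  have e: "0 < e" "e < 1" using \<open>\<not> \<alpha> a \<le> \<alpha> b\<close> osc[of a b] \<open>a < b\<close> by (auto simp: e_def)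
  define h where "h x = inner (cis m) (\<gamma> x)" for x
  have hd: "(h has_real_derivative cos (m - \<alpha> x)) (at x)" for x
  proof -
    have "(h has_real_derivative inner (cis m) (cis (\<alpha> x))) (at x)"
      unfolding h_def
      using has_derivative_inner_right[OF gamma_deriv[of x, unfolded has_vector_derivative_def], of "cis m"]
      by (simp add: has_field_derivative_def mult_commute_abs)
    then show ?thesis by (simp add: inner_complex_def cos_diff)
  qed
  obtain z where z: "a < z" "z < b" "h b - h a = (b - a) * cos (m - \<alpha> z)"
    using MVT2[OF \<open>a < b\<close> hd] by blast
  have "\<bar>m - \<alpha> z\<bar> < 1"
  proof -
    have "\<bar>\<alpha> a - \<alpha> z\<bar> < 1" "\<bar>\<alpha> b - \<alpha> z\<bar> < 1" using osc[of a z] osc[of b z] z(1,2) by auto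
    moreover have "2 * m = \<alpha> a + \<alpha> b" by (simp add: m_def)
    ultimately show ?thesis by linarith
  qed
  then have "cos (m - \<alpha> z) > 0" using pi_gt3 by (intro cos_gt_zero_pi) auto
  then have pos: "h b - h a > 0" using z(3) \<open>a < b\<close> by simp
  have "cross (\<gamma> b - \<gamma> a) (cis (\<alpha> a)) \<le> 0" "cross (\<gamma> b - \<gamma> a) (cis (\<alpha> b)) \<ge> 0"
    using cross_gamma_le[of b a] cross_gamma_le[of a b] by (simp_all add: cross_simps)
  then have "cross (\<gamma> b - \<gamma> a) (cis (\<alpha> a) - cis (\<alpha> b)) \<le> 0" by (simp add: cross_simps)
  also have "cross (\<gamma> b - \<gamma> a) (cis (\<alpha> a) - cis (\<alpha> b)) = 2 * sin e * (h b - h a)"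
  proof -
    have "\<alpha> a = m + e" "\<alpha> b = m - e" by (simp_all add: m_def e_def field_simps)
    then have "cis (\<alpha> a) - cis (\<alpha> b) = Complex (- 2 * sin m * sin e) (2 * cos m * sin e)"
      by (simp add: complex_eq_iff sin_add cos_add sin_diff cos_diff)
    then show ?thesis by (simp add: cross_def h_def inner_complex_def algebra_simps)
  qed
  finally show False
    using mult_pos_pos[OF _ pos, of "2 * sin e"] sin_gt_zero[of e] e pi_gt3 by auto
qed

text \<open>The last point at which the angle is at least its initial value exists by continuity.
  Near it the oscillation is small, so \<open>alpha_mono_local\<close> pushes it further to the
  right, a contradiction unless it is the endpoint.\<close>

lemma alpha_mono: "x \<le> y \<Longrightarrow> \<alpha> x \<le> \<alpha> y"
proof (rule ccontr)
  assume "x \<le> y" "\<not> \<alpha> x \<le> \<alpha> y"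
  define S where "S = {t \<in> {x..y}. \<alpha> x \<le> \<alpha> t}"
  have "closed S" unfolding S_def
    using closed_Collect_le[OF continuous_on_const[of UNIV "\<alpha> x"] alpha_continuous[of UNIV]]
    by (auto simp: Collect_conj_eq simp flip: atLeast_def atMost_def intro!: closed_Int)
  moreover have S: "x \<in> S" "bdd_above S" using \<open>x \<le> y\<close> by (auto simp: S_def intro!: bdd_aboveI[of _ y])
  ultimately have SS: "Sup S \<in> S" using closed_contains_Sup[of S] by auto
  define t where "t = Sup S"
  have t: "x \<le> t" "t < y" "\<alpha> x \<le> \<alpha> t"
    using SS \<open>\<not> \<alpha> x \<le> \<alpha> y\<close> by (auto simp: S_def t_def order_le_less)
  have "isCont \<alpha> t" using alpha_continuous[of UNIV] by (simp add: continuous_on_eq_continuous_at)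
  then obtain d where d: "d > 0" "\<And>s. \<bar>s - t\<bar> < d \<Longrightarrow> \<bar>\<alpha> s - \<alpha> t\<bar> < 1/2"
    unfolding continuous_at_eps_delta dist_real_def by (metis half_gt_zero zero_less_one)
  define b where "b = min y (t + d / 2)"
  have b: "t < b" "b \<le> y" using t d by (auto simp: b_def)
  have "\<alpha> t \<le> \<alpha> b"
  proof (rule alpha_mono_local[OF b(1)])
    fix u v assume "u \<in> {t..b}" "v \<in> {t..b}"
    then have "\<bar>u - t\<bar> < d" "\<bar>v - t\<bar> < d" using d(1) by (auto simp: b_def)
    from d(2)[OF this(1)] d(2)[OF this(2)] show "\<bar>\<alpha> u - \<alpha> v\<bar> < 1" by linarith
  qed
  then have "b \<in> S" using b t by (auto simp: S_def)
  then have "b \<le> t" unfolding t_def using S(2) by (rule cSup_upper)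
  then show False using b by simp
qed

text \<open>If the angle were constant between \<open>a\<close> and \<open>b\<close>, the unit
  sphere would contain a segment, and the midpoint of its ends would have norm 1 against strict
  convexity.\<close>

lemma alpha_strict_mono: "a < b \<Longrightarrow> \<alpha> a < \<alpha> b"
proof (rule ccontr)
  assume "a < b" "\<not> \<alpha> a < \<alpha> b"
  then have c: "\<alpha> t = \<alpha> a" if "t \<in> {a..b}" for t
    using alpha_mono[of a t] alpha_mono[of t b] that by auto
  define h where "h t = \<gamma> t - t *\<^sub>R cis (\<alpha> a)" for t
  have aff: "\<gamma> t = \<gamma> a + (t - a) *\<^sub>R cis (\<alpha> a)" if "t \<in> {a..b}" for t
  proof -
    have "h t = h a"
    proof (rule has_derivative_zero_unique[where s = "{a..b}"])
      show "(h has_derivative (\<lambda>_. 0)) (at s within {a..b})" if "s \<in> {a..b}" for s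
        unfolding h_def
        using has_derivative_at_withinI[OF gamma_deriv[of s, unfolded has_vector_derivative_def c[OF that]]]
        by (auto intro!: derivative_eq_intros)
    qed (use that \<open>a < b\<close> in auto)
    then show ?thesis by (simp add: h_def algebra_simps)
  qed
  have "(1/2) *\<^sub>R (\<gamma> a + \<gamma> b) = \<gamma> ((a + b) / 2)"
    using aff[of b] aff[of "(a + b) / 2"] \<open>a < b\<close> by (simp add: complex_eq_iff field_simps)
  moreover have "\<gamma> a \<noteq> \<gamma> b"
    using aff[of b] \<open>a < b\<close> by simp
  ultimately show False using strict_N N_gamma unfolding strictly_convex_norm_def by (metis less_irrefl)
qed

text \<open>The tangent is periodic, so the increment over one period is a multiple of 2 pi. It
  depends continuously on \<open>t\<close> and therefore cannot change.\<close>

lemma alpha_shift: obtains P where "\<And>t. \<alpha> (t + 2 * pi) = \<alpha> t + P"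
proof -
  define f where "f t = (\<alpha> (t + 2 * pi) - \<alpha> t) / (2 * pi)" for t
  have fc: "continuous_on UNIV f"
    unfolding f_def by (intro continuous_intros continuous_on_compose2[OF alpha_continuous]) auto
  have fZ: "f t \<in> \<int>" for t
  proof -
    have "cis (\<alpha> (t + 2 * pi) - \<alpha> t) = 1"
      using cis_alpha_periodic[of t] by (simp add: cis_divide[symmetric])
    then have "cos (\<alpha> (t + 2 * pi) - \<alpha> t) = 1" by (metis cis.sel(1) one_complex.sel(1))
    then obtain n :: int where "\<alpha> (t + 2 * pi) - \<alpha> t = of_int n * (2 * pi)"
      unfolding cos_one_2pi_int by (auto simp: mult.assoc)
    then show ?thesis by (simp add: f_def)
  qed
  have "f constant_on UNIV"
  proof (rule continuous_discrete_range_constant[OF connected_UNIV fc])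
    fix x
    show "\<exists>e>0. \<forall>y. y \<in> UNIV \<and> f y \<noteq> f x \<longrightarrow> e \<le> norm (f y - f x)"
    proof (intro exI[of _ 1] conjI allI impI)
      fix y assume "y \<in> UNIV \<and> f y \<noteq> f x"
      moreover have "f y - f x \<in> \<int>" using fZ by auto
      ultimately show "1 \<le> norm (f y - f x)" using Ints_nonzero_abs_ge1[of "f y - f x"] by auto
    qed simp
  qed
  then obtain c where "\<And>t. f t = c" by (auto simp: constant_on_def)
  then have "\<alpha> (t + 2 * pi) = \<alpha> t + 2 * pi * c" for t by (simp add: f_def field_simps)
  then show thesis by (rule that)
qed

end

section \<open>The arc cost\<close>

lemma antiderivative_exists:
  fixes f :: "real \<Rightarrow> real"
  assumes "continuous_on UNIV f"
  shows "\<exists>F. \<forall>x. (F has_real_derivative f x) (at x)"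
  using einterval_antiderivative[of "-\<infinity>" "\<infinity>" f] assms
  by (auto simp: continuous_on_eq_continuous_at has_real_derivative_iff_has_vector_derivative)

lemma DERIV_nonneg_le:
  fixes f :: "real \<Rightarrow> real"
  assumes "a \<le> b" "\<And>x. (f has_real_derivative f' x) (at x)" "\<And>x. \<lbrakk>a \<le> x; x \<le> b\<rbrakk> \<Longrightarrow> 0 \<le> f' x"
  shows "f a \<le> f b"
  using assms by (intro DERIV_nonneg_imp_nondecreasing[of a b f]) auto

context unit_curve
begin

text \<open>A primitive of the tangent angle. It is convex because \<alpha> is nondecreasing, and
  this convexity drives all estimates of the cost.\<close>

definition alpha_prim :: "real \<Rightarrow> real" where
  "alpha_prim = (SOME A. \<forall>t. (A has_real_derivative \<alpha> t) (at t))"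

lemma alpha_prim_deriv: "(alpha_prim has_real_derivative \<alpha> t) (at t)"
  using someI_ex[OF antiderivative_exists[OF alpha_continuous]] by (simp add: alpha_prim_def)

lemma alpha_prim_continuous: "continuous_on S alpha_prim"
  by (meson DERIV_isCont alpha_prim_deriv continuous_at_imp_continuous_on)

text \<open>The Bregman divergence of the convex function \<open>alpha_prim\<close>.\<close>

definition breg :: "real \<Rightarrow> real \<Rightarrow> real" where
  "breg c u = alpha_prim u - alpha_prim c - \<alpha> c * (u - c)"

lemma breg_deriv: "(breg c has_real_derivative \<alpha> u - \<alpha> c) (at u)"
  unfolding breg_def by (auto intro!: derivative_eq_intros alpha_prim_deriv)

lemma breg_self: "breg c c = 0"
  by (simp add: breg_def)

lemma breg_nonneg: "0 \<le> breg c u"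
proof (cases "c \<le> u")
  case True
  have "breg c c \<le> breg c u"
    by (rule DERIV_nonneg_le[OF True breg_deriv]) (simp add: alpha_mono)
  then show ?thesis by (simp add: breg_self)
next
  case False
  have "- breg c u \<le> - breg c c"
    by (rule DERIV_nonneg_le[where f' = "\<lambda>x. - (\<alpha> x - \<alpha> c)"])
       (use False in \<open>auto intro!: derivative_eq_intros breg_deriv alpha_mono\<close>)
  then show ?thesis by (simp add: breg_self)
qed

text \<open>The derivative vanishes at \<open>c\<close>, so the strict gain is taken from the right
  half of the interval, where strict monotonicity of \<alpha> keeps the derivative positive.\<close>

lemma breg_pos: "c < u \<Longrightarrow> 0 < breg c u"
proof -
  assume "c < u"
  define d where "d = (c + u) / 2"
  have d: "c < d" "d < u" using \<open>c < u\<close> by (auto simp: d_def)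
  obtain z where z: "d < z" "z < u" "breg c u - breg c d = (u - d) * (\<alpha> z - \<alpha> c)"
    using MVT2[OF d(2) breg_deriv[of c]] by blast
  have "(u - d) * (\<alpha> z - \<alpha> c) > 0" using alpha_strict_mono[of c z] d z by simp
  then show ?thesis using z(3) breg_nonneg[of c d] by linarith
qed

text \<open>After clearing the positive denominator, the claim is that
  \<open>breg c v + cross (\<gamma> v) (cis (\<alpha> c))\<close> is minimal at v = c. Its
  derivative is x - sin x with x = \<alpha> v - \<alpha> c, and it has the sign of v - c.\<close>

lemma support_deficit_le:
  "1 - cross (\<gamma> u) (cis (\<alpha> c)) / cross (\<gamma> c) (cis (\<alpha> c)) \<le> breg c u / cross (\<gamma> c) (cis (\<alpha> c))"
proof -
  define F where "F v = breg c v + cross (\<gamma> v) (cis (\<alpha> c))" for v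
  have F': "(F has_real_derivative (\<alpha> v - \<alpha> c) - sin (\<alpha> v - \<alpha> c)) (at v)" for v
  proof -
    have "(\<gamma> has_derivative (\<lambda>x. x *\<^sub>R cis (\<alpha> v))) (at v)"
      using gamma_deriv by (simp add: has_vector_derivative_def)
    then have "((\<lambda>v. cross (\<gamma> v) (cis (\<alpha> c))) has_derivative (\<lambda>x. x * cross (cis (\<alpha> v)) (cis (\<alpha> c)))) (at v)"
      unfolding cross_def by (auto intro!: derivative_eq_intros simp: algebra_simps)
    then have "((\<lambda>v. cross (\<gamma> v) (cis (\<alpha> c))) has_real_derivative cross (cis (\<alpha> v)) (cis (\<alpha> c))) (at v)"
      by (simp add: has_field_derivative_def mult_commute_abs)
    then show ?thesis
      unfolding F_def cross_cis
      using breg_deriv[of c v] sin_minus[of "\<alpha> v - \<alpha> c"] by (auto intro!: derivative_eq_intros)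
  qed
  have "F c \<le> F u"
  proof (cases "c \<le> u")
    case True
    show ?thesis
      by (rule DERIV_nonneg_le[OF True F']) (simp add: sin_x_le_x alpha_mono)
  next
    case False
    have "- F u \<le> - F c"
    proof (rule DERIV_nonneg_le[where a = u and b = c and f = "\<lambda>v. - F v" and f' = "\<lambda>v. sin (\<alpha> v - \<alpha> c) - (\<alpha> v - \<alpha> c)"])
      show "((\<lambda>v. - F v) has_real_derivative sin (\<alpha> v - \<alpha> c) - (\<alpha> v - \<alpha> c)) (at v)" for v
        using DERIV_minus[OF F'[of v]] by simp
      show "0 \<le> sin (\<alpha> v - \<alpha> c) - (\<alpha> v - \<alpha> c)" if "v \<le> c" for v
        using sin_x_le_x[of "\<alpha> c - \<alpha> v"] alpha_mono[OF that] sin_minus[of "\<alpha> v - \<alpha> c"] by simp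
    qed (use False in auto)
    then show ?thesis by simp
  qed
  then have "cross (\<gamma> c) (cis (\<alpha> c)) - cross (\<gamma> u) (cis (\<alpha> c)) \<le> breg c u"
    by (simp add: F_def breg_self)
  then have "(cross (\<gamma> c) (cis (\<alpha> c)) - cross (\<gamma> u) (cis (\<alpha> c))) / cross (\<gamma> c) (cis (\<alpha> c))
      \<le> breg c u / cross (\<gamma> c) (cis (\<alpha> c))"
    using cross_gamma_pos[of c] by (intro divide_right_mono) auto
  then show ?thesis using cross_gamma_pos[of c] by (simp add: diff_divide_distrib)
qed

lemma cross_gamma_lower_bound: obtains D0 where "D0 > 0" "\<And>t. D0 \<le> cross (\<gamma> t) (cis (\<alpha> t))"
proof -
  have "continuous_on {0..2 * pi} (\<lambda>t. cross (\<gamma> t) (cis (\<alpha> t)))"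
    by (intro continuous_intros gamma_continuous continuous_on_cis alpha_continuous)
  then obtain s where s: "\<forall>t\<in>{0..2 * pi}. cross (\<gamma> s) (cis (\<alpha> s)) \<le> cross (\<gamma> t) (cis (\<alpha> t))"
    using continuous_attains_inf[of "{0..2 * pi}" "\<lambda>t. cross (\<gamma> t) (cis (\<alpha> t))"] by auto
  show thesis
  proof (rule that[OF cross_gamma_pos[of s]])
    fix t
    have per: "cis (\<alpha> (t + 2 * pi * of_int k)) = cis (\<alpha> t)" for k :: int
    proof (induction k rule: int_induct[where k = 0])
      case (step1 i)
      then show ?case using cis_alpha_periodic[of "t + 2 * pi * of_int i"] by (simp add: algebra_simps)
    next
      case (step2 i)
      then show ?case using cis_alpha_periodic[of "t + 2 * pi * of_int (i - 1)"] by (simp add: algebra_simps)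
    qed simp
    obtain k where "t + 2 * pi * of_int k \<in> {0..<2 * pi}" by (rule reduce_mod_2pi)
    then show "cross (\<gamma> s) (cis (\<alpha> s)) \<le> cross (\<gamma> t) (cis (\<alpha> t))"
      using bspec[OF s, of "t + 2 * pi * of_int k"] by (simp add: gamma_periodic_int per)
  qed
qed

section \<open>The cost of an arc in terms of its end parameters\<close>

definition arc_cost :: "real \<Rightarrow> real \<Rightarrow> real" where
  "arc_cost a b = integral {min a b..max a b} (\<lambda>t. integral {min a b..max a b} (\<lambda>s. \<bar>\<alpha> t - \<alpha> s\<bar>))"

lemma arc_cost_commute: "arc_cost a b = arc_cost b a"
  by (simp add: arc_cost_def min.commute max.commute)

definition alpha_prim2 :: "real \<Rightarrow> real" where
  "alpha_prim2 = (SOME E. \<forall>t. (E has_real_derivative alpha_prim t) (at t))"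

lemma alpha_prim2_deriv: "(alpha_prim2 has_real_derivative alpha_prim t) (at t)"
  using someI_ex[OF antiderivative_exists[OF alpha_prim_continuous]] by (simp add: alpha_prim2_def)

text \<open>Monotonicity of \<alpha> removes the absolute value once the inner integral is split at
  s = t. What is left has the explicit primitive \<open>J\<close>. From here on, estimates of the
  cost are statements about the convex function \<open>alpha_prim\<close>.\<close>

lemma arc_cost_eq:
  assumes "a \<le> b"
  shows "arc_cost a b = 2 * (b - a) * (alpha_prim a + alpha_prim b) - 4 * (alpha_prim2 b - alpha_prim2 a)"
proof -
  have inner: "integral {a..b} (\<lambda>s. \<bar>\<alpha> t - \<alpha> s\<bar>)
      = \<alpha> t * (2 * t - a - b) + alpha_prim a + alpha_prim b - 2 * alpha_prim t" if t: "t \<in> {a..b}" for t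
  proof -
    have "((\<lambda>s. \<alpha> t - \<alpha> s) has_integral (\<alpha> t * t - alpha_prim t) - (\<alpha> t * a - alpha_prim a)) {a..t}"
      using t by (intro fundamental_theorem_of_calculus)
       (auto intro!: derivative_eq_intros DERIV_subset[OF alpha_prim_deriv] simp flip: has_real_derivative_iff_has_vector_derivative)
    then have 1: "((\<lambda>s. \<bar>\<alpha> t - \<alpha> s\<bar>) has_integral (\<alpha> t * t - alpha_prim t) - (\<alpha> t * a - alpha_prim a)) {a..t}"
      by (rule has_integral_eq[rotated]) (use alpha_mono in auto)
    have "((\<lambda>s. \<alpha> s - \<alpha> t) has_integral (alpha_prim b - \<alpha> t * b) - (alpha_prim t - \<alpha> t * t)) {t..b}"
      using t by (intro fundamental_theorem_of_calculus)
       (auto intro!: derivative_eq_intros DERIV_subset[OF alpha_prim_deriv] simp flip: has_real_derivative_iff_has_vector_derivative)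
    then have 2: "((\<lambda>s. \<bar>\<alpha> t - \<alpha> s\<bar>) has_integral (alpha_prim b - \<alpha> t * b) - (alpha_prim t - \<alpha> t * t)) {t..b}"
      by (rule has_integral_eq[rotated]) (use alpha_mono in auto)
    show ?thesis
      using has_integral_combine[OF _ _ 1 2] t by (simp add: integral_unique algebra_simps)
  qed
  define J where "J t = (2 * t - a - b) * alpha_prim t + (alpha_prim a + alpha_prim b) * t - 4 * alpha_prim2 t" for t
  have "((\<lambda>t. \<alpha> t * (2 * t - a - b) + alpha_prim a + alpha_prim b - 2 * alpha_prim t) has_integral J b - J a) {a..b}"
    unfolding J_def
    using assms by (intro fundamental_theorem_of_calculus)
       (auto intro!: derivative_eq_intros DERIV_subset[OF alpha_prim_deriv] DERIV_subset[OF alpha_prim2_deriv]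
         simp: algebra_simps simp flip: has_real_derivative_iff_has_vector_derivative)
  then have "((\<lambda>t. integral {a..b} (\<lambda>s. \<bar>\<alpha> t - \<alpha> s\<bar>)) has_integral J b - J a) {a..b}"
    by (rule has_integral_eq[rotated]) (simp add: inner)
  then show ?thesis
    using assms by (simp add: arc_cost_def integral_unique J_def algebra_simps)
qed

text \<open>In terms of \<open>breg c\<close>, the cost is 2 (b - a) (breg c a + breg c b) minus
  four times the integral of \<open>breg c\<close> over [a, b]. A convex function vanishing at
  \<open>c\<close> lies below its chords from \<open>c\<close>, so the integral on each side of
  \<open>c\<close> is at most the area of a triangle. Subtracting the triangles leaves exactly the
  mixed products.\<close>

lemma arc_cost_breg_lower:
  assumes "a \<le> c" "c \<le> b"
  shows "2 * ((c - a) * breg c b + (b - c) * breg c a) \<le> arc_cost a b"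
proof -
  \<comment> \<open>The primitive of \<open>breg c\<close> that vanishes at
    \<open>c\<close>.\<close>
  define I where "I u = alpha_prim2 u - alpha_prim2 c - alpha_prim c * (u - c) - \<alpha> c * (u - c)^2 / 2" for u
  \<comment> \<open>Signed triangle area minus integral. Its derivative is half the Bregman
    divergence with exchanged arguments, hence nonnegative.\<close>
  define F where "F u = (u - c) * breg c u / 2 - I u" for u
  have F': "(F has_real_derivative breg u c / 2) (at u)" for u
    unfolding F_def I_def
    by (auto intro!: derivative_eq_intros alpha_prim2_deriv breg_deriv)
       (auto simp: breg_def algebra_simps add_divide_distrib diff_divide_distrib)
  have "F a \<le> F c" "F c \<le> F b"
    using assms breg_nonneg by (auto intro!: DERIV_nonneg_le[OF _ F'])
  moreover have "F c = 0" by (simp add: F_def I_def)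
  ultimately have "I b \<le> (b - c) * breg c b / 2" "(a - c) * breg c a / 2 \<le> I a"
    by (simp_all add: F_def)
  moreover have "arc_cost a b = 2 * (b - a) * (breg c a + breg c b) - 4 * (I b - I a)"
    using assms by (simp add: arc_cost_eq breg_def I_def power2_eq_square field_simps)
  ultimately show ?thesis by (simp add: algebra_simps)
qed

lemma arc_cost_self: "arc_cost a a = 0"
  by (simp add: arc_cost_def)

lemma arc_cost_pos: "a \<noteq> b \<Longrightarrow> 0 < arc_cost a b"
proof -
  have *: "0 < arc_cost a b" if "a < b" for a b
  proof -
    define c where "c = (a + b) / 2"
    have c: "a < c" "c < b" using that by (auto simp: c_def)
    have "0 < (c - a) * breg c b" "0 \<le> (b - c) * breg c a" using c breg_pos breg_nonneg by auto
    then show ?thesis using arc_cost_breg_lower[of a c b] c by auto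
  qed
  assume "a \<noteq> b"
  then show ?thesis using *[of a b] *[of b a] by (auto simp: neq_iff arc_cost_commute)
qed

lemma arc_cost_nonneg: "0 \<le> arc_cost a b"
  using arc_cost_pos[of a b] arc_cost_self[of a] by (cases "a = b") auto

text \<open>The closed form valid for a \<le> b changes sign when the endpoints are exchanged, so
  its absolute value represents the nonnegative cost for either order.\<close>

lemma continuous_arc_cost: "continuous_on UNIV (\<lambda>p. arc_cost (fst p) (snd p))"
proof -
  have eq: "arc_cost a b = \<bar>2 * (b - a) * (alpha_prim a + alpha_prim b) - 4 * (alpha_prim2 b - alpha_prim2 a)\<bar>" for a b
  proof (cases "a \<le> b")
    case True
    then show ?thesis using arc_cost_nonneg[of a b] by (simp add: arc_cost_eq)
  next
    case False
    then have "arc_cost a b = 2 * (a - b) * (alpha_prim b + alpha_prim a) - 4 * (alpha_prim2 a - alpha_prim2 b)"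
      by (subst arc_cost_commute) (simp add: arc_cost_eq)
    also have "\<dots> = - (2 * (b - a) * (alpha_prim a + alpha_prim b) - 4 * (alpha_prim2 b - alpha_prim2 a))"
      by (simp add: algebra_simps)
    finally show ?thesis using arc_cost_nonneg[of a b] by linarith
  qed
  have "continuous_on UNIV alpha_prim2"
    by (meson DERIV_isCont alpha_prim2_deriv continuous_at_imp_continuous_on)
  note c = this alpha_prim_continuous[of UNIV]
  have "continuous_on UNIV (\<lambda>p::real \<times> real. alpha_prim (fst p))" "continuous_on UNIV (\<lambda>p::real \<times> real. alpha_prim (snd p))"
    "continuous_on UNIV (\<lambda>p::real \<times> real. alpha_prim2 (fst p))" "continuous_on UNIV (\<lambda>p::real \<times> real. alpha_prim2 (snd p))"
    by (rule continuous_on_compose2[OF c(2)] continuous_on_compose2[OF c(1)], intro continuous_intros, simp)+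
  then show ?thesis unfolding eq by (intro continuous_intros)
qed

lemma alpha_diff_periodic: "\<alpha> (s + 2 * pi * of_int k) - \<alpha> (t + 2 * pi * of_int k) = \<alpha> s - \<alpha> t"
proof -
  obtain P where P: "\<And>t. \<alpha> (t + 2 * pi) = \<alpha> t + P" using alpha_shift by metis
  show ?thesis
  proof (induction k rule: int_induct[where k = 0])
    case (step1 i)
    then show ?case
      using P[of "s + 2 * pi * of_int i"] P[of "t + 2 * pi * of_int i"] by (simp add: algebra_simps)
  next
    case (step2 i)
    then show ?case
      using P[of "s + 2 * pi * of_int (i - 1)"] P[of "t + 2 * pi * of_int (i - 1)"] by (simp add: algebra_simps)
  qed simp
qed

lemma arc_cost_periodic: "arc_cost (a + 2 * pi * of_int k) (b + 2 * pi * of_int k) = arc_cost a b"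
proof -
  define d :: real where "d = 2 * pi * of_int k"
  have shift: "integral {x + d..y + d} f = integral {x..y} (\<lambda>t. f (t + d))" for x y :: real and f :: "real \<Rightarrow> real"
    using integral_shift_Icc_real[of x y f d] by (simp add: o_def add.commute)
  have "min (a + d) (b + d) = min a b + d" "max (a + d) (b + d) = max a b + d" by auto
  then show ?thesis
    unfolding arc_cost_def d_def[symmetric] using alpha_diff_periodic[of _ k, folded d_def] by (simp add: shift)
qed

text \<open>A common shift by periods confines the first endpoint to a compact interval; there the
  positive continuous cost attains its minimum.\<close>

lemma arc_cost_lower_bound:
  assumes "0 < \<eta>"
  obtains \<kappa> where "\<kappa> > 0" "\<And>a b. \<lbrakk>\<eta> \<le> \<bar>a - b\<bar>; \<bar>a - b\<bar> \<le> pi\<rbrakk> \<Longrightarrow> \<kappa> \<le> arc_cost a b"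
proof (cases "\<eta> \<le> pi")
  case False
  then show thesis using that[of 1] by auto
next
  case True
  have "compact ({0..2 * pi} \<times> {\<eta>..pi})" "{0..2 * pi} \<times> {\<eta>..pi} \<noteq> {}"
    using True by (auto intro!: compact_Times)
  moreover have "continuous_on ({0..2 * pi} \<times> {\<eta>..pi}) (\<lambda>p. arc_cost (fst p) (fst p + snd p))"
  proof -
    have "continuous_on ({0..2 * pi} \<times> {\<eta>..pi}) (\<lambda>p. (fst p, fst p + snd p))"
      by (intro continuous_intros)
    from continuous_on_compose2[OF continuous_arc_cost this] show ?thesis by simp
  qed
  ultimately have "\<exists>q\<in>{0..2 * pi} \<times> {\<eta>..pi}. \<forall>p\<in>{0..2 * pi} \<times> {\<eta>..pi}.
      arc_cost (fst q) (fst q + snd q) \<le> arc_cost (fst p) (fst p + snd p)"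
    by (rule continuous_attains_inf)
  then obtain q where q: "q \<in> {0..2 * pi} \<times> {\<eta>..pi}" and
    min: "\<forall>p\<in>{0..2 * pi} \<times> {\<eta>..pi}. arc_cost (fst q) (fst q + snd q) \<le> arc_cost (fst p) (fst p + snd p)"
    by blast
  define s h where "s = fst q" and "h = snd q"
  have sh: "h \<in> {\<eta>..pi}" using q by (auto simp: h_def)
  have le: "arc_cost s (s + h) \<le> arc_cost a (a + k)" if "a \<in> {0..2 * pi}" "k \<in> {\<eta>..pi}" for a k
    using bspec[OF min, of "(a, k)"] that by (simp add: s_def h_def)
  have lt: "arc_cost s (s + h) \<le> arc_cost a b" if "\<eta> \<le> b - a" "b - a \<le> pi" for a b
  proof -
    obtain k where k: "a + 2 * pi * of_int k \<in> {0..<2 * pi}" by (rule reduce_mod_2pi)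
    have "arc_cost a b = arc_cost (a + 2 * pi * of_int k) (a + 2 * pi * of_int k + (b - a))"
      using arc_cost_periodic[of a k b] by (simp add: algebra_simps)
    then show ?thesis using le[of "a + 2 * pi * of_int k" "b - a"] k that by auto
  qed
  show thesis
  proof (rule that[of "arc_cost s (s + h)"])
    show "0 < arc_cost s (s + h)" using sh assms by (intro arc_cost_pos) auto
    show "arc_cost s (s + h) \<le> arc_cost a b" if "\<eta> \<le> \<bar>a - b\<bar>" "\<bar>a - b\<bar> \<le> pi" for a b
      using that lt[of a b] lt[of b a] arc_cost_commute[of a b] by (cases "a \<le> b") auto
  qed
qed

text \<open>A Borel minorant of the cost: the two arcs between antipodal points compete in
  \<^const>\<open>Pi_cost\<close>, so there only a constant is used.\<close>

definition circle_cost :: "real \<Rightarrow> real \<Rightarrow> real \<Rightarrow> real" where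
  "circle_cost \<kappa> a b = (let b' = b + 2 * pi * of_int (round ((a - b) / (2 * pi)))
     in if \<bar>a - b'\<bar> < pi then arc_cost a b' else \<kappa>)"

text \<open>Two lifts less than pi apart are unique up to a common shift, and rounding recovers
  exactly that relative shift.\<close>

lemma circle_cost_eq_arc_cost:
  assumes "\<bar>(a + 2 * pi * of_int k) - (b + 2 * pi * of_int l)\<bar> < pi"
  shows "circle_cost \<kappa> a b = arc_cost (a + 2 * pi * of_int k) (b + 2 * pi * of_int l)"
proof -
  have "\<bar>(a - b) / (2 * pi) - of_int (l - k)\<bar> < 1/2"
  proof -
    have "(a - b) / (2 * pi) - of_int (l - k) = ((a + 2 * pi * of_int k) - (b + 2 * pi * of_int l)) / (2 * pi)"
      by (simp add: field_simps)
    then show ?thesis using assms by (simp add: abs_divide field_simps)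
  qed
  then have r: "round ((a - b) / (2 * pi)) = l - k" by (rule round_unique')
  have e: "a - (b + 2 * pi * of_int (l - k)) = (a + 2 * pi * of_int k) - (b + 2 * pi * of_int l)"
    by (simp add: algebra_simps)
  have "arc_cost a (b + 2 * pi * of_int (l - k)) = arc_cost (a + 2 * pi * of_int k) (b + 2 * pi * of_int l)"
    using arc_cost_periodic[of a k "b + 2 * pi * of_int (l - k)"] by (simp add: algebra_simps)
  then show ?thesis unfolding circle_cost_def r Let_def e using assms by simp
qed

lemma circle_cost_self: "circle_cost \<kappa> a a = 0"
  by (simp add: circle_cost_def arc_cost_self)

lemma circle_cost_nonneg: "0 \<le> \<kappa> \<Longrightarrow> 0 \<le> circle_cost \<kappa> a b"
  by (simp add: circle_cost_def Let_def arc_cost_nonneg)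

lemma measurable_circle_cost [measurable]:
  assumes [measurable]: "f \<in> borel_measurable M" "g \<in> borel_measurable M"
  shows "(\<lambda>x. circle_cost \<kappa> (f x) (g x)) \<in> borel_measurable M"
proof -
  have "(\<lambda>p. arc_cost (fst p) (snd p)) \<in> borel_measurable (borel \<Otimes>\<^sub>M borel)"
    unfolding borel_prod using continuous_arc_cost by (rule borel_measurable_continuous_onI)
  then have [measurable]: "(\<lambda>x. arc_cost (u x) (v x)) \<in> borel_measurable M"
    if [measurable]: "u \<in> borel_measurable M" "v \<in> borel_measurable M" for u v
    using measurable_compose[of "\<lambda>x. (u x, v x)" M "borel \<Otimes>\<^sub>M borel" "\<lambda>p. arc_cost (fst p) (snd p)"] by simp
  show ?thesis unfolding circle_cost_def Let_def round_def by measurable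
qed

text \<open>The choice inside \<open>Pi_cost\<close> returns an unspecified admissible pair of
  parameters. If they are less than pi apart, periodicity identifies its value with
  \<open>circle_cost\<close>. If they are antipodal, only the lower bound \<kappa> is known, and
  that is the value \<open>circle_cost\<close> has there.\<close>

lemma circle_cost_le_Pi_cost:
  assumes "\<And>a b. \<bar>a - b\<bar> = pi \<Longrightarrow> \<kappa> \<le> arc_cost a b"
  shows "circle_cost \<kappa> a b \<le> Pi_cost \<gamma> \<alpha> (\<gamma> a) (\<gamma> b)"
proof -
  define b' where "b' = b + 2 * pi * of_int (round ((a - b) / (2 * pi)))"
  have "\<bar>(a - b) / (2 * pi) - of_int (round ((a - b) / (2 * pi)))\<bar> \<le> 1 / 2"
    using of_int_round_abs_le[of "(a - b) / (2 * pi)"] by (simp add: abs_minus_commute)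
  then have "\<bar>a - b'\<bar> \<le> pi" unfolding b'_def by (auto simp: field_simps abs_le_iff)
  then have "\<exists>v t1 t2. \<gamma> t1 = \<gamma> a \<and> \<gamma> t2 = \<gamma> b \<and> \<bar>t1 - t2\<bar> \<le> pi \<and> v = arc_cost t1 t2"
    using gamma_periodic_int[of b] unfolding b'_def by blast
  from someI_ex[OF this[unfolded arc_cost_def]] obtain t1 t2
    where t: "\<gamma> t1 = \<gamma> a" "\<gamma> t2 = \<gamma> b" "\<bar>t1 - t2\<bar> \<le> pi" "Pi_cost \<gamma> \<alpha> (\<gamma> a) (\<gamma> b) = arc_cost t1 t2"
    unfolding Pi_cost_def arc_cost_def by blast
  obtain k where k: "t1 = a + 2 * pi * of_int k" using t(1) gamma_eq_iff[of a t1] by auto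
  obtain l where l: "t2 = b + 2 * pi * of_int l" using t(2) gamma_eq_iff[of b t2] by auto
  show ?thesis
  proof (cases "\<bar>t1 - t2\<bar> < pi")
    case True
    then show ?thesis using circle_cost_eq_arc_cost[of a k b l \<kappa>] t(4) by (simp add: k l)
  next
    case False
    then have pi: "\<bar>t1 - t2\<bar> = pi" using t(3) by simp
    \<comment> \<open>A parity argument: when one pair of lifts differs by pi, every pair differs by
      an odd multiple of pi, so the rounded pair cannot be closer.\<close>
    have "\<not> \<bar>a - b'\<bar> < pi"
    proof
      assume *: "\<bar>a - b'\<bar> < pi"
      define n where "n = l - k - round ((a - b) / (2 * pi))"
      have "a - b' = (t1 - t2) + 2 * pi * of_int n"
        by (simp add: k l b'_def n_def algebra_simps)
      moreover have "t1 - t2 = pi \<or> t1 - t2 = - pi" using pi by (auto simp: abs_if split: if_splits)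
      ultimately have "a - b' = pi * of_int (2 * n + 1) \<or> a - b' = pi * of_int (2 * n - 1)"
        by (auto simp: algebra_simps)
      then have "\<bar>of_int (2 * n + 1) :: real\<bar> < 1 \<or> \<bar>of_int (2 * n - 1) :: real\<bar> < 1"
        using * by (auto simp: abs_mult)
      then show False by (simp only: of_int_abs[symmetric] of_int_less_1_iff) presburger
    qed
    then have "circle_cost \<kappa> a b = \<kappa>" by (simp add: circle_cost_def b'_def[symmetric])
    then show ?thesis using assms[OF pi] t(4) by simp
  qed
qed

text \<open>Values that are not close on the circle pay a fixed price. This converts a small total
  cost into a small measure of far values.\<close>

lemma circle_cost_dichotomy:
  assumes "\<kappa> > 0" "0 < \<eta>"
  obtains \<kappa>' where "\<kappa>' > 0" "\<And>a b. (\<exists>k. \<bar>a - (b + 2 * pi * of_int k)\<bar> < \<eta>) \<or> \<kappa>' \<le> circle_cost \<kappa> a b"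
proof -
  obtain \<kappa>1 where \<kappa>1: "\<kappa>1 > 0" "\<And>a b. \<lbrakk>\<eta> \<le> \<bar>a - b\<bar>; \<bar>a - b\<bar> \<le> pi\<rbrakk> \<Longrightarrow> \<kappa>1 \<le> arc_cost a b"
    using arc_cost_lower_bound[OF assms(2)] by blast
  show thesis
  proof (rule that[of "min \<kappa> \<kappa>1"])
    show "0 < min \<kappa> \<kappa>1" using assms \<kappa>1 by simp
    fix a b
    define b' where "b' = b + 2 * pi * of_int (round ((a - b) / (2 * pi)))"
    have "\<bar>a - b'\<bar> < \<eta> \<or> min \<kappa> \<kappa>1 \<le> circle_cost \<kappa> a b"
      using \<kappa>1(2)[of a b'] by (cases "\<bar>a - b'\<bar> < \<eta>") (auto simp: circle_cost_def b'_def[symmetric])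
    then show "(\<exists>k. \<bar>a - (b + 2 * pi * of_int k)\<bar> < \<eta>) \<or> min \<kappa> \<kappa>1 \<le> circle_cost \<kappa> a b"
      unfolding b'_def by blast
  qed
qed

lemma norm_gamma_diff_le: "norm (\<gamma> s - \<gamma> t) \<le> \<bar>s - t\<bar>"
proof -
  have "norm (\<gamma> s - \<gamma> t) \<le> 1 * norm (s - t)"
  proof (rule differentiable_bound[OF convex_UNIV])
    show "(\<gamma> has_derivative (\<lambda>x. x *\<^sub>R cis (\<alpha> u))) (at u within UNIV)" for u
      using gamma_deriv by (simp add: has_vector_derivative_def)
    show "onorm (\<lambda>x. x *\<^sub>R cis (\<alpha> u)) \<le> 1" for u
      by (rule onorm_le) simp
  qed auto
  then show ?thesis by simp
qed

end

section \<open>Deficit and spread of probability measures on the circle\<close>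

context unit_curve
begin

text \<open>Allowing lengths up to 2 pi instead of pi leaves room for the auxiliary endpoint in
  \<open>breg_bounded\<close>.\<close>

lemma arc_cost_upper_bound:
  obtains B where "B \<ge> 0" "\<And>a b. \<bar>a - b\<bar> \<le> 2 * pi \<Longrightarrow> arc_cost a b \<le> B"
proof -
  let ?S = "{0..2 * pi} \<times> {-2 * pi..2 * pi}"
  have "continuous_on ?S (\<lambda>p. (fst p, fst p + snd p))"
    by (intro continuous_intros)
  from continuous_on_compose2[OF continuous_arc_cost this]
  have "continuous_on ?S (\<lambda>p. arc_cost (fst p) (fst p + snd p))" by simp
  then have "bounded ((\<lambda>p. arc_cost (fst p) (fst p + snd p)) ` ?S)"
    by (intro compact_imp_bounded compact_continuous_image compact_Times compact_Icc)
  then obtain B where "B > 0" and B: "\<forall>p\<in>?S. norm (arc_cost (fst p) (fst p + snd p)) \<le> B"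
    unfolding bounded_pos by blast
  show thesis
  proof (rule that[of B])
    fix a b :: real assume ab: "\<bar>a - b\<bar> \<le> 2 * pi"
    obtain k where k: "a + 2 * pi * of_int k \<in> {0..<2 * pi}" by (rule reduce_mod_2pi)
    have "arc_cost a b = arc_cost (a + 2 * pi * of_int k) (a + 2 * pi * of_int k + (b - a))"
      using arc_cost_periodic[of a k b] by (simp add: algebra_simps)
    also have "\<dots> \<le> B"
      using bspec[OF B, of "(a + 2 * pi * of_int k, b - a)"] k ab
      by (auto simp: abs_le_iff)
    finally show "arc_cost a b \<le> B" .
  qed (use \<open>B > 0\<close> in simp)
qed

lemma circle_cost_bounded:
  obtains B where "B \<ge> 0" "\<And>a b. circle_cost \<kappa> a b \<le> B"
proof -
  obtain B where B: "B \<ge> 0" "\<And>a b. \<bar>a - b\<bar> \<le> 2 * pi \<Longrightarrow> arc_cost a b \<le> B"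
    using arc_cost_upper_bound by metis
  show thesis
  proof (rule that[of "max B \<kappa>"])
    show "circle_cost \<kappa> a b \<le> max B \<kappa>" for a b
      using B(2)[of a "b + 2 * pi * of_int (round ((a - b) / (2 * pi)))"] pi_gt_zero
      unfolding circle_cost_def Let_def by (simp add: le_max_iff_disj)
  qed (use B in auto)
qed

text \<open>Adjoin an endpoint at distance 1 on the other side of \<open>c\<close>. The lower bound
  for the cost of the enlarged arc then contains \<open>breg c u\<close> with the factor 2.\<close>

lemma breg_bounded:
  obtains B where "B \<ge> 0" "\<And>c u. \<bar>u - c\<bar> \<le> pi \<Longrightarrow> breg c u \<le> B"
proof -
  obtain B where B: "B \<ge> 0" "\<And>a b. \<bar>a - b\<bar> \<le> 2 * pi \<Longrightarrow> arc_cost a b \<le> B"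
    using arc_cost_upper_bound by metis
  have "breg c u \<le> B" if "\<bar>u - c\<bar> \<le> pi" for c u
  proof (cases "c \<le> u")
    case True
    have "\<bar>c - 1 - u\<bar> \<le> 2 * pi" using that pi_gt3 by auto
    then have "arc_cost (c - 1) u \<le> B" by (rule B(2))
    moreover have "0 \<le> (u - c) * breg c (c - 1)" using True breg_nonneg by simp
    ultimately show ?thesis
      using arc_cost_breg_lower[of "c - 1" c u] True breg_nonneg[of c u] by simp
  next
    case False
    have "\<bar>u - (c + 1)\<bar> \<le> 2 * pi" using that pi_gt3 by auto
    then have "arc_cost u (c + 1) \<le> B" by (rule B(2))
    moreover have "0 \<le> (c - u) * breg c (c + 1)" using False breg_nonneg by simp
    ultimately show ?thesis
      using arc_cost_breg_lower[of u c "c + 1"] False breg_nonneg[of c u] by simp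
  qed
  with B(1) show thesis by (rule that)
qed

lemma norm_gamma_diff_le_2pi: "norm (\<gamma> s - \<gamma> t) \<le> 2 * pi"
proof -
  obtain k where k: "s + 2 * pi * of_int k \<in> {0..<2 * pi}" by (rule reduce_mod_2pi)
  obtain l where l: "t + 2 * pi * of_int l \<in> {0..<2 * pi}" by (rule reduce_mod_2pi)
  have "norm (\<gamma> s - \<gamma> t) \<le> \<bar>(s + 2 * pi * of_int k) - (t + 2 * pi * of_int l)\<bar>"
    using norm_gamma_diff_le[of "s + 2 * pi * of_int k" "t + 2 * pi * of_int l"] by (simp add: gamma_periodic_int)
  then show ?thesis using k l by auto
qed

text \<open>The linear functional of dual norm 1 that attains the norm at \<gamma> c; its level line
  through \<gamma> c is the tangent to the unit ball.\<close>

definition support_fn :: "real \<Rightarrow> complex \<Rightarrow> real" where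
  "support_fn c z = cross z (cis (\<alpha> c)) / cross (\<gamma> c) (cis (\<alpha> c))"

lemma support_fn_le: "support_fn c z \<le> N z"
  using support_line[of c z] by (simp add: support_fn_def)

lemma support_fn_ge: "- N z \<le> support_fn c z"
proof -
  have "support_fn c (- z) = - support_fn c z"
    unfolding support_fn_def by (subst minus_divide_left) (simp add: cross_def)
  then show ?thesis using support_fn_le[of c "- z"] by (simp add: N_minus)
qed

lemma measurable_gamma [measurable]: "\<gamma> \<in> borel_measurable borel"
  using gamma_continuous by (rule borel_measurable_continuous_onI)

lemma measurable_support_fn [measurable]: "support_fn c \<in> borel_measurable borel"
  unfolding support_fn_def cross_def by measurable

lemma measurable_breg [measurable]: "breg c \<in> borel_measurable borel"
proof -
  have "continuous_on UNIV (breg c)"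
    by (meson DERIV_isCont breg_deriv continuous_at_imp_continuous_on)
  then show ?thesis by (rule borel_measurable_continuous_onI)
qed

text \<open>For points lifted to one short arc with mean \<open>c\<close>, the points left and right of \<open>c\<close> have
  equal first moments, so integrating \<open>arc_cost_breg_lower\<close> over pairs on opposite sides of
  \<open>c\<close> produces the product of the two averages. The remaining points are paid for by
  \<^const>\<open>circle_cost\<close> being bounded below.\<close>

lemma deficit_times_spread_le:
  assumes "\<kappa> > 0"
  obtains C where "C \<ge> 0"
    "\<And>(M :: 'a measure) (T :: 'a \<Rightarrow> real). \<lbrakk>prob_space M; T \<in> borel_measurable M\<rbrakk> \<Longrightarrow>
      \<exists>c. (\<integral>y. 1 - support_fn c (\<gamma> (T y)) \<partial>M) * (\<integral>y. norm (\<gamma> (T y) - \<gamma> c) \<partial>M)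
        \<le> C * (\<integral>x. \<integral>y. circle_cost \<kappa> (T x) (T y) \<partial>M \<partial>M)"
proof -
  obtain \<kappa>' where \<kappa>': "\<kappa>' > 0"
    "\<And>a b. (\<exists>k. \<bar>a - (b + 2 * pi * of_int k)\<bar> < pi / 2) \<or> \<kappa>' \<le> circle_cost \<kappa> a b"
    using circle_cost_dichotomy[OF assms, of "pi / 2"] pi_gt_zero by (metis half_gt_zero)
  obtain D0 where D0: "D0 > 0" "\<And>t. D0 \<le> cross (\<gamma> t) (cis (\<alpha> t))"
    using cross_gamma_lower_bound by metis
  obtain Bq where Bq: "Bq \<ge> 0" "\<And>a b. circle_cost \<kappa> a b \<le> Bq" using circle_cost_bounded by metis
  obtain Bg where Bg: "Bg \<ge> 0" "\<And>c u. \<bar>u - c\<bar> \<le> pi \<Longrightarrow> breg c u \<le> Bg" using breg_bounded by metis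
  \<comment> \<open>The first summand belongs to the product of the two main terms. The others
    collect the mixed terms with a factor \<open>p\<close>, each paid for by
    \<open>p \<le> P / \<kappa>'\<close>.\<close>
  define C where "C = 1 / (2 * D0) + (2 * pi * Bg / D0 + 2 * pi + 4 * pi) / \<kappa>'"
  show thesis
  proof (rule that[of C])
    show "C \<ge> 0" using D0 \<kappa>' Bg by (auto simp: C_def)
  next
    fix M :: "'a measure" and T :: "'a \<Rightarrow> real" assume M: "prob_space M" and [measurable]: "T \<in> borel_measurable M"
    interpret prob_space M by fact
    define q where "q x y = circle_cost \<kappa> (T x) (T y)" for x y
    have qm[measurable]: "(\<lambda>p. q (fst p) (snd p)) \<in> borel_measurable (M \<Otimes>\<^sub>M M)"
      unfolding q_def by measurable
    have q0: "0 \<le> q x y" "q x y \<le> Bq" for x y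
      using assms Bq by (auto simp: q_def intro: circle_cost_nonneg)
    have q1[measurable]: "q x \<in> borel_measurable M" for x unfolding q_def by measurable
    have qi: "integrable M (q x)" for x
      using q0 by (intro integrable_const_bound[where B = Bq]) auto
    define h where "h x = (\<integral>y. q x y \<partial>M)" for x
    have h0: "0 \<le> h x" "h x \<le> Bq" for x
      using q0 by (auto simp: h_def intro!: integral_nonneg_AE integral_le_const qi)
    have [measurable]: "h \<in> borel_measurable M" unfolding h_def
      by (rule borel_measurable_lebesgue_integral) (simp add: split_beta')
    have hi: "integrable M h"
      using h0 by (intro integrable_const_bound[where B = Bq]) auto
    define P where "P = (\<integral>x. h x \<partial>M)"
    \<comment> \<open>Some point has average cost at most the mean. Its angle is the reference
      around which the circle is cut open.\<close>
    have "\<exists>x0\<in>space M. h x0 \<le> P"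
    proof (rule ccontr)
      assume "\<not> (\<exists>x0\<in>space M. h x0 \<le> P)"
      then have "AE x in M. P < h x" by (intro AE_I2) auto
      then have "P < expectation h" by (rule expectation_greater[OF hi])
      then show False by (simp add: P_def)
    qed
    then obtain x0 where x0: "x0 \<in> space M" "h x0 \<le> P" by blast
    define c0 where "c0 = T x0"
    define n where "n y = round ((c0 - T y) / (2 * pi))" for y
    define U where "U y = T y + 2 * pi * of_int (n y)" for y
    have [measurable]: "U \<in> borel_measurable M" unfolding U_def n_def round_def by measurable
    have gU: "\<gamma> (U y) = \<gamma> (T y)" for y by (simp add: U_def gamma_periodic_int)
    \<comment> \<open>The radius pi/2 makes any two lifts in \<open>V\<close> less than pi apart, so
      that \<open>circle_cost\<close> is their arc cost, and keeps them within pi of every point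
      that is itself within pi/2 of \<open>c0\<close>, such as the mean below.\<close>
    define V where "V = {y \<in> space M. \<bar>c0 - U y\<bar> < pi / 2}"
    have [measurable]: "V \<in> sets M" unfolding V_def by measurable
    have far: "\<kappa>' \<le> q x0 y" if "y \<in> space M" "y \<notin> V" for y
    proof (rule ccontr)
      assume "\<not> \<kappa>' \<le> q x0 y"
      then obtain k where k: "\<bar>c0 - (T y + 2 * pi * of_int k)\<bar> < pi / 2"
        using \<kappa>'(2)[of c0 "T y"] by (auto simp: q_def c0_def)
      have "(c0 - T y) / (2 * pi) - of_int k = (c0 - (T y + 2 * pi * of_int k)) / (2 * pi)"
        by (simp add: field_simps)
      moreover have "\<bar>c0 - (T y + 2 * pi * of_int k)\<bar> < pi" using k pi_gt_zero by linarith
      ultimately have "\<bar>(c0 - T y) / (2 * pi) - of_int k\<bar> < 1 / 2" by (simp add: abs_divide field_simps)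
      then have "n y = k" unfolding n_def by (rule round_unique')
      then show False using that k by (simp add: V_def U_def)
    qed
    define p where "p = measure M (space M - V)"
    have p: "0 \<le> p" "p \<le> 1" by (simp_all add: p_def)
    have [simp]: "integrable M (indicat_real (space M - V))"
      by (intro integrable_real_indicator) (auto simp: less_top[symmetric])
    \<comment> \<open>Markov's inequality for the cost seen from the reference point.\<close>
    have pP: "\<kappa>' * p \<le> P"
    proof -
      have "\<kappa>' * p = (\<integral>y. \<kappa>' * indicator (space M - V) y \<partial>M)" by (simp add: p_def)
      also have "\<dots> \<le> h x0"
        unfolding h_def
      proof (rule integral_mono)
        show "integrable M (\<lambda>y. \<kappa>' * indicator (space M - V) y)"
          by (intro integrable_mult_right) simp
        show "\<kappa>' * indicator (space M - V) y \<le> q x0 y" if "y \<in> space M" for y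
          using far[OF that] q0(1)[of x0 y] by (cases "y \<in> V") (simp_all add: that)
      qed (rule qi)
      finally show ?thesis using x0 by simp
    qed
    have P0: "0 \<le> P" using order_trans[OF _ pP] p \<kappa>' by simp
    have bnd: "integrable M f" if "f \<in> borel_measurable M" "\<And>y. y \<in> space M \<Longrightarrow> \<bar>f y\<bar> \<le> B" for f and B :: real
      using that by (intro integrable_const_bound[where B = B]) auto
    define v where "v = measure M V"
    \<comment> \<open>The mean of the lifts over \<open>V\<close>, with the reference angle as
      default when \<open>V\<close> is a null set.\<close>
    define c where "c = (if v = 0 then c0 else (\<integral>y. indicator V y * U y \<partial>M) / v)"
    have VU: "integrable M (\<lambda>y. indicator V y * U y)"
    proof (rule bnd[of _ "\<bar>c0\<bar> + pi / 2"])
      fix y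
      have "\<bar>U y\<bar> \<le> \<bar>c0\<bar> + pi / 2" if "y \<in> V"
      proof -
        have "\<bar>c0 - U y\<bar> < pi / 2" using that by (simp add: V_def)
        then show ?thesis by linarith
      qed
      then show "\<bar>indicator V y * U y\<bar> \<le> \<bar>c0\<bar> + pi / 2"
        using pi_gt_zero by (auto simp: indicator_def)
    qed measurable
    have Vi: "integrable M (\<lambda>y. indicator V y * d)" for d :: real
      by (rule bnd[of _ "\<bar>d\<bar>"]) (auto simp: indicator_def)
    have cc0: "\<bar>c - c0\<bar> \<le> pi / 2"
    proof (cases "v = 0")
      case False
      then have "v > 0" by (simp add: v_def zero_less_measure_iff)
      have Vb: "U y \<le> c0 + pi / 2" "c0 - pi / 2 \<le> U y" if "y \<in> V" for y
      proof -
        have "\<bar>c0 - U y\<bar> < pi / 2" using that by (simp add: V_def)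
        then show "U y \<le> c0 + pi / 2" "c0 - pi / 2 \<le> U y" by linarith+
      qed
      have "(\<integral>y. indicator V y * U y \<partial>M) \<le> (\<integral>y. indicator V y * (c0 + pi / 2) \<partial>M)"
        by (rule integral_mono[OF VU Vi]) (use Vb in \<open>simp add: indicator_def\<close>)
      moreover have "(\<integral>y. indicator V y * (c0 - pi / 2) \<partial>M) \<le> (\<integral>y. indicator V y * U y \<partial>M)"
        by (rule integral_mono[OF Vi VU]) (use Vb in \<open>simp add: indicator_def\<close>)
      ultimately have "(\<integral>y. indicator V y * U y \<partial>M) \<le> v * (c0 + pi / 2)"
        "v * (c0 - pi / 2) \<le> (\<integral>y. indicator V y * U y \<partial>M)"
        by (simp_all add: v_def)
      then have "c \<le> c0 + pi / 2" "c0 - pi / 2 \<le> c"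
        using False \<open>v > 0\<close> by (simp_all add: c_def field_simps)
      then show ?thesis by linarith
    qed (simp add: c_def)
    have Uc: "\<bar>U y - c\<bar> \<le> pi" if "y \<in> V" for y
    proof -
      have "\<bar>c0 - U y\<bar> < pi / 2" using that by (simp add: V_def)
      then show ?thesis using cc0 by linarith
    qed
    have mean: "(\<integral>y. indicator V y * (U y - c) \<partial>M) = 0"
    proof (cases "v = 0")
      case True
      then have "AE y in M. y \<notin> V" by (intro AE_not_in null_setsI) (simp_all add: v_def emeasure_eq_measure)
      then show ?thesis by (intro integral_eq_zero_AE) (auto simp: indicator_def)
    next
      case False
      have "(\<integral>y. indicator V y * (U y - c) \<partial>M) = (\<integral>y. indicator V y * U y - indicator V y * c \<partial>M)"
        by (simp add: right_diff_distrib)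
      also have "\<dots> = (\<integral>y. indicator V y * U y \<partial>M) - v * c"
        by (subst Bochner_Integration.integral_diff) (use VU Vi in \<open>auto simp: v_def\<close>)
      finally show ?thesis using False by (simp add: c_def)
    qed
    \<comment> \<open>Distances to \<open>c\<close> and Bregman divergences at \<open>c\<close>,
      separated into the contributions from the right (\<open>ap\<close>, \<open>gp\<close>) and
      from the left (\<open>am\<close>, \<open>gm\<close>). All four vanish off
      \<open>V\<close>.\<close>
    define ap am gp gm where "ap y = indicator V y * max 0 (U y - c)"
      and "am y = indicator V y * max 0 (c - U y)"
      and "gp y = indicator V y * (if c \<le> U y then breg c (U y) else 0)"
      and "gm y = indicator V y * (if c \<le> U y then 0 else breg c (U y))" for y
    have nn: "0 \<le> ap y" "0 \<le> am y" "0 \<le> gp y" "0 \<le> gm y" for y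
      by (auto simp: ap_def am_def gp_def gm_def breg_nonneg)
    have ubd: "ap y \<le> pi" "am y \<le> pi" "gp y \<le> Bg" "gm y \<le> Bg" for y
      using Uc[of y] Bg(1) Bg(2)[of "U y" c] pi_gt_zero
      by (auto simp: ap_def am_def gp_def gm_def indicator_def abs_le_iff)
    have meas[measurable]: "ap \<in> borel_measurable M" "am \<in> borel_measurable M" "gp \<in> borel_measurable M" "gm \<in> borel_measurable M"
      unfolding ap_def am_def gp_def gm_def by measurable
    have ints: "integrable M ap" "integrable M am" "integrable M gp" "integrable M gm"
      by (rule bnd[of _ "max pi Bg"]; simp add: nn ubd le_max_iff_disj)+
    define A where "A = (\<integral>y. ap y \<partial>M)"
    have A: "(\<integral>y. am y \<partial>M) = A"
    proof -
      have "ap y - am y = indicator V y * (U y - c)" for y by (auto simp: ap_def am_def indicator_def)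
      then have "A - (\<integral>y. am y \<partial>M) = 0"
        using mean unfolding A_def by (subst Bochner_Integration.integral_diff[symmetric]) (use ints in auto)
      then show ?thesis by simp
    qed
    define Gp Gm where "Gp = (\<integral>y. gp y \<partial>M)" and "Gm = (\<integral>y. gm y \<partial>M)"
    have Apos: "0 \<le> A" "A \<le> pi" using nn ubd ints by (auto simp: A_def intro!: integral_nonneg_AE integral_le_const)
    have Gpos: "0 \<le> Gp" "0 \<le> Gm" using nn by (auto simp: Gp_def Gm_def intro!: integral_nonneg_AE)
    \<comment> \<open>The first bracket is active when \<open>y\<close> is left and \<open>z\<close>
      right of \<open>c\<close>, the second in the opposite order; for other pairs the left side is
      0 and the cost is nonnegative.\<close>
    have lower: "2 * (am y * gp z + gm y * ap z) + 2 * (ap y * gm z + gp y * am z) \<le> q y z"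
      if yz: "y \<in> space M" "z \<in> space M" for y z
    proof (cases "y \<in> V \<and> z \<in> V")
      case False
      then show ?thesis using q0[of y z] by (auto simp: ap_def am_def gp_def gm_def)
    next
      case True
      then have "\<bar>c0 - U y\<bar> < pi / 2" "\<bar>c0 - U z\<bar> < pi / 2" by (simp_all add: V_def)
      then have "\<bar>U y - U z\<bar> < pi" by linarith
      then have qe: "q y z = arc_cost (U y) (U z)"
        unfolding q_def U_def by (rule circle_cost_eq_arc_cost)
      consider "U y < c" "c \<le> U z" | "c \<le> U y" "U z < c" | "U y < c" "U z < c" | "c \<le> U y" "c \<le> U z"
        by linarith
      then show ?thesis
      proof cases
        case 1
        then show ?thesis using arc_cost_breg_lower[of "U y" c "U z"] True
          by (simp add: ap_def am_def gp_def gm_def qe mult.commute)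
      next
        case 2
        then show ?thesis using arc_cost_breg_lower[of "U z" c "U y"] True
          by (simp add: ap_def am_def gp_def gm_def qe arc_cost_commute[of "U y"] mult.commute)
      qed (use arc_cost_nonneg[of "U y" "U z"] True in \<open>simp_all add: ap_def am_def gp_def gm_def qe\<close>)
    qed
    \<comment> \<open>Because both one-sided first moments equal \<open>A\<close>, each of the four
      mixed products integrates to \<open>A\<close> times \<open>Gp\<close> or \<open>Gm\<close>.
      Together they form the full product, although only pairs on opposite sides were used.\<close>
    have AG: "4 * A * (Gp + Gm) \<le> P"
    proof -
      have inner: "2 * (am y * Gp + gm y * A) + 2 * (ap y * Gm + gp y * A) \<le> h y" if "y \<in> space M" for y
      proof -
        have "2 * (am y * Gp + gm y * A) + 2 * (ap y * Gm + gp y * A)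
          = (\<integral>z. 2 * (am y * gp z + gm y * ap z) + 2 * (ap y * gm z + gp y * am z) \<partial>M)"
          using ints A by (simp add: Gp_def Gm_def A_def)
        also have "\<dots> \<le> h y"
          unfolding h_def
          by (rule integral_mono)
             (use lower[OF that] ints qi in \<open>auto intro!: Bochner_Integration.integrable_add integrable_mult_right\<close>)
        finally show ?thesis .
      qed
      have "4 * A * (Gp + Gm) = (\<integral>y. 2 * (am y * Gp + gm y * A) + 2 * (ap y * Gm + gp y * A) \<partial>M)"
        using ints A by (simp add: Gp_def Gm_def A_def algebra_simps)
      also have "\<dots> \<le> P"
        unfolding P_def
        by (rule integral_mono)
           (use inner ints hi in \<open>auto intro!: Bochner_Integration.integrable_add integrable_mult_right integrable_mult_left\<close>)
      finally show ?thesis .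
    qed
    have Gle: "Gp + Gm \<le> Bg"
    proof -
      have "Gp + Gm = (\<integral>y. gp y + gm y \<partial>M)" using ints by (simp add: Gp_def Gm_def)
      also have "\<dots> \<le> Bg"
      proof (rule integral_le_const)
        show "AE y in M. gp y + gm y \<le> Bg"
          using Uc Bg by (intro AE_I2) (auto simp: gp_def gm_def indicator_def)
      qed (use ints in auto)
      finally show ?thesis .
    qed
    have deficit: "(\<integral>y. 1 - support_fn c (\<gamma> (T y)) \<partial>M) \<le> (Gp + Gm) / D0 + 2 * p"
    proof -
      have pw: "1 - support_fn c (\<gamma> (T y)) \<le> (gp y + gm y) / D0 + 2 * indicator (space M - V) y" if "y \<in> space M" for y
      proof (cases "y \<in> V")
        case True
        have "1 - support_fn c (\<gamma> (T y)) \<le> breg c (U y) / cross (\<gamma> c) (cis (\<alpha> c))"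
          using support_deficit_le[where u="U y" and c=c] by (simp add: support_fn_def gU)
        also have "\<dots> \<le> breg c (U y) / D0"
          using D0 D0(2)[of c] breg_nonneg cross_gamma_pos[of c] by (intro divide_left_mono) auto
        finally show ?thesis using True by (auto simp: gp_def gm_def)
      next
        case False
        then show ?thesis
          using support_fn_ge[of "\<gamma> (T y)" c] that by (simp add: N_gamma gp_def gm_def)
      qed
      have "(\<integral>y. 1 - support_fn c (\<gamma> (T y)) \<partial>M) \<le> (\<integral>y. (gp y + gm y) / D0 + 2 * indicator (space M - V) y \<partial>M)"
      proof (rule integral_mono)
        show "integrable M (\<lambda>y. 1 - support_fn c (\<gamma> (T y)))"
          using support_fn_le[of c "\<gamma> (T _)"] support_fn_ge[of "\<gamma> (T _)" c]
          by (intro bnd[of _ 2]) (measurable, simp add: N_gamma abs_le_iff)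
        show "integrable M (\<lambda>y. (gp y + gm y) / D0 + 2 * indicator (space M - V) y)"
          using ints by (auto intro!: Bochner_Integration.integrable_add)
      qed (use pw in auto)
      also have "\<dots> = (Gp + Gm) / D0 + 2 * p"
        using ints by (simp add: Gp_def Gm_def p_def)
      finally show ?thesis .
    qed
    have spread: "(\<integral>y. norm (\<gamma> (T y) - \<gamma> c) \<partial>M) \<le> 2 * A + 2 * pi * p"
    proof -
      have pw: "norm (\<gamma> (T y) - \<gamma> c) \<le> (ap y + am y) + 2 * pi * indicator (space M - V) y" if "y \<in> space M" for y
      proof (cases "y \<in> V")
        case True
        then show ?thesis using norm_gamma_diff_le[of "U y" c] by (auto simp: gU ap_def am_def)
      next
        case False
        then show ?thesis using norm_gamma_diff_le_2pi[of "T y" c] that by (simp add: ap_def am_def)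
      qed
      have "(\<integral>y. norm (\<gamma> (T y) - \<gamma> c) \<partial>M) \<le> (\<integral>y. (ap y + am y) + 2 * pi * indicator (space M - V) y \<partial>M)"
      proof (rule integral_mono)
        show "integrable M (\<lambda>y. norm (\<gamma> (T y) - \<gamma> c))"
          using norm_gamma_diff_le_2pi by (intro bnd[of _ "2 * pi"]) auto
        show "integrable M (\<lambda>y. ap y + am y + 2 * pi * indicator (space M - V) y)"
          using ints by (auto intro!: Bochner_Integration.integrable_add)
      qed (use pw in auto)
      also have "\<dots> = 2 * A + 2 * pi * p"
        using ints A by (simp add: A_def p_def)
      finally show ?thesis .
    qed
    have "(\<integral>y. 1 - support_fn c (\<gamma> (T y)) \<partial>M) * (\<integral>y. norm (\<gamma> (T y) - \<gamma> c) \<partial>M)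
        \<le> ((Gp + Gm) / D0 + 2 * p) * (2 * A + 2 * pi * p)"
      using deficit spread p D0 Gpos by (intro mult_mono) (auto intro!: integral_nonneg_AE add_nonneg_nonneg)
    \<comment> \<open>The first term is controlled by \<open>AG\<close>; everything else carries a
      factor \<open>p\<close> and is controlled by \<open>pP\<close> with crude bounds for the
      cofactor.\<close>
    also have "\<dots> = (4 * A * (Gp + Gm)) / (2 * D0) + p * (2 * pi * (Gp + Gm) / D0 + 4 * A + 4 * pi * p)"
      using D0 by (simp add: field_simps)
    also have "\<dots> \<le> P / (2 * D0) + p * (2 * pi * Bg / D0 + 2 * pi + 4 * pi)"
    proof -
      have "2 * A = (\<integral>y. ap y + am y \<partial>M)" using ints A by (simp add: A_def)
      also have "\<dots> \<le> pi"
      proof (rule integral_le_const)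
        show "AE y in M. ap y + am y \<le> pi"
          using Uc pi_gt_zero by (intro AE_I2) (auto simp: ap_def am_def indicator_def abs_le_iff max_def)
      qed (use ints in auto)
      finally have 1: "4 * A \<le> 2 * pi" by simp
      have 2: "4 * pi * p \<le> 4 * pi" using p by simp
      have 3: "2 * pi * (Gp + Gm) / D0 \<le> 2 * pi * Bg / D0"
        using Gle D0 by (intro divide_right_mono mult_left_mono) auto
      have "p * (2 * pi * (Gp + Gm) / D0 + 4 * A + 4 * pi * p) \<le> p * (2 * pi * Bg / D0 + 2 * pi + 4 * pi)"
        by (rule mult_left_mono[OF _ p(1)]) (use 1 2 3 in linarith)
      moreover have "4 * A * (Gp + Gm) / (2 * D0) \<le> P / (2 * D0)"
        using AG D0 by (intro divide_right_mono) auto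
      ultimately show ?thesis by linarith
    qed
    also have "\<dots> \<le> P / (2 * D0) + (P / \<kappa>') * (2 * pi * Bg / D0 + 2 * pi + 4 * pi)"
      using pP \<kappa>' D0 Bg by (intro add_left_mono mult_right_mono) (auto simp: field_simps intro!: add_nonneg_nonneg)
    also have "\<dots> = C * P" unfolding C_def by (simp only: distrib_right times_divide_eq_left times_divide_eq_right mult_1_left mult.commute[of P])
    finally show "\<exists>c. (\<integral>y. 1 - support_fn c (\<gamma> (T y)) \<partial>M) * (\<integral>y. norm (\<gamma> (T y) - \<gamma> c) \<partial>M)
        \<le> C * (\<integral>x. \<integral>y. circle_cost \<kappa> (T x) (T y) \<partial>M \<partial>M)"
      unfolding P_def h_def q_def by blast
  qed
qed

end

section \<open>Extension of entropies to the plane\<close>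

lemma has_derivative_Im_compose:
  assumes "(f has_vector_derivative d) (at (Im w))"
  shows "((\<lambda>w. f (Im w)) has_derivative (\<lambda>v. Im v *\<^sub>R d)) (at w)"
  using has_derivative_compose[of Im Im w UNIV f "\<lambda>x. x *\<^sub>R d"] assms
  by (simp add: has_vector_derivative_def bounded_linear_imp_has_derivative bounded_linear_Im)

lemma has_derivative_zero_quadratic:
  fixes f :: "'a::real_normed_vector \<Rightarrow> 'b::real_normed_vector"
  assumes "0 < e" "\<And>z. norm z < e \<Longrightarrow> norm (f z) \<le> C * norm z ^ 2"
  shows "(f has_derivative (\<lambda>_. 0)) (at 0)"
proof (rule has_derivativeI_sandwich[of e _ _ _ _ "\<lambda>z. C * norm z"])
  have f0: "f 0 = 0" using assms(2)[of 0] assms(1) by simp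
  show "norm (f y - f 0 - 0) / norm (y - 0) \<le> C * norm y" if "y \<noteq> 0" "dist y 0 < e" for y
    using assms(2)[of y] that by (simp add: f0 field_simps power2_eq_square)
  have "((\<lambda>z. C * norm z) \<longlongrightarrow> C * norm (0::'a)) (at (0::'a))"
    by (intro tendsto_intros)
  then show "((\<lambda>z. C * norm z) \<longlongrightarrow> 0) (at (0::'a))" by simp
qed (use assms in auto)

context unit_curve
begin

text \<open>Polar coordinates of the norm: \<open>Re w\<close> is the radius, \<open>Im w\<close>
  the parameter. They are injective on a strip of parameters within pi of \<open>t\<close>, so
  invariance of domain makes the image open. The derivative of the inverse is Cramer's rule in the
  basis formed by \<gamma> t and the tangent.\<close>

lemma polar_map_inverse:
  assumes "0 < s"
  obtains S g where "open S" "\<And>w. w \<in> S \<Longrightarrow> 0 < Re w" "open ((\<lambda>w. Re w *\<^sub>R \<gamma> (Im w)) ` S)"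
    "Complex s t \<in> S" "\<And>w. w \<in> S \<Longrightarrow> g (Re w *\<^sub>R \<gamma> (Im w)) = w"
    "(g has_derivative (\<lambda>v. Complex (cross v (cis (\<alpha> t)) / cross (\<gamma> t) (cis (\<alpha> t)))
        (cross (\<gamma> t) v / (s * cross (\<gamma> t) (cis (\<alpha> t)))))) (at (s *\<^sub>R \<gamma> t))"
proof -
  define P where "P w = Re w *\<^sub>R \<gamma> (Im w)" for w
  define S where "S = {w. 0 < Re w \<and> \<bar>Im w - t\<bar> < pi}"
  have S: "open S"
    unfolding S_def by (intro open_Collect_conj open_Collect_less continuous_intros)
  have Pc: "continuous_on A P" for A
    unfolding P_def by (intro continuous_intros continuous_on_compose2[OF gamma_continuous[of UNIV]]) auto
  have inj: "inj_on P S"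
  proof (rule inj_onI)
    fix w w' assume w: "w \<in> S" "w' \<in> S" and eq: "P w = P w'"
    have "Re w = Re w'"
      using arg_cong[OF eq, of N] w by (simp add: P_def N_scale N_gamma S_def)
    moreover then have "\<gamma> (Im w) = \<gamma> (Im w')"
      using eq w by (simp add: P_def S_def)
    then obtain k where k: "Im w' = Im w + 2 * pi * of_int k" using gamma_eq_iff by blast
    have "\<bar>Im w - t\<bar> < pi" "\<bar>Im w' - t\<bar> < pi" using w by (auto simp: S_def)
    then have "\<bar>Im w' - Im w\<bar> < 2 * pi" by linarith
    then have "\<bar>of_int k :: real\<bar> < 1" using k by (simp add: abs_mult)
    then have "k = 0" by linarith
    ultimately show "w = w'" using k by (simp add: complex_eq_iff)
  qed
  define g where "g = inv_into S P"
  have gP: "g (P w) = w" if "w \<in> S" for w unfolding g_def using inj that by (rule inv_into_f_f)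
  have st: "Complex s t \<in> S" using assms by (simp add: S_def)
  let ?D = "cross (\<gamma> t) (cis (\<alpha> t))"
  let ?g = "\<lambda>v. Complex (cross v (cis (\<alpha> t)) / ?D) (cross (\<gamma> t) v / (s * ?D))"
  have D: "?D > 0" by (rule cross_gamma_pos)
  have P': "(P has_derivative (\<lambda>v. Re v *\<^sub>R \<gamma> t + (s * Im v) *\<^sub>R cis (\<alpha> t))) (at (Complex s t))"
    unfolding P_def
    using has_derivative_scaleR[OF bounded_linear_imp_has_derivative[OF bounded_linear_Re] has_derivative_Im_compose[OF gamma_deriv], of "Complex s t"]
    by (simp add: add.commute mult.commute)
  have id: "(\<lambda>v. Re v *\<^sub>R \<gamma> t + (s * Im v) *\<^sub>R cis (\<alpha> t)) \<circ> ?g = id"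
  proof
    fix v
    have "cross v (cis (\<alpha> t)) *\<^sub>R \<gamma> t + cross (\<gamma> t) v *\<^sub>R cis (\<alpha> t) = ?D *\<^sub>R v"
      by (simp add: complex_eq_iff cross_def algebra_simps)
    then have "(1 / ?D) *\<^sub>R (cross v (cis (\<alpha> t)) *\<^sub>R \<gamma> t + cross (\<gamma> t) v *\<^sub>R cis (\<alpha> t)) = v"
      using D by simp
    then show "((\<lambda>v. Re v *\<^sub>R \<gamma> t + (s * Im v) *\<^sub>R cis (\<alpha> t)) \<circ> ?g) v = id v"
      using assms D by (simp add: scaleR_add_right)
  qed
  have g': "(g has_derivative ?g) (at (P (Complex s t)))"
    by (rule has_derivative_inverse_strong[OF S st Pc _ P' id]) (rule gP)
  show thesis
  proof (rule that[of S g])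
    have "open (P ` S)" by (rule invariance_of_domain[OF Pc S inj])
    then show "open ((\<lambda>w. Re w *\<^sub>R \<gamma> (Im w)) ` S)" by (simp add: P_def)
    show "0 < Re w" if "w \<in> S" for w using that by (simp add: S_def)
    show "g (Re w *\<^sub>R \<gamma> (Im w)) = w" if "w \<in> S" for w using gP[OF that] by (simp add: P_def)
    show "(g has_derivative ?g) (at (s *\<^sub>R \<gamma> t))" using g' by (simp add: P_def)
  qed (rule S st)+
qed

text \<open>Along the ray through \<open>\<gamma> t\<close> the extension is \<open>\<Phi> + \<lambda> (z - \<gamma> t)\<close>, so that its
  differential equals \<open>\<lambda> I\<close> up to an error vanishing on the unit sphere; the factor \<open>2s\<^sup>2 - s\<^sup>4\<close> is
  stationary at \<open>s = 1\<close> and removes the singularity at the origin.\<close>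

lemma entropy_extension:
  assumes "ENT \<gamma> \<Phi>"
  obtains \<Psi> :: "complex \<Rightarrow> complex" and D :: "complex \<Rightarrow> complex \<Rightarrow> complex" and l :: "complex \<Rightarrow> real" and C
  where "C \<ge> 0" "\<And>z. (\<Psi> has_derivative D z) (at z)" "\<And>t. \<Psi> (\<gamma> t) = \<Phi> (\<gamma> t)"
    "\<And>z v. N z \<le> 1 \<Longrightarrow> norm (D z v - l z *\<^sub>R v) \<le> C * (1 - N z) * norm v"
    "\<And>z. N z \<le> 1 \<Longrightarrow> \<bar>l z\<bar> \<le> C"
proof -
  obtain lam :: "real \<Rightarrow> real" where lam_per: "\<And>t. lam (t + 2 * pi) = lam t"
    and "lam C1_differentiable_on UNIV"
    and \<Phi>': "\<And>t. ((\<lambda>t. \<Phi> (\<gamma> t)) has_vector_derivative (lam t *\<^sub>R vector_derivative \<gamma> (at t))) (at t)"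
    using assms unfolding ENT_def by blast
  then obtain lam' where lam': "\<And>t. (lam has_vector_derivative lam' t) (at t)" and lam'c: "continuous_on UNIV lam'"
    unfolding C1_differentiable_on_def by auto
  have \<Phi>_deriv: "((\<lambda>t. \<Phi> (\<gamma> t)) has_vector_derivative (lam t *\<^sub>R cis (\<alpha> t))) (at t)" for t
    using \<Phi>'[of t] vector_derivative_at[OF gamma_deriv[of t]] by simp
  have lam_per_int: "lam (t + 2 * pi * of_int k) = lam t" for t k
  proof (induction k rule: int_induct[where k = 0])
    case (step1 i)
    then show ?case using lam_per[of "t + 2 * pi * of_int i"] by (simp add: algebra_simps)
  next
    case (step2 i)
    then show ?case using lam_per[of "t + 2 * pi * of_int (i - 1)"] by (simp add: algebra_simps)
  qed simp
  have cont: "continuous_on UNIV lam" "continuous_on UNIV (\<lambda>t. \<Phi> (\<gamma> t))"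
    by (rule continuous_at_imp_continuous_on, rule ballI,
        rule has_vector_derivative_continuous, rule lam' \<Phi>_deriv)+
  have bdd: "\<exists>B. \<forall>t\<in>{0..2 * pi}. norm (f t) \<le> B" if "continuous_on UNIV f" for f :: "real \<Rightarrow> 'b::real_normed_vector"
    using compact_imp_bounded[OF compact_continuous_image[OF continuous_on_subset[OF that subset_UNIV] compact_Icc[of 0 "2 * pi"]]]
    unfolding bounded_iff by auto
  obtain B1 where B1: "\<forall>t\<in>{0..2 * pi}. norm (lam t) \<le> B1" using bdd[OF cont(1)] by blast
  obtain B2 where B2: "\<forall>t\<in>{0..2 * pi}. norm (lam' t) \<le> B2" using bdd[OF lam'c] by blast
  obtain B3 where B3: "\<forall>t\<in>{0..2 * pi}. norm (\<Phi> (\<gamma> t)) \<le> B3" using bdd[OF cont(2)] by blast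
  obtain B4 where B4: "\<forall>t\<in>{0..2 * pi}. norm (\<gamma> t) \<le> B4" using bdd[OF gamma_continuous[of UNIV]] by blast
  define B where "B = \<bar>B1\<bar> + \<bar>B2\<bar> + \<bar>B3\<bar> + \<bar>B4\<bar>"
  have B: "0 \<le> B" and bounds: "\<bar>lam t\<bar> \<le> B" "\<bar>lam' t\<bar> \<le> B" "norm (\<Phi> (\<gamma> t)) \<le> B" "norm (\<gamma> t) \<le> B"
    if "t \<in> {0..2 * pi}" for t
    using bspec[OF B1 that] bspec[OF B2 that] bspec[OF B3 that] bspec[OF B4 that] by (auto simp: B_def)
  have B0: "0 \<le> B" by (simp add: B_def)
  obtain D0 where D0: "D0 > 0" "\<And>t. D0 \<le> cross (\<gamma> t) (cis (\<alpha> t))"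
    using cross_gamma_lower_bound by metis
  define \<psi> :: "real \<Rightarrow> real" where "\<psi> s = 2 * s ^ 2 - s ^ 4" for s
  \<comment> \<open>The radial derivative of \<open>V\<close> is \<lambda> times \<gamma> t. By the
    entropy relation the tangential one is s \<lambda> times the tangent, plus a term with the
    derivative of \<lambda> and the factor s - 1. The first two together are \<lambda> times the
    identity in polar coordinates.\<close>
  define V where "V s t = (lam t * (s - 1)) *\<^sub>R \<gamma> t + \<Phi> (\<gamma> t)" for s t
  define \<Xi> where "\<Xi> w = \<psi> (Re w) *\<^sub>R V (Re w) (Im w)" for w
  \<comment> \<open>Any choice of angle is good enough: \<open>V\<close> has period 2 pi in
    \<open>t\<close>, so \<Psi> does not depend on it, as \<open>\<Psi>_polar\<close>
    records.\<close>
  define \<tau> where "\<tau> z = (SOME t. t \<in> {0..<2 * pi} \<and> \<gamma> t = (1 / N z) *\<^sub>R z)" for z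
  have \<tau>: "\<tau> z \<in> {0..<2 * pi}" "\<gamma> (\<tau> z) = (1 / N z) *\<^sub>R z" if "z \<noteq> 0" for z
  proof -
    have "N ((1 / N z) *\<^sub>R z) = 1" using N_pos[OF that] by (simp add: N_scale)
    then have "(1 / N z) *\<^sub>R z \<in> range \<gamma>" unfolding gamma_range by simp
    then obtain t where t: "(1 / N z) *\<^sub>R z = \<gamma> t" by (rule rangeE)
    obtain k where k: "t + 2 * pi * of_int k \<in> {0..<2 * pi}" by (rule reduce_mod_2pi)
    have "\<exists>t. t \<in> {0..<2 * pi} \<and> \<gamma> t = (1 / N z) *\<^sub>R z"
      using k unfolding t by (intro exI[of _ "t + 2 * pi * of_int k"] conjI gamma_periodic_int)
    from someI_ex[OF this] show "\<tau> z \<in> {0..<2 * pi}" "\<gamma> (\<tau> z) = (1 / N z) *\<^sub>R z" unfolding \<tau>_def by auto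
  qed
  have z_eq: "z = N z *\<^sub>R \<gamma> (\<tau> z)" if "z \<noteq> 0" for z
    using \<tau>(2)[OF that] N_pos[OF that] by simp
  define \<Psi> where "\<Psi> z = (if z = 0 then 0 else \<Xi> (Complex (N z) (\<tau> z)))" for z
  have \<Psi>_polar: "\<Psi> (Re w *\<^sub>R \<gamma> (Im w)) = \<Xi> w" if "0 < Re w" for w
  proof -
    let ?z = "Re w *\<^sub>R \<gamma> (Im w)"
    have z: "?z \<noteq> 0" "N ?z = Re w" using that gamma_nonzero by (auto simp: N_scale N_gamma)
    have "\<gamma> (\<tau> ?z) = \<gamma> (Im w)" using \<tau>(2)[OF z(1)] z that by simp
    then obtain k where "\<tau> ?z = Im w + 2 * pi * of_int k" using gamma_eq_iff by metis
    then show ?thesis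
      using z by (simp add: \<Psi>_def \<Xi>_def V_def gamma_periodic_int lam_per_int)
  qed
  define l where "l z = (if z = 0 then 0 else \<psi> (N z) * lam (\<tau> z))" for z
  define a where "a z v = cross v (cis (\<alpha> (\<tau> z))) / cross (\<gamma> (\<tau> z)) (cis (\<alpha> (\<tau> z)))" for z v
  define b where "b z v = cross (\<gamma> (\<tau> z)) v / (N z * cross (\<gamma> (\<tau> z)) (cis (\<alpha> (\<tau> z))))" for z v
  \<comment> \<open>The first term comes from differentiating \<psi>, the second from
    differentiating \<open>lam\<close>. Each carries a factor that vanishes for N z = 1.\<close>
  define E where "E z v = (if z = 0 then 0 else
      (a z v * (4 * N z - 4 * N z ^ 3)) *\<^sub>R V (N z) (\<tau> z)
      + (b z v * \<psi> (N z) * lam' (\<tau> z) * (N z - 1)) *\<^sub>R \<gamma> (\<tau> z))" for z v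
  have deriv: "(\<Psi> has_derivative (\<lambda>v. l z *\<^sub>R v + E z v)) (at z)" for z
  proof (cases "z = 0")
    case True
    \<comment> \<open>Polar coordinates fail at the origin, but the double zero of \<psi> makes
      \<Psi> quadratically small. The radius is chosen so that \<open>N y \<le> 1\<close>, where
      \<psi> and \<open>V\<close> are bounded.\<close>
    have "norm (\<Psi> y) \<le> (2 * (B * B + B) * (N 1 + N \<i>) ^ 2) * norm y ^ 2" if y: "norm y < 1 / (N 1 + N \<i> + 1)" for y
    proof (cases "y = 0")
      case False
      let ?t = "\<tau> y" and ?s = "N y"
      have t: "?t \<in> {0..2 * pi}" using \<tau>[OF False] by auto
      have K: "0 \<le> N 1 + N \<i>" using N_nonneg[of 1] N_nonneg[of \<i>] by simp
      have s: "0 < ?s" "?s \<le> (N 1 + N \<i>) * norm y" using N_pos[OF False] N_le_norm by auto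
      have "(N 1 + N \<i>) * norm y \<le> (N 1 + N \<i> + 1) * norm y" by (intro mult_right_mono) auto
      also have "\<dots> < 1" using y K by (simp add: field_simps)
      finally have s1: "?s \<le> 1" using s by simp
      have "norm (V ?s ?t) \<le> \<bar>lam ?t * (?s - 1)\<bar> * norm (\<gamma> ?t) + norm (\<Phi> (\<gamma> ?t))"
        unfolding V_def by (rule order_trans[OF norm_triangle_ineq]) simp
      also have "\<dots> \<le> (B * 1) * B + B"
        unfolding abs_mult using bounds[OF t] s s1 B0 by (intro add_mono mult_mono) auto
      finally have V: "norm (V ?s ?t) \<le> B * B + B" by simp
      have \<psi>: "0 \<le> \<psi> ?s" "\<psi> ?s \<le> 2 * ?s ^ 2"
      proof -
        have "?s ^ 4 \<le> ?s ^ 2" using s s1 by (intro power_decreasing) auto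
        then show "0 \<le> \<psi> ?s" using zero_le_power2[of ?s] unfolding \<psi>_def by linarith
        show "\<psi> ?s \<le> 2 * ?s ^ 2" using s by (simp add: \<psi>_def)
      qed
      have "norm (\<Psi> y) = \<psi> ?s * norm (V ?s ?t)" using False \<psi> by (simp add: \<Psi>_def \<Xi>_def)
      also have "\<dots> \<le> (2 * ?s ^ 2) * (B * B + B)"
        using V \<psi> by (intro mult_mono) auto
      also have "\<dots> \<le> (2 * ((N 1 + N \<i>) * norm y) ^ 2) * (B * B + B)"
        using s B0 by (intro mult_right_mono mult_left_mono power_mono) auto
      also have "\<dots> = (2 * (B * B + B) * (N 1 + N \<i>) ^ 2) * norm y ^ 2"
        by (simp only: power_mult_distrib mult_ac)
      finally show ?thesis .
    qed (simp add: \<Psi>_def)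
    moreover have "0 < 1 / (N 1 + N \<i> + 1)" using N_nonneg[of 1] N_nonneg[of \<i>] by simp
    ultimately have "(\<Psi> has_derivative (\<lambda>_. 0)) (at 0)" by (rule has_derivative_zero_quadratic[rotated])
    then show ?thesis using True by (simp add: l_def E_def)
  next
    case False
    define s t where "s = N z" and "t = \<tau> z"
    have s: "0 < s" using N_pos[OF False] by (simp add: s_def)
    have z: "z = s *\<^sub>R \<gamma> t" using z_eq[OF False] by (simp add: s_def t_def)
    obtain S g where S: "open S" "\<And>w. w \<in> S \<Longrightarrow> 0 < Re w" "open ((\<lambda>w. Re w *\<^sub>R \<gamma> (Im w)) ` S)"
      "Complex s t \<in> S" "\<And>w. w \<in> S \<Longrightarrow> g (Re w *\<^sub>R \<gamma> (Im w)) = w"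
      "(g has_derivative (\<lambda>v. Complex (cross v (cis (\<alpha> t)) / cross (\<gamma> t) (cis (\<alpha> t)))
        (cross (\<gamma> t) v / (s * cross (\<gamma> t) (cis (\<alpha> t)))))) (at (s *\<^sub>R \<gamma> t))"
      by (rule polar_map_inverse[OF s, of t]) (rule that)
    have g': "(g has_derivative (\<lambda>v. Complex (a z v) (b z v))) (at z)"
      using S(6) unfolding a_def b_def s_def[symmetric] t_def[symmetric] z[symmetric] .
    have gz: "g z = Complex s t" using S(5)[OF S(4)] z by simp
    have \<psi>': "((\<lambda>w. \<psi> (Re w)) has_derivative (\<lambda>v. Re v * (4 * s - 4 * s ^ 3))) (at (Complex s t))"
      unfolding \<psi>_def by (auto intro!: derivative_eq_intros simp: fun_eq_iff algebra_simps)
    have V': "((\<lambda>w. V (Re w) (Im w)) has_derivative (\<lambda>v. Re v *\<^sub>R (lam t *\<^sub>R \<gamma> t)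
        + Im v *\<^sub>R ((lam' t * (s - 1)) *\<^sub>R \<gamma> t + (s * lam t) *\<^sub>R cis (\<alpha> t)))) (at (Complex s t))"
    proof -
      note dl = has_derivative_Im_compose[OF lam', of "Complex s t", unfolded complex.sel]
      note dg = has_derivative_Im_compose[OF gamma_deriv, of "Complex s t", unfolded complex.sel]
      note dP = has_derivative_Im_compose[OF \<Phi>_deriv, of "Complex s t", unfolded complex.sel]
      have dR: "((\<lambda>w. Re w - 1) has_derivative Re) (at (Complex s t))"
        by (auto intro!: derivative_eq_intros)
      show ?thesis
        unfolding V_def
        by (rule has_derivative_eq_rhs[OF has_derivative_add[OF has_derivative_scaleR[OF has_derivative_mult[OF dl dR] dg] dP]])
           (simp add: fun_eq_iff algebra_simps)
    qed
    have "(\<Xi> has_derivative (\<lambda>v. \<psi> s *\<^sub>R (Re v *\<^sub>R (lam t *\<^sub>R \<gamma> t)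
        + Im v *\<^sub>R ((lam' t * (s - 1)) *\<^sub>R \<gamma> t + (s * lam t) *\<^sub>R cis (\<alpha> t)))
        + (Re v * (4 * s - 4 * s ^ 3)) *\<^sub>R V s t)) (at (g z))"
      unfolding \<Xi>_def gz by (rule has_derivative_eq_rhs[OF has_derivative_scaleR[OF \<psi>' V']]) simp
    from has_derivative_compose[OF g' this]
    have "((\<lambda>z. \<Xi> (g z)) has_derivative (\<lambda>v. \<psi> s *\<^sub>R (a z v *\<^sub>R (lam t *\<^sub>R \<gamma> t)
        + b z v *\<^sub>R ((lam' t * (s - 1)) *\<^sub>R \<gamma> t + (s * lam t) *\<^sub>R cis (\<alpha> t)))
        + (a z v * (4 * s - 4 * s ^ 3)) *\<^sub>R V s t)) (at z)" by simp
    moreover have "\<psi> s *\<^sub>R (a z v *\<^sub>R (lam t *\<^sub>R \<gamma> t)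
        + b z v *\<^sub>R ((lam' t * (s - 1)) *\<^sub>R \<gamma> t + (s * lam t) *\<^sub>R cis (\<alpha> t)))
        + (a z v * (4 * s - 4 * s ^ 3)) *\<^sub>R V s t = l z *\<^sub>R v + E z v" for v
    proof -
      let ?D = "cross (\<gamma> t) (cis (\<alpha> t))"
      have "cross v (cis (\<alpha> t)) *\<^sub>R \<gamma> t + cross (\<gamma> t) v *\<^sub>R cis (\<alpha> t) = ?D *\<^sub>R v"
        by (simp add: complex_eq_iff cross_def algebra_simps)
      then have "(1 / ?D) *\<^sub>R (cross v (cis (\<alpha> t)) *\<^sub>R \<gamma> t + cross (\<gamma> t) v *\<^sub>R cis (\<alpha> t)) = v"
        using cross_gamma_pos[of t] by simp
      then have v: "a z v *\<^sub>R \<gamma> t + (s * b z v) *\<^sub>R cis (\<alpha> t) = v"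
        using s by (simp add: a_def b_def s_def[symmetric] t_def[symmetric] scaleR_add_right)
      have "l z *\<^sub>R v = (\<psi> s * lam t) *\<^sub>R (a z v *\<^sub>R \<gamma> t + (s * b z v) *\<^sub>R cis (\<alpha> t))"
        using False unfolding v by (simp add: l_def s_def t_def)
      moreover have "E z v = (a z v * (4 * s - 4 * s ^ 3)) *\<^sub>R V s t + (b z v * \<psi> s * lam' t * (s - 1)) *\<^sub>R \<gamma> t"
        using False by (simp add: E_def s_def t_def)
      ultimately show ?thesis by (simp add: scaleR_add_right scaleR_add_left algebra_simps)
    qed
    ultimately have "((\<lambda>z. \<Xi> (g z)) has_derivative (\<lambda>v. l z *\<^sub>R v + E z v)) (at z)" by simp
    then show ?thesis
    proof (rule has_derivative_transform_within_open[OF _ S(3)])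
      show "z \<in> (\<lambda>w. Re w *\<^sub>R \<gamma> (Im w)) ` S" using S(4) z by (auto intro!: image_eqI[where x = "Complex s t"])
      show "\<Xi> (g y) = \<Psi> y" if "y \<in> (\<lambda>w. Re w *\<^sub>R \<gamma> (Im w)) ` S" for y
        using that S(2,5) \<Psi>_polar by auto
    qed
  qed
  define C where "C = 8 / D0 * (B * B + B) + 2 * B / D0 * B * B + 2 * B"
  have C0: "0 \<le> C" using B0 D0 by (simp add: C_def)
  have \<psi>b: "0 \<le> \<psi> s" "\<psi> s \<le> 2 * s" "\<psi> s \<le> 2" if "0 \<le> s" "s \<le> 1" for s
  proof -
    have "s ^ 4 \<le> s ^ 2" "s ^ 2 \<le> s" "0 \<le> s ^ 2" "0 \<le> s ^ 4"
      using power_decreasing[of 2 4 s] power_decreasing[of 1 2 s] that by auto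
    then show "0 \<le> \<psi> s" "\<psi> s \<le> 2 * s" "\<psi> s \<le> 2" using that unfolding \<psi>_def by linarith+
  qed
  show thesis
  proof (rule that[of C \<Psi> "\<lambda>z v. l z *\<^sub>R v + E z v" l])
    show "0 \<le> C" by (rule C0)
    show "(\<Psi> has_derivative (\<lambda>v. l z *\<^sub>R v + E z v)) (at z)" for z by (rule deriv)
    show "\<Psi> (\<gamma> t) = \<Phi> (\<gamma> t)" for t
      using \<Psi>_polar[of "Complex 1 t"] by (simp add: \<Xi>_def V_def \<psi>_def)
    show "\<bar>l z\<bar> \<le> C" if z: "N z \<le> 1" for z
    proof (cases "z = 0")
      case False
      have t: "\<tau> z \<in> {0..2 * pi}" using \<tau>[OF False] by auto
      have "\<bar>l z\<bar> = \<psi> (N z) * \<bar>lam (\<tau> z)\<bar>"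
        using False \<psi>b(1)[OF N_nonneg z] by (simp add: l_def abs_mult)
      also have "\<dots> \<le> 2 * B"
        using bounds[OF t] \<psi>b[OF N_nonneg z] by (intro mult_mono) auto
      also have "\<dots> \<le> C" using B0 D0 by (simp add: C_def)
      finally show ?thesis .
    qed (use C0 in \<open>simp add: l_def\<close>)
    show "norm (l z *\<^sub>R v + E z v - l z *\<^sub>R v) \<le> C * (1 - N z) * norm v" if z: "N z \<le> 1" for z v
    proof (cases "z = 0")
      case True
      then show ?thesis using C0 z by (simp add: E_def)
    next
      case False
      define s t where "s = N z" and "t = \<tau> z"
      have s: "0 < s" "s \<le> 1" using N_pos[OF False] z by (auto simp: s_def)
      have t: "t \<in> {0..2 * pi}" using \<tau>[OF False] by (auto simp: t_def)
      note bt = bounds[OF t]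
      let ?D = "cross (\<gamma> t) (cis (\<alpha> t))"
      have a: "\<bar>a z v\<bar> \<le> norm v / D0"
      proof -
        have "\<bar>cross v (cis (\<alpha> t))\<bar> \<le> norm v" using cross_abs_le[of v "cis (\<alpha> t)"] by simp
        then have "\<bar>cross v (cis (\<alpha> t))\<bar> / ?D \<le> norm v / D0"
          using D0 D0(2)[of t] by (intro frac_le) auto
        then show ?thesis using cross_gamma_pos[of t] by (simp add: a_def t_def[symmetric])
      qed
      have b: "\<bar>b z v\<bar> * \<psi> s \<le> 2 * B / D0 * norm v"
      proof -
        have "\<bar>cross (\<gamma> t) v\<bar> \<le> B * norm v"
          using cross_abs_le[of "\<gamma> t" v] mult_right_mono[OF bt(4), of "norm v"] by simp
        then have "\<bar>cross (\<gamma> t) v\<bar> / ?D \<le> B * norm v / D0"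
          using D0 D0(2)[of t] B0 by (intro frac_le) auto
        then have "\<bar>cross (\<gamma> t) v\<bar> / ?D * (\<psi> s / s) \<le> B * norm v / D0 * 2"
          using \<psi>b[of s] s B0 D0 cross_gamma_pos[of t] by (intro mult_mono) (auto simp: field_simps)
        then show ?thesis
          using cross_gamma_pos[of t] s by (simp add: b_def s_def[symmetric] t_def[symmetric] abs_mult field_simps)
      qed
      have V: "norm (V s t) \<le> B * B + B"
      proof -
        have "norm (V s t) \<le> \<bar>lam t * (s - 1)\<bar> * norm (\<gamma> t) + norm (\<Phi> (\<gamma> t))"
          unfolding V_def by (rule order_trans[OF norm_triangle_ineq]) simp
        also have "\<dots> \<le> (B * 1) * B + B"
          unfolding abs_mult using bt s B0 by (intro add_mono mult_mono) auto
        finally show ?thesis by simp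
      qed
      have c: "\<bar>4 * s - 4 * s ^ 3\<bar> \<le> 8 * (1 - s)"
      proof -
        have "4 * s - 4 * s ^ 3 = 4 * s * (1 + s) * (1 - s)" by (simp add: algebra_simps power3_eq_cube)
        moreover have "4 * s * (1 + s) \<le> 4 * 1 * 2" using s by (intro mult_mono) auto
        ultimately show ?thesis using s mult_right_mono[of "4 * s * (1 + s)" 8 "1 - s"] by (simp add: abs_mult)
      qed
      have "norm (E z v) \<le> \<bar>a z v\<bar> * \<bar>4 * s - 4 * s ^ 3\<bar> * norm (V s t) + (\<bar>b z v\<bar> * \<psi> s) * \<bar>lam' t\<bar> * (1 - s) * norm (\<gamma> t)"
        using False s \<psi>b(1)[of s]
        unfolding E_def s_def[symmetric] t_def[symmetric]
        by (auto intro!: order_trans[OF norm_triangle_ineq] simp: abs_mult)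
      also have "\<dots> \<le> norm v / D0 * (8 * (1 - s)) * (B * B + B) + (2 * B / D0 * norm v) * B * (1 - s) * B"
      proof (rule add_mono)
        have nd: "0 \<le> norm v / D0" "0 \<le> 2 * B / D0 * norm v" using D0 B0 by auto
        have "\<bar>a z v\<bar> * \<bar>4 * s - 4 * s ^ 3\<bar> \<le> norm v / D0 * (8 * (1 - s))"
          by (rule mult_mono[OF a c nd(1) abs_ge_zero])
        then show "\<bar>a z v\<bar> * \<bar>4 * s - 4 * s ^ 3\<bar> * norm (V s t) \<le> norm v / D0 * (8 * (1 - s)) * (B * B + B)"
          by (rule mult_mono[OF _ V]) (use nd s D0 in simp_all)
        have "\<bar>b z v\<bar> * \<psi> s * \<bar>lam' t\<bar> \<le> 2 * B / D0 * norm v * B"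
          by (rule mult_mono[OF b bt(2) nd(2) abs_ge_zero])
        then have "\<bar>b z v\<bar> * \<psi> s * \<bar>lam' t\<bar> * (1 - s) \<le> 2 * B / D0 * norm v * B * (1 - s)"
          by (rule mult_right_mono) (use s in simp)
        then show "\<bar>b z v\<bar> * \<psi> s * \<bar>lam' t\<bar> * (1 - s) * norm (\<gamma> t) \<le> 2 * B / D0 * norm v * B * (1 - s) * B"
          by (rule mult_mono[OF _ bt(4)]) (use nd B0 s D0 in simp_all)
      qed
      also have "\<dots> = (8 / D0 * (B * B + B) + 2 * B / D0 * B * B) * (1 - s) * norm v"
        unfolding divide_inverse by (simp add: algebra_simps)
      also have "\<dots> \<le> C * (1 - s) * norm v"
        using s B0 by (intro mult_right_mono) (auto simp: C_def)
      finally show ?thesis by (simp add: s_def)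
    qed
  qed
qed

end

section \<open>Smooth functions with compact support\<close>

lemma smooth_R2_D:
  assumes "smooth_R2 f"
  shows "(f has_derivative frechet_derivative f (at x)) (at x)" "continuous_on UNIV f"
    "smooth_R2 (\<lambda>x. frechet_derivative f (at x) v)"
  using assms by (auto elim: smooth_R2.cases simp: frechet_derivative_works[symmetric])

lemma frechet_derivative_Re_Im:
  fixes f :: "complex \<Rightarrow> real"
  assumes "f differentiable (at x)"
  shows "frechet_derivative f (at x) v
    = Re v * frechet_derivative f (at x) 1 + Im v * frechet_derivative f (at x) \<i>"
proof -
  have lin: "linear (frechet_derivative f (at x))" using assms by (rule linear_frechet_derivative)
  have "v = Re v *\<^sub>R 1 + Im v *\<^sub>R \<i>" by (simp add: complex_eq_iff)
  then have "frechet_derivative f (at x) v = frechet_derivative f (at x) (Re v *\<^sub>R 1 + Im v *\<^sub>R \<i>)" by metis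
  then show ?thesis using lin by (simp add: linear_add linear_scale)
qed

lemma frechet_derivative_eq_0_outside_support:
  assumes "x \<notin> closure {x. f x \<noteq> 0}"
  shows "frechet_derivative f (at x) = (\<lambda>_. 0)"
proof -
  have "((\<lambda>_. 0) has_derivative (\<lambda>_. 0)) (at x)" by simp
  then have "(f has_derivative (\<lambda>_. 0)) (at x)"
  proof (rule has_derivative_transform_within_open)
    show "open (- closure {x. f x \<noteq> 0})" by (rule open_Compl[OF closed_closure])
    show "0 = f y" if "y \<in> - closure {x. f x \<noteq> 0}" for y
      using that closure_subset[of "{x. f x \<noteq> 0}"] by auto
  qed (use assms in simp)
  then show ?thesis by (metis frechet_derivative_at)
qed

lemma continuous_compact_support_bounded:
  fixes f :: "'a::topological_space \<Rightarrow> 'b::real_normed_vector"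
  assumes "continuous_on UNIV f" "compact K" "\<And>x. x \<notin> K \<Longrightarrow> f x = 0"
  obtains B where "B \<ge> 0" "\<And>x. norm (f x) \<le> B"
proof -
  have "bounded (f ` K)"
    by (intro compact_imp_bounded compact_continuous_image assms continuous_on_subset[OF assms(1)]) auto
  then obtain B where B: "B > 0" "\<forall>x\<in>K. norm (f x) \<le> B" unfolding bounded_pos by blast
  show thesis
  proof (rule that[of B])
    show "norm (f x) \<le> B" for x
      using B assms(3)[of x] by (cases "x \<in> K") auto
  qed (use B in simp)
qed

text \<open>The last bound is a Taylor estimate. Second derivatives are bounded by compactness, so
  the first partials are Lipschitz, and the mean value inequality is applied to \<open>f\<close>
  minus its linearization at \<open>x\<close>. It makes differentiation under a convolution integral
  quantitative.\<close>

lemma smooth_compact_support_C2_bounds: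
  assumes f: "smooth_R2 f" and K: "compact K" "\<And>x. x \<notin> K \<Longrightarrow> f x = 0"
  obtains B where "B \<ge> 0" "\<And>x. \<bar>f x\<bar> \<le> B"
    "\<And>x v. \<bar>frechet_derivative f (at x) v\<bar> \<le> B * norm v"
    "\<And>x h. \<bar>f (x + h) - f x - frechet_derivative f (at x) h\<bar> \<le> B * norm h ^ 2"
proof -
  have cl: "closure {x. g x \<noteq> 0} \<subseteq> K" if "\<And>x. x \<notin> K \<Longrightarrow> g x = 0" for g :: "complex \<Rightarrow> real"
    using that K(1) by (intro closure_minimal compact_imp_closed) auto
  have first: "\<exists>B\<ge>0. (\<forall>x. \<bar>g x\<bar> \<le> B) \<and> (\<forall>x v. \<bar>frechet_derivative g (at x) v\<bar> \<le> B * norm v)"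
    if g: "smooth_R2 g" "\<And>x. x \<notin> K \<Longrightarrow> g x = 0" for g
  proof -
    have z: "frechet_derivative g (at x) v = 0" if "x \<notin> K" for x v
    proof -
      have "x \<notin> closure {x. g x \<noteq> 0}" using cl[of g, OF g(2)] that by blast
      from fun_cong[OF frechet_derivative_eq_0_outside_support[OF this]] show ?thesis .
    qed
    obtain B0 where B0: "B0 \<ge> 0" "\<And>x. norm (g x) \<le> B0"
      using continuous_compact_support_bounded[OF smooth_R2_D(2)[OF g(1)] K(1) g(2)] by blast
    obtain B1 where B1: "B1 \<ge> 0" "\<And>x. norm (frechet_derivative g (at x) 1) \<le> B1"
      using continuous_compact_support_bounded[OF smooth_R2_D(2)[OF smooth_R2_D(3)[OF g(1)]] K(1) z] by blast
    obtain B2 where B2: "B2 \<ge> 0" "\<And>x. norm (frechet_derivative g (at x) \<i>) \<le> B2"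
      using continuous_compact_support_bounded[OF smooth_R2_D(2)[OF smooth_R2_D(3)[OF g(1)]] K(1) z] by blast
    have "\<bar>frechet_derivative g (at x) v\<bar> \<le> (B0 + B1 + B2) * norm v" for x v
    proof -
      have "g differentiable (at x)" using smooth_R2_D(1)[OF g(1)] by (auto simp: differentiable_def)
      then have "\<bar>frechet_derivative g (at x) v\<bar>
          \<le> \<bar>Re v\<bar> * \<bar>frechet_derivative g (at x) 1\<bar> + \<bar>Im v\<bar> * \<bar>frechet_derivative g (at x) \<i>\<bar>"
        by (subst frechet_derivative_Re_Im) (auto simp flip: abs_mult)
      also have "\<dots> \<le> norm v * B1 + norm v * B2"
        using B1 B2 by (intro add_mono mult_mono abs_Re_le_cmod abs_Im_le_cmod) auto
      also have "\<dots> \<le> (B0 + B1 + B2) * norm v" using B0(1) by (simp add: algebra_simps)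
      finally show ?thesis .
    qed
    moreover have "\<bar>g x\<bar> \<le> B0 + B1 + B2" for x using B0(2)[of x] B1(1) B2(1) by simp
    ultimately show ?thesis using B0(1) B1(1) B2(1) by (intro exI[of _ "B0 + B1 + B2"]) auto
  qed
  obtain B where B: "B \<ge> 0" "\<And>x. \<bar>f x\<bar> \<le> B" "\<And>x v. \<bar>frechet_derivative f (at x) v\<bar> \<le> B * norm v"
    using first[OF f K(2)] by blast
  let ?d = "\<lambda>v x. frechet_derivative f (at x) v"
  have z: "?d v x = 0" if "x \<notin> K" for x v
  proof -
    have "x \<notin> closure {x. f x \<noteq> 0}" using cl[of f, OF K(2)] that by blast
    from fun_cong[OF frechet_derivative_eq_0_outside_support[OF this]] show ?thesis .
  qed
  have lip: "\<exists>C\<ge>0. \<forall>x y. \<bar>?d v x - ?d v y\<bar> \<le> C * norm (x - y)" for v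
  proof -
    obtain C where C: "C \<ge> 0" "\<And>x w. \<bar>frechet_derivative (?d v) (at x) w\<bar> \<le> C * norm w"
      using first[OF smooth_R2_D(3)[OF f] z] by blast
    have "norm (?d v x - ?d v y) \<le> C * norm (x - y)" for x y
    proof (rule differentiable_bound[OF convex_UNIV])
      show "((?d v) has_derivative frechet_derivative (?d v) (at u)) (at u within UNIV)" for u
        using smooth_R2_D(1)[OF smooth_R2_D(3)[OF f]] by simp
      show "onorm (frechet_derivative (?d v) (at u)) \<le> C" for u
        using C(2)[of u] by (intro onorm_le) (simp add: real_norm_def)
    qed auto
    then show ?thesis using C(1) by auto
  qed
  obtain C1 where C1: "C1 \<ge> 0" "\<And>x y. \<bar>?d 1 x - ?d 1 y\<bar> \<le> C1 * norm (x - y)" using lip by blast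
  obtain C2 where C2: "C2 \<ge> 0" "\<And>x y. \<bar>?d \<i> x - ?d \<i> y\<bar> \<le> C2 * norm (x - y)" using lip by blast
  have diff: "f differentiable (at x)" for x using smooth_R2_D(1)[OF f] by (auto simp: differentiable_def)
  have taylor: "\<bar>f (x + h) - f x - frechet_derivative f (at x) h\<bar> \<le> (C1 + C2) * norm h ^ 2" for x h
  proof -
    define G where "G y = f y - frechet_derivative f (at x) y" for y
    have lin: "bounded_linear (frechet_derivative f (at x))"
      using smooth_R2_D(1)[OF f] has_derivative_bounded_linear by blast
    have "norm (G (x + h) - G x) \<le> ((C1 + C2) * norm h) * norm ((x + h) - x)"
    proof (rule differentiable_bound[of "cball x (norm h)" G "\<lambda>u v. ?d v u - ?d v x"])
      show "(G has_derivative (\<lambda>v. ?d v u - ?d v x)) (at u within cball x (norm h))" for u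
        unfolding G_def
        by (intro has_derivative_diff has_derivative_at_withinI[OF smooth_R2_D(1)[OF f]] bounded_linear_imp_has_derivative lin)
      show "onorm (\<lambda>v. ?d v u - ?d v x) \<le> (C1 + C2) * norm h" if u: "u \<in> cball x (norm h)" for u
      proof (rule onorm_le)
        fix v
        have nu: "norm (u - x) \<le> norm h" using u by (simp add: dist_norm norm_minus_commute)
        have "norm (?d v u - ?d v x) = \<bar>Re v * (?d 1 u - ?d 1 x) + Im v * (?d \<i> u - ?d \<i> x)\<bar>"
          using frechet_derivative_Re_Im[OF diff, of u v] frechet_derivative_Re_Im[OF diff, of x v]
          by (simp add: algebra_simps)
        also have "\<dots> \<le> \<bar>Re v\<bar> * \<bar>?d 1 u - ?d 1 x\<bar> + \<bar>Im v\<bar> * \<bar>?d \<i> u - ?d \<i> x\<bar>"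
          by (simp flip: abs_mult)
        also have "\<dots> \<le> norm v * (C1 * norm h) + norm v * (C2 * norm h)"
          using order_trans[OF C1(2)[of u x] mult_left_mono[OF nu C1(1)]]
            order_trans[OF C2(2)[of u x] mult_left_mono[OF nu C2(1)]]
          by (intro add_mono mult_mono abs_Re_le_cmod abs_Im_le_cmod) auto
        finally show "norm (?d v u - ?d v x) \<le> (C1 + C2) * norm h * norm v" by (simp add: algebra_simps)
      qed
    qed (auto simp: dist_norm)
    moreover have "G (x + h) - G x = f (x + h) - f x - frechet_derivative f (at x) h"
      using linear_add[OF bounded_linear.linear[OF lin]] by (simp add: G_def)
    ultimately show ?thesis by (simp add: power2_eq_square mult.assoc)
  qed
  show thesis
  proof (rule that[of "B + C1 + C2"])
    show "0 \<le> B + C1 + C2" using B C1 C2 by simp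
    show "\<bar>f x\<bar> \<le> B + C1 + C2" for x using B(2)[of x] C1(1) C2(1) by simp
    show "\<bar>frechet_derivative f (at x) v\<bar> \<le> (B + C1 + C2) * norm v" for x v
      by (rule order_trans[OF B(3)]) (use C1(1) C2(1) in \<open>auto intro!: mult_right_mono\<close>)
    show "\<bar>f (x + h) - f x - frechet_derivative f (at x) h\<bar> \<le> (B + C1 + C2) * norm h ^ 2" for x h
      by (rule order_trans[OF taylor]) (use B(1) in \<open>auto intro!: mult_right_mono\<close>)
  qed
qed

section \<open>Difference quotients and integration by parts\<close>

lemma difference_quotient_LIMSEQ:
  fixes u :: "complex \<Rightarrow> real"
  assumes u': "(u has_derivative D) (at x)" and s: "s \<longlonglongrightarrow> 0" "\<And>n. s n \<noteq> 0"
  shows "(\<lambda>n. (u (x + s n *\<^sub>R e) - u x) / s n) \<longlonglongrightarrow> D e"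
proof -
  have "((\<lambda>t. u (x + t *\<^sub>R e)) has_derivative (\<lambda>t. D (t *\<^sub>R e))) (at 0)"
    by (rule has_derivative_compose[of "\<lambda>t. x + t *\<^sub>R e" "\<lambda>t. t *\<^sub>R e" 0 UNIV u])
       (use u' in \<open>auto intro!: derivative_eq_intros\<close>)
  moreover have "D (t *\<^sub>R e) = t * D e" for t
    using linear_scale[OF has_derivative_linear[OF u']] by simp
  ultimately have "((\<lambda>t. u (x + t *\<^sub>R e)) has_real_derivative D e) (at 0)"
    by (simp add: has_field_derivative_def mult.commute[of _ "D e"])
  then have "((\<lambda>t. (u (x + t *\<^sub>R e) - u x) / t) \<longlongrightarrow> D e) (at 0)"
    by (simp add: DERIV_def)
  moreover have "filterlim s (at 0) sequentially"
    using s by (simp add: filterlim_at)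
  ultimately show ?thesis by (rule filterlim_compose)
qed

text \<open>The derivative is assumed to exist but not to be continuous, so measurability is
  obtained from a sequence of difference quotients.\<close>

lemma borel_measurable_directional_derivative:
  fixes u :: "complex \<Rightarrow> real"
  assumes u': "\<And>x. (u has_derivative D x) (at x)"
  shows "(\<lambda>x. D x e) \<in> borel_measurable borel"
proof -
  have "continuous_on UNIV u"
    using u' by (meson continuous_at_imp_continuous_on has_derivative_continuous)
  then have [measurable]: "u \<in> borel_measurable borel" by (rule borel_measurable_continuous_onI)
  have "(\<lambda>n. (u (x + inverse (real (Suc n)) *\<^sub>R e) - u x) / inverse (real (Suc n))) \<longlonglongrightarrow> D x e" for x
    by (rule difference_quotient_LIMSEQ[OF u' LIMSEQ_inverse_real_of_nat]) simp
  from borel_measurable_LIMSEQ_real[OF this] show ?thesis by measurable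
qed

text \<open>By translation invariance every difference quotient has integral 0. The Lipschitz bound
  dominates them, and steps of size at most 1 keep all supports in one ball, so the limit also has
  integral 0, again without continuity of the derivative.\<close>

lemma integral_derivative_eq_0:
  fixes u :: "complex \<Rightarrow> real"
  assumes u': "\<And>x. (u has_derivative D x) (at x)" and K: "\<And>x v. \<bar>D x v\<bar> \<le> K * norm v"
    and supp: "\<And>x. R \<le> norm x \<Longrightarrow> u x = 0"
  shows "integrable lborel (\<lambda>x. D x e)" "(\<integral>x. D x e \<partial>lborel) = 0"
proof -
  define s where "s n = inverse (real (Suc n))" for n
  have s: "0 < s n" "s n \<le> 1" for n by (auto simp: s_def field_simps)
  have s0: "s \<longlonglongrightarrow> 0" unfolding s_def by (rule LIMSEQ_inverse_real_of_nat)
  have uc: "continuous_on UNIV u"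
    using u' by (meson continuous_at_imp_continuous_on has_derivative_continuous)
  then have [measurable]: "u \<in> borel_measurable borel" by (rule borel_measurable_continuous_onI)
  have ui: "integrable lborel u"
  proof -
    have "integrable lborel (\<lambda>x. indicator (cball 0 R) x *\<^sub>R u x)"
      by (rule borel_integrable_compact) (auto intro: continuous_on_subset[OF uc])
    moreover have "(\<lambda>x. indicator (cball 0 R) x *\<^sub>R u x) = u"
      using supp by (auto simp: indicator_def fun_eq_iff)
    ultimately show ?thesis by metis
  qed
  define f where "f n x = (u (x + s n *\<^sub>R e) - u x) / s n" for n x
  have [measurable]: "f n \<in> borel_measurable lborel" for n unfolding f_def by measurable
  have lim: "(\<lambda>n. f n x) \<longlonglongrightarrow> D x e" for x
    unfolding f_def using s(1) by (intro difference_quotient_LIMSEQ[OF u' s0]) (simp add: less_imp_neq[symmetric])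
  have Dm[measurable]: "(\<lambda>x. D x e) \<in> borel_measurable lborel"
    using borel_measurable_directional_derivative[OF u'] by simp
  have bnd: "norm (f n x) \<le> K * norm e * indicator (cball 0 (R + norm e)) x" for n x
  proof (cases "x \<in> cball 0 (R + norm e)")
    case True
    have "norm (u (x + s n *\<^sub>R e) - u x) \<le> K * norm ((x + s n *\<^sub>R e) - x)"
    proof (rule differentiable_bound[OF convex_UNIV])
      show "(u has_derivative D y) (at y within UNIV)" for y using u' by simp
      show "onorm (D y) \<le> K" for y using K[of y] by (intro onorm_le) auto
    qed auto
    then show ?thesis using True s[of n] by (simp add: f_def abs_divide field_simps)
  next
    case False
    then have x: "norm x > R + norm e" by simp
    have se: "norm (s n *\<^sub>R e) \<le> norm e" using s[of n] by (simp add: mult_left_le_one_le)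
    have "norm x \<le> norm (x + s n *\<^sub>R e) + norm (s n *\<^sub>R e)" using norm_triangle_ineq4[of "x + s n *\<^sub>R e" "s n *\<^sub>R e"] by simp
    then have "R \<le> norm (x + s n *\<^sub>R e)" "R \<le> norm x" using x se norm_ge_zero[of e] by linarith+
    then show ?thesis using False supp by (simp add: f_def)
  qed
  have wi: "integrable lborel (\<lambda>x::complex. K * norm e * indicator (cball 0 (R + norm e)) x)"
    using emeasure_bounded_finite[OF bounded_cball, of "0::complex" "R + norm e"]
    by (auto intro!: integrable_mult_right integrable_real_indicator)
  have f0: "(\<integral>x. f n x \<partial>lborel) = 0" for n
  proof -
    have d: "distr lborel borel ((+) (s n *\<^sub>R e)) = lborel" by (rule lborel_distr_plus)
    have i: "integrable lborel (\<lambda>x. u (s n *\<^sub>R e + x))"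
      using ui integrable_distr_eq[of "(+) (s n *\<^sub>R e)" lborel borel u] d by simp
    have "(\<integral>x. u (s n *\<^sub>R e + x) \<partial>lborel) = (\<integral>x. u x \<partial>lborel)"
      using integral_distr[of "(+) (s n *\<^sub>R e)" lborel borel u] d by simp
    then show ?thesis
      unfolding f_def using i ui by (simp add: add.commute)
  qed
  show "integrable lborel (\<lambda>x. D x e)"
    by (rule integrable_dominated_convergence[OF Dm _ wi, of f]) (use lim bnd in auto)
  have "(\<lambda>n. \<integral>x. f n x \<partial>lborel) \<longlonglongrightarrow> (\<integral>x. D x e \<partial>lborel)"
    by (rule integral_dominated_convergence[OF Dm _ wi]) (use lim bnd in auto)
  then show "(\<integral>x. D x e \<partial>lborel) = 0" by (simp add: f0 LIMSEQ_const_iff)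
qed

text \<open>Apply \<open>integral_derivative_eq_0\<close> to \<phi> Re F in direction 1 and to
  \<phi> Im F in direction \<i>, and add. The bracket \<open>Re (D x 1) + Im (D x \<i>)\<close> is
  the divergence of \<open>F\<close>.\<close>

lemma integral_test_fn_divergence:
  fixes F :: "complex \<Rightarrow> complex"
  assumes \<phi>: "test_fn \<Omega> \<phi>" and F': "\<And>x. (F has_derivative D x) (at x)"
    and K: "\<And>x v. norm (D x v) \<le> K * norm v" "\<And>x. norm (F x) \<le> K"
  shows "integrable lborel (\<lambda>x. \<phi> x * (Re (D x 1) + Im (D x \<i>)))"
    "(\<integral>x. frechet_derivative \<phi> (at x) (F x) \<partial>lborel) = - (\<integral>x. \<phi> x * (Re (D x 1) + Im (D x \<i>)) \<partial>lborel)"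
proof -
  let ?d = "\<lambda>x. frechet_derivative \<phi> (at x)"
  let ?S = "closure {x. \<phi> x \<noteq> 0}"
  have sm: "smooth_R2 \<phi>" and S: "compact ?S" using \<phi> by (auto simp: test_fn_def)
  have z: "\<phi> x = 0" if "x \<notin> ?S" for x using that closure_subset[of "{x. \<phi> x \<noteq> 0}"] by auto
  obtain B where B: "B \<ge> 0" "\<And>x. \<bar>\<phi> x\<bar> \<le> B" "\<And>x v. \<bar>?d x v\<bar> \<le> B * norm v"
    using smooth_compact_support_C2_bounds[OF sm S z] by metis
  obtain R where R: "\<And>x. x \<in> ?S \<Longrightarrow> norm x < R"
    using compact_imp_bounded[OF S] by (metis bounded_pos_less)
  have zR: "\<phi> x = 0" if "R \<le> norm x" for x using R[of x] z[of x] that by (meson linorder_not_less)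
  have K0: "0 \<le> K" using K(2)[of 0] norm_ge_zero order_trans by blast
  have part: "integrable lborel (\<lambda>x. \<phi> x * L (D x e) + ?d x e * L (F x)) \<and>
    (\<integral>x. \<phi> x * L (D x e) + ?d x e * L (F x) \<partial>lborel) = 0"
    if L: "bounded_linear L" "\<And>w. \<bar>L w\<bar> \<le> norm w" for L :: "complex \<Rightarrow> real" and e
  proof -
    have d: "((\<lambda>x. \<phi> x * L (F x)) has_derivative (\<lambda>v. \<phi> x * L (D x v) + ?d x v * L (F x))) (at x)" for x
      by (rule has_derivative_mult[OF smooth_R2_D(1)[OF sm] bounded_linear.has_derivative[OF L(1) F']])
    have b: "\<bar>\<phi> x * L (D x v) + ?d x v * L (F x)\<bar> \<le> (2 * B * K) * norm v" for x v
    proof -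
      have "\<bar>\<phi> x * L (D x v)\<bar> \<le> B * (K * norm v)"
        unfolding abs_mult using B(1) by (intro mult_mono B(2) order_trans[OF L(2) K(1)]) auto
      moreover have "\<bar>?d x v * L (F x)\<bar> \<le> (B * norm v) * K"
        unfolding abs_mult using B(1) by (intro mult_mono B(3) order_trans[OF L(2) K(2)]) auto
      ultimately show ?thesis
        using abs_triangle_ineq[of "\<phi> x * L (D x v)" "?d x v * L (F x)"] by (simp add: mult_ac)
    qed
    show ?thesis
      using integral_derivative_eq_0[OF d b, of R e] zR by simp
  qed
  note 1 = part[OF bounded_linear_Re abs_Re_le_cmod, of 1] and 2 = part[OF bounded_linear_Im abs_Im_le_cmod, of \<i>]
  have dF: "?d x (F x) = ?d x 1 * Re (F x) + ?d x \<i> * Im (F x)" for x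
    using frechet_derivative_Re_Im[of \<phi> x "F x"] smooth_R2_D(1)[OF sm] by (auto simp: differentiable_def mult.commute)
  define G where "G x = ?d x (F x)" for x
  have Fc: "continuous_on UNIV F"
    using F' by (meson continuous_at_imp_continuous_on has_derivative_continuous)
  have Gc: "continuous_on UNIV G"
    unfolding G_def dF by (intro continuous_intros smooth_R2_D(2) smooth_R2_D(3) sm Fc)
  have G0: "G x = 0" if "x \<notin> ?S" for x
    using frechet_derivative_eq_0_outside_support[OF that] by (simp add: G_def)
  have Gi: "integrable lborel G"
  proof -
    have "integrable lborel (\<lambda>x. indicator ?S x *\<^sub>R G x)"
      by (rule borel_integrable_compact[OF S]) (rule continuous_on_subset[OF Gc], simp)
    moreover have "(\<lambda>x. indicator ?S x *\<^sub>R G x) = G"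
      using G0 by (auto simp: indicator_def fun_eq_iff)
    ultimately show ?thesis by metis
  qed
  let ?H = "\<lambda>x. \<phi> x * (Re (D x 1) + Im (D x \<i>))"
  have sum: "(\<phi> x * Re (D x 1) + ?d x 1 * Re (F x)) + (\<phi> x * Im (D x \<i>) + ?d x \<i> * Im (F x)) = ?H x + G x" for x
    by (simp add: G_def dF algebra_simps)
  have HG: "integrable lborel (\<lambda>x. ?H x + G x)" "(\<integral>x. ?H x + G x \<partial>lborel) = 0"
    using Bochner_Integration.integrable_add[OF conjunct1[OF 1] conjunct1[OF 2]]
      Bochner_Integration.integral_add[OF conjunct1[OF 1] conjunct1[OF 2]] conjunct2[OF 1] conjunct2[OF 2]
    unfolding sum by auto
  show Hi: "integrable lborel ?H"
    using Bochner_Integration.integrable_diff[OF HG(1) Gi] by simp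
  show "(\<integral>x. ?d x (F x) \<partial>lborel) = - (\<integral>x. ?H x \<partial>lborel)"
    using HG(2) Bochner_Integration.integral_add[OF Hi Gi] by (simp add: G_def[abs_def])
qed

section \<open>Mollification\<close>

lemma measure_cball_complex:
  fixes x :: complex
  assumes "0 \<le> r"
  shows "emeasure lborel (cball x r) = ennreal (pi * r ^ 2)" "measure lborel (cball x r) = pi * r ^ 2"
  using assms by (simp_all add: emeasure_cball unit_ball_vol_2 measure_def)

text \<open>One bump rescaled to z -> \<epsilon>^-2 \<rho>(z/\<epsilon>): unit mass fixes the power
  2, and a derivative costs one more. The constant is independent of \<epsilon>.\<close>

lemma scaled_kernel_exists:
  obtains K where "K \<ge> 0" "\<And>\<epsilon>. 0 < \<epsilon> \<Longrightarrow> \<exists>k. smooth_R2 k \<and> (\<forall>z. 0 \<le> k z) \<and> (\<forall>z. \<epsilon> \<le> norm z \<longrightarrow> k z = 0) \<and>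
     (\<integral>z. k z \<partial>lborel) = 1 \<and> (\<forall>z. k z \<le> K / \<epsilon> ^ 2) \<and>
     (\<forall>z v. \<bar>frechet_derivative k (at z) v\<bar> \<le> K / \<epsilon> ^ 3 * norm v)"
proof -
  obtain \<rho> :: "complex \<Rightarrow> real" where \<rho>: "smooth_R2 \<rho>" "\<And>z. 0 \<le> \<rho> z" "\<And>z. norm z \<ge> 1 \<Longrightarrow> \<rho> z = 0"
    "integrable lborel \<rho>" "(\<integral>z. \<rho> z \<partial>lborel) = 1"
    by (rule smooth_bump_exists) (rule that)
  have "\<rho> x = 0" if "x \<notin> cball 0 1" for x using \<rho>(3)[of x] that by simp
  then obtain K where K: "K \<ge> 0" "\<And>x. \<bar>\<rho> x\<bar> \<le> K" "\<And>x v. \<bar>frechet_derivative \<rho> (at x) v\<bar> \<le> K * norm v"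
    using smooth_compact_support_C2_bounds[OF \<rho>(1) compact_cball] by metis
  have [measurable]: "\<rho> \<in> borel_measurable borel" using \<rho>(4) by simp
  show thesis
  proof (rule that[OF K(1)])
    fix \<epsilon> :: real assume e: "0 < \<epsilon>"
    define k where "k z = 1 / \<epsilon> ^ 2 * \<rho> ((1 / \<epsilon>) *\<^sub>R z)" for z
    have sm: "smooth_R2 k"
      using smooth_R2_scaled_affine[OF \<rho>(1), of "1 / \<epsilon> ^ 2" "1 / \<epsilon>" 0] by (simp add: k_def[abs_def])
    have int: "(\<integral>z. k z \<partial>lborel) = 1"
    proof -
      have [measurable]: "k \<in> borel_measurable borel" unfolding k_def by measurable
      have "(\<integral>z. k z \<partial>lborel) = (\<integral>z. k z \<partial>density (distr lborel borel (\<lambda>x. 0 + \<epsilon> *\<^sub>R x)) (\<lambda>_. ennreal (\<bar>\<epsilon>\<bar> ^ DIM(complex))))"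
        using lborel_affine[of \<epsilon> "0::complex"] e by (metis order_less_irrefl)
      also have "\<dots> = (\<integral>z. \<epsilon> ^ 2 * k (\<epsilon> *\<^sub>R z) \<partial>lborel)"
        by (subst integral_density) (auto simp: integral_distr)
      also have "\<dots> = (\<integral>z. \<rho> z \<partial>lborel)" using e by (simp add: k_def)
      finally show ?thesis using \<rho>(5) by simp
    qed
    have D: "frechet_derivative k (at z) v = 1 / \<epsilon> ^ 2 * frechet_derivative \<rho> (at ((1 / \<epsilon>) *\<^sub>R z)) ((1 / \<epsilon>) *\<^sub>R v)" for z v
    proof -
      have "(k has_derivative (\<lambda>v. 1 / \<epsilon> ^ 2 * frechet_derivative \<rho> (at ((1 / \<epsilon>) *\<^sub>R z)) ((1 / \<epsilon>) *\<^sub>R v))) (at z)"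
        unfolding k_def
        by (rule has_derivative_mult_right, rule has_derivative_compose[of "\<lambda>z. (1 / \<epsilon>) *\<^sub>R z", where g = \<rho>])
           (auto intro!: derivative_eq_intros smooth_R2_D(1)[OF \<rho>(1)])
      from frechet_derivative_at[OF this, symmetric] show ?thesis by simp
    qed
    have Db: "\<bar>frechet_derivative k (at z) v\<bar> \<le> K / \<epsilon> ^ 3 * norm v" for z v
    proof -
      have "\<bar>frechet_derivative k (at z) v\<bar> \<le> 1 / \<epsilon> ^ 2 * (K * norm ((1 / \<epsilon>) *\<^sub>R v))"
        unfolding D abs_mult by (rule mult_mono[OF _ K(3)]) (use e in auto)
      also have "\<dots> = K / \<epsilon> ^ 3 * norm v" using e by (simp add: power3_eq_cube power2_eq_square)
      finally show ?thesis .
    qed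
    have kz: "k z = 0" if "\<epsilon> \<le> norm z" for z
      using \<rho>(3)[of "(1 / \<epsilon>) *\<^sub>R z"] that e by (simp add: k_def)
    have kb: "k z \<le> K / \<epsilon> ^ 2" "0 \<le> k z" for z
      using K(2)[of "(1 / \<epsilon>) *\<^sub>R z"] \<rho>(2)[of "(1 / \<epsilon>) *\<^sub>R z"] e by (auto simp: k_def divide_right_mono)
    show "\<exists>k. smooth_R2 k \<and> (\<forall>z. 0 \<le> k z) \<and> (\<forall>z. \<epsilon> \<le> norm z \<longrightarrow> k z = 0) \<and>
     (\<integral>z. k z \<partial>lborel) = 1 \<and> (\<forall>z. k z \<le> K / \<epsilon> ^ 2) \<and>
     (\<forall>z v. \<bar>frechet_derivative k (at z) v\<bar> \<le> K / \<epsilon> ^ 3 * norm v)"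
      using sm kz kb int Db by blast
  qed
qed

lemma integrable_bounded_cball:
  fixes f :: "complex \<Rightarrow> 'b::{banach, second_countable_topology}"
  assumes "f \<in> borel_measurable borel" "0 \<le> r" "\<And>y. norm (f y) \<le> B" "\<And>y. y \<notin> cball x r \<Longrightarrow> f y = 0"
  shows "integrable lborel f" "norm (\<integral>y. f y \<partial>lborel) \<le> B * (pi * r ^ 2)"
proof -
  have w: "integrable lborel (\<lambda>y. B * indicator (cball x r) y)"
    by (intro integrable_mult_right integrable_real_indicator) (auto simp: measure_cball_complex assms)
  have le: "norm (f y) \<le> B * indicator (cball x r) y" for y
    using assms(3)[of y] assms(4)[of y] by (auto simp: indicator_def)
  show i: "integrable lborel f"
    by (rule Bochner_Integration.integrable_bound[OF w]) (use assms(1) le order_trans[OF le abs_ge_self] in auto)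
  have "norm (\<integral>y. f y \<partial>lborel) \<le> (\<integral>y. norm (f y) \<partial>lborel)" by (rule integral_norm_bound)
  also have "\<dots> \<le> (\<integral>y. B * indicator (cball x r) y \<partial>lborel)"
    using i w le by (intro integral_mono) auto
  also have "\<dots> = B * (pi * r ^ 2)" by (simp add: measure_cball_complex assms)
  finally show "norm (\<integral>y. f y \<partial>lborel) \<le> B * (pi * r ^ 2)" .
qed

text \<open>The Taylor estimate of the kernel bounds the remainder by a multiple of |h|^2 times an
  area. For |h| < 1 the ball of radius \<epsilon> + 1 contains all the supports involved.\<close>

lemma convolution_has_derivative:
  fixes k :: "complex \<Rightarrow> real" and m :: "complex \<Rightarrow> complex"
  assumes k: "smooth_R2 k" and supp: "\<And>z. \<epsilon> \<le> norm z \<Longrightarrow> k z = 0" and e: "0 < \<epsilon>"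
    and [measurable]: "m \<in> borel_measurable borel" and m: "\<And>x. norm (m x) \<le> B"
  shows "((\<lambda>x. \<integral>y. k (x - y) *\<^sub>R m y \<partial>lborel) has_derivative
     (\<lambda>v. Re v *\<^sub>R (\<integral>y. frechet_derivative k (at (x - y)) 1 *\<^sub>R m y \<partial>lborel)
        + Im v *\<^sub>R (\<integral>y. frechet_derivative k (at (x - y)) \<i> *\<^sub>R m y \<partial>lborel))) (at x)"
proof -
  let ?d = "\<lambda>v z. frechet_derivative k (at z) v"
  have k0: "k z = 0" if "z \<notin> cball 0 \<epsilon>" for z using supp[of z] that by simp
  have cl: "closure {z. k z \<noteq> 0} \<subseteq> cball 0 \<epsilon>"
    using k0 by (intro closure_minimal) blast+
  have d0: "?d v z = 0" if "z \<notin> cball 0 \<epsilon>" for v z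
  proof -
    have "z \<notin> closure {z. k z \<noteq> 0}" using cl that by blast
    from fun_cong[OF frechet_derivative_eq_0_outside_support[OF this]] show ?thesis .
  qed
  obtain L where L: "L \<ge> 0" "\<And>z. \<bar>k z\<bar> \<le> L" "\<And>z v. \<bar>?d v z\<bar> \<le> L * norm v"
    "\<And>z h. \<bar>k (z + h) - k z - ?d h z\<bar> \<le> L * norm h ^ 2"
    using smooth_compact_support_C2_bounds[OF k compact_cball k0] by metis
  have [measurable]: "k \<in> borel_measurable borel" "?d v \<in> borel_measurable borel" for v
    using smooth_R2_D[OF k] smooth_R2_D(2)[OF smooth_R2_D(3)[OF k]] by (auto intro: borel_measurable_continuous_onI)
  have B0: "0 \<le> B" using order_trans[OF norm_ge_zero m] .
  have ik: "integrable lborel (\<lambda>y. k (x - y) *\<^sub>R m y)" for x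
  proof (rule integrable_bounded_cball(1)[of _ \<epsilon> "L * B" x])
    show "norm (k (x - y) *\<^sub>R m y) \<le> L * B" for y
      using L(1) by (auto intro!: mult_mono L(2) m)
    show "k (x - y) *\<^sub>R m y = 0" if "y \<notin> cball x \<epsilon>" for y
    proof -
      have "x - y \<notin> cball 0 \<epsilon>" using that by (simp add: dist_norm norm_minus_commute)
      from k0[OF this] show ?thesis by simp
    qed
  qed (use e in \<open>measurable, simp\<close>)
  have id: "integrable lborel (\<lambda>y. ?d v (x - y) *\<^sub>R m y)" for v x
  proof (rule integrable_bounded_cball(1)[of _ \<epsilon> "L * norm v * B" x])
    show "norm (?d v (x - y) *\<^sub>R m y) \<le> L * norm v * B" for y
      using L(1) by (auto intro!: mult_mono L(3) m)
    show "?d v (x - y) *\<^sub>R m y = 0" if "y \<notin> cball x \<epsilon>" for y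
    proof -
      have "x - y \<notin> cball 0 \<epsilon>" using that by (simp add: dist_norm norm_minus_commute)
      from d0[OF this] show ?thesis by simp
    qed
  qed (use e in \<open>measurable, simp\<close>)
  define M where "M x = (\<integral>y. k (x - y) *\<^sub>R m y \<partial>lborel)" for x
  let ?A = "\<lambda>v. Re v *\<^sub>R (\<integral>y. ?d 1 (x - y) *\<^sub>R m y \<partial>lborel) + Im v *\<^sub>R (\<integral>y. ?d \<i> (x - y) *\<^sub>R m y \<partial>lborel)"
  have kd: "k differentiable (at z)" for z using smooth_R2_D(1)[OF k] by (auto simp: differentiable_def)
  have A: "?A v = (\<integral>y. ?d v (x - y) *\<^sub>R m y \<partial>lborel)" for v
  proof -
    have "?d v (x - y) *\<^sub>R m y = Re v *\<^sub>R (?d 1 (x - y) *\<^sub>R m y) + Im v *\<^sub>R (?d \<i> (x - y) *\<^sub>R m y)" for y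
      by (subst frechet_derivative_Re_Im[OF kd]) (simp add: scaleR_add_left)
    then have "(\<integral>y. ?d v (x - y) *\<^sub>R m y \<partial>lborel)
      = (\<integral>y. Re v *\<^sub>R (?d 1 (x - y) *\<^sub>R m y) + Im v *\<^sub>R (?d \<i> (x - y) *\<^sub>R m y) \<partial>lborel)"
      by simp
    also have "\<dots> = ?A v"
      by (subst Bochner_Integration.integral_add)
         (auto intro!: integrable_scaleR_right id simp del: scaleR_scaleR)
    finally show ?thesis by simp
  qed
  define r where "r h = M (x + h) - M x - ?A h" for h
  have "norm (r h) \<le> (L * B * (pi * (\<epsilon> + 1) ^ 2)) * norm h ^ 2" if h: "norm h < 1" for h
  proof -
    have eq: "r h = (\<integral>y. (k (x + h - y) - k (x - y) - ?d h (x - y)) *\<^sub>R m y \<partial>lborel)"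
      unfolding r_def A M_def using ik[of "x + h"] ik[of x] id[where v = h and x = x] by (simp add: scaleR_diff_left)
    have "norm (r h) \<le> (L * norm h ^ 2 * B) * (pi * (\<epsilon> + 1) ^ 2)"
      unfolding eq
    proof (rule integrable_bounded_cball(2)[of _ _ _ x])
      show "norm ((k (x + h - y) - k (x - y) - ?d h (x - y)) *\<^sub>R m y) \<le> L * norm h ^ 2 * B" for y
        unfolding norm_scaleR using L(1) L(4)[of "x - y" h] by (intro mult_mono m) (simp_all add: algebra_simps)
      show "(k (x + h - y) - k (x - y) - ?d h (x - y)) *\<^sub>R m y = 0" if y: "y \<notin> cball x (\<epsilon> + 1)" for y
      proof -
        have n: "norm (x - y) > \<epsilon> + 1" using y by (simp add: dist_norm)
        moreover have "norm (x - y) \<le> norm (x + h - y) + norm h"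
          using norm_triangle_ineq4[of "x + h - y" h] by (simp add: algebra_simps)
        ultimately have "norm (x + h - y) \<ge> \<epsilon>" "norm (x - y) \<ge> \<epsilon>" using h by linarith+
        then show ?thesis using n supp d0[where z = "x - y" and v = h] by (simp add: mem_cball_0)
      qed
    qed (use e in \<open>measurable, auto\<close>)
    then show ?thesis by (simp only: mult_ac)
  qed
  then have r': "(r has_derivative (\<lambda>_. 0)) (at 0)"
    by (intro has_derivative_zero_quadratic[of 1]) auto
  have "((\<lambda>h. r h + M x + ?A h) has_derivative (\<lambda>v. 0 + 0 + ?A v)) (at 0)"
    by (intro has_derivative_add r' has_derivative_const bounded_linear_imp_has_derivative
        bounded_linear_add bounded_linear_compose[OF bounded_linear_scaleR_left] bounded_linear_Re bounded_linear_Im)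
  moreover have "(\<lambda>h. r h + M x + ?A h) = (\<lambda>h. M (x + h))" by (simp add: r_def fun_eq_iff)
  ultimately have "((\<lambda>h. M (x + h)) has_derivative ?A) (at (x - x))" by simp
  then have "((\<lambda>y. M (x + (y - x))) has_derivative ?A) (at x)"
    by (intro has_derivative_compose[of "\<lambda>y. y - x" "\<lambda>v. v" x UNIV "\<lambda>h. M (x + h)"])
       (auto intro!: derivative_eq_intros)
  then show ?thesis by (simp add: M_def)
qed

lemma integral_uniform_measure_cball:
  fixes f :: "complex \<Rightarrow> real"
  assumes [measurable]: "f \<in> borel_measurable borel" and "0 < r"
  shows "(\<integral>y. f y \<partial>uniform_measure lborel (cball x r)) = (\<integral>y. indicator (cball x r) y * f y \<partial>lborel) / (pi * r ^ 2)"
proof -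
  have p: "0 < pi * r ^ 2" using assms by simp
  have eq: "(\<lambda>y. indicator (cball x r) y / emeasure lborel (cball x r)) = (\<lambda>y. ennreal (indicator (cball x r) y / (pi * r ^ 2)))"
    using p assms by (auto simp: measure_cball_complex indicator_def divide_ennreal[symmetric] fun_eq_iff)
  have "(\<integral>y. f y \<partial>uniform_measure lborel (cball x r)) = (\<integral>y. (indicator (cball x r) y / (pi * r ^ 2)) * f y \<partial>lborel)"
    unfolding uniform_measure_def eq using p
    by (subst integral_density) (auto intro!: borel_measurable_divide borel_measurable_indicator)
  then show ?thesis by (simp only: times_divide_eq_left integral_divide_zero)
qed

context unit_curve
begin

lemma norm_gamma_bounded: obtains R where "R \<ge> 0" "\<And>t. norm (\<gamma> t) \<le> R"
proof
  show "0 \<le> norm (\<gamma> 0) + 2 * pi" by simp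
  show "norm (\<gamma> t) \<le> norm (\<gamma> 0) + 2 * pi" for t
    using norm_triangle_sub[of "\<gamma> t" "\<gamma> 0"] norm_gamma_diff_le_2pi[of t 0] by linarith
qed

lemma bounded_linear_support_fn: "bounded_linear (support_fn c)"
proof -
  have "linear (support_fn c)"
    by (rule linearI) (simp_all add: support_fn_def cross_def algebra_simps add_divide_distrib diff_divide_distrib)
  then show ?thesis by (simp add: linear_conv_bounded_linear)
qed

text \<open>Together with \<open>support_fn_le\<close>, this exhibits the norm as the maximum of its
  support functionals; it yields that mollified values stay in the unit ball.\<close>

lemma N_eq_support_fn: "z \<noteq> 0 \<Longrightarrow> \<exists>c. support_fn c z = N z"
proof -
  assume z: "z \<noteq> 0"
  have "N ((1 / N z) *\<^sub>R z) = 1" using N_pos[OF z] by (simp add: N_scale)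
  then have "(1 / N z) *\<^sub>R z \<in> range \<gamma>" unfolding gamma_range by simp
  then obtain c where c: "(1 / N z) *\<^sub>R z = \<gamma> c" by (rule rangeE)
  then have "z = N z *\<^sub>R \<gamma> c" using N_pos[OF z] by (simp flip: c)
  moreover have "support_fn c (N z *\<^sub>R \<gamma> c) = N z"
    using cross_gamma_pos[of c] by (simp add: support_fn_def cross_simps)
  ultimately show ?thesis by metis
qed

text \<open>The estimate for probability measures, applied to normalized Lebesgue measure on a ball.
  Both sides are of degree two in the measure, so clearing the area leaves the constant unchanged.
  The right side is written as a nonnegative integral for the Fubini arguments to come.\<close>

lemma uniform_deficit_times_spread:
  assumes "\<kappa> > 0"
  obtains C where "C \<ge> 0"
    "\<And>(T :: complex \<Rightarrow> real) x \<epsilon>. \<lbrakk>T \<in> borel_measurable borel; 0 < \<epsilon>\<rbrakk> \<Longrightarrow> \<exists>c. ennreal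
      ((\<integral>y. indicator (cball x \<epsilon>) y * (1 - support_fn c (\<gamma> (T y))) \<partial>lborel)
       * (\<integral>y. indicator (cball x \<epsilon>) y * norm (\<gamma> (T y) - \<gamma> c) \<partial>lborel))
      \<le> ennreal C * (\<integral>\<^sup>+y\<in>cball x \<epsilon>. (\<integral>\<^sup>+z\<in>cball x \<epsilon>. ennreal (circle_cost \<kappa> (T y) (T z)) \<partial>lborel) \<partial>lborel)"
proof -
  obtain C where C: "C \<ge> 0" "\<And>(M :: complex measure) T. \<lbrakk>prob_space M; T \<in> borel_measurable M\<rbrakk> \<Longrightarrow>
      \<exists>c. (\<integral>y. 1 - support_fn c (\<gamma> (T y)) \<partial>M) * (\<integral>y. norm (\<gamma> (T y) - \<gamma> c) \<partial>M)
        \<le> C * (\<integral>x. \<integral>y. circle_cost \<kappa> (T x) (T y) \<partial>M \<partial>M)"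
    using deficit_times_spread_le[OF assms, where ?'a = complex] by blast
  obtain Bq where Bq: "Bq \<ge> 0" "\<And>a b. circle_cost \<kappa> a b \<le> Bq" using circle_cost_bounded by metis
  show thesis
  proof (rule that[OF C(1)])
    fix T :: "complex \<Rightarrow> real" and x :: complex and \<epsilon> :: real
    assume [measurable]: "T \<in> borel_measurable borel" and e: "0 < \<epsilon>"
    define U where "U = uniform_measure lborel (cball x \<epsilon>)"
    define V where "V = pi * \<epsilon> ^ 2"
    have V: "0 < V" "emeasure lborel (cball x \<epsilon>) = ennreal V"
      using e by (auto simp: V_def measure_cball_complex)
    have [measurable_cong]: "sets U = sets borel" by (simp add: U_def)
    have U: "prob_space U"
      unfolding U_def using V by (intro prob_space_uniform_measure) auto
    interpret U: prob_space U by fact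
    obtain c where c: "(\<integral>y. 1 - support_fn c (\<gamma> (T y)) \<partial>U) * (\<integral>y. norm (\<gamma> (T y) - \<gamma> c) \<partial>U)
        \<le> C * (\<integral>x. \<integral>y. circle_cost \<kappa> (T x) (T y) \<partial>U \<partial>U)"
      using C(2)[OF U, of T] by auto
    define h where "h y = (\<integral>z. circle_cost \<kappa> (T y) (T z) \<partial>U)" for y
    have q0: "0 \<le> circle_cost \<kappa> a b" for a b using assms by (intro circle_cost_nonneg) simp
    have qi: "integrable U (\<lambda>z. circle_cost \<kappa> (T y) (T z))" for y
      using q0 Bq by (intro U.integrable_const_bound[where B = Bq]) auto
    have [measurable]: "h \<in> borel_measurable U"
      unfolding h_def by (rule U.borel_measurable_lebesgue_integral) measurable
    have h: "0 \<le> h y" "h y \<le> Bq" for y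
      using q0 Bq qi by (auto simp: h_def intro!: integral_nonneg_AE U.integral_le_const)
    have hi: "integrable U h" using h by (intro U.integrable_const_bound[where B = Bq]) auto
    have nn: "(\<integral>\<^sup>+y. f y \<partial>U) = (\<integral>\<^sup>+y\<in>cball x \<epsilon>. f y \<partial>lborel) / ennreal V"
      if "f \<in> borel_measurable borel" for f
      unfolding U_def using that V by (subst nn_integral_uniform_measure) auto
    have [measurable]: "Measurable.pred borel (\<lambda>z. z \<in> cball x \<epsilon>)" by simp
    have mq: "(\<lambda>y. \<integral>\<^sup>+z\<in>cball x \<epsilon>. ennreal (circle_cost \<kappa> (T y) (T z)) \<partial>lborel) \<in> borel_measurable borel"
      by measurable
    have "ennreal (\<integral>y. h y \<partial>U) = (\<integral>\<^sup>+y. ennreal (h y) \<partial>U)"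
      using hi h by (intro nn_integral_eq_integral[symmetric]) auto
    also have "\<dots> = (\<integral>\<^sup>+y. (\<integral>\<^sup>+z. ennreal (circle_cost \<kappa> (T y) (T z)) \<partial>U) \<partial>U)"
      unfolding h_def using qi q0 by (intro nn_integral_cong nn_integral_eq_integral[symmetric]) auto
    also have "\<dots> = (\<integral>\<^sup>+y. (\<integral>\<^sup>+z\<in>cball x \<epsilon>. ennreal (circle_cost \<kappa> (T y) (T z)) \<partial>lborel) / ennreal V \<partial>U)"
      by (intro nn_integral_cong nn) measurable
    also have "\<dots> = (\<integral>\<^sup>+y. (\<integral>\<^sup>+z\<in>cball x \<epsilon>. ennreal (circle_cost \<kappa> (T y) (T z)) \<partial>lborel) \<partial>U) / ennreal V"
      using mq by (intro nn_integral_divide) measurable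
    also have "\<dots> = (\<integral>\<^sup>+y\<in>cball x \<epsilon>. (\<integral>\<^sup>+z\<in>cball x \<epsilon>. ennreal (circle_cost \<kappa> (T y) (T z)) \<partial>lborel) \<partial>lborel) / ennreal V / ennreal V"
      using mq by (subst nn) auto
    finally have P: "ennreal (\<integral>y. h y \<partial>U) = (\<integral>\<^sup>+y\<in>cball x \<epsilon>. (\<integral>\<^sup>+z\<in>cball x \<epsilon>. ennreal (circle_cost \<kappa> (T y) (T z)) \<partial>lborel) \<partial>lborel) / ennreal V / ennreal V"
      (is "_ = ?I / _ / _") .
    have I: "?I = ennreal (V * V * (\<integral>y. h y \<partial>U))"
    proof -
      have "ennreal (V * V * (\<integral>y. h y \<partial>U)) = ennreal V * ennreal V * (?I / ennreal V / ennreal V)"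
        using V h unfolding P[symmetric] by (simp add: ennreal_mult integral_nonneg_AE)
      also have "\<dots> = ?I"
      proof -
        have "ennreal V * (X / ennreal V) = X" for X
          using V(1) by (simp add: ennreal_times_divide mult.commute[of "ennreal V"] mult_divide_eq_ennreal)
        then show ?thesis by (simp only: mult.assoc)
      qed
      finally show ?thesis ..
    qed
    have "(\<integral>y. indicator (cball x \<epsilon>) y * (1 - support_fn c (\<gamma> (T y))) \<partial>lborel)
       * (\<integral>y. indicator (cball x \<epsilon>) y * norm (\<gamma> (T y) - \<gamma> c) \<partial>lborel)
      = V * V * ((\<integral>y. 1 - support_fn c (\<gamma> (T y)) \<partial>U) * (\<integral>y. norm (\<gamma> (T y) - \<gamma> c) \<partial>U))"
      unfolding U_def V_def using e by (subst (1 2) integral_uniform_measure_cball) (auto simp: field_simps)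
    also have "\<dots> \<le> V * V * (C * (\<integral>y. h y \<partial>U))"
      using V c unfolding h_def by (intro mult_left_mono) auto
    finally have "ennreal ((\<integral>y. indicator (cball x \<epsilon>) y * (1 - support_fn c (\<gamma> (T y))) \<partial>lborel)
       * (\<integral>y. indicator (cball x \<epsilon>) y * norm (\<gamma> (T y) - \<gamma> c) \<partial>lborel)) \<le> ennreal (C * (V * V * (\<integral>y. h y \<partial>U)))"
      by (intro ennreal_leI) (simp add: mult_ac)
    also have "\<dots> = ennreal C * ?I" unfolding I using C(1) V h by (simp add: ennreal_mult integral_nonneg_AE)
    finally show "\<exists>c. ennreal
      ((\<integral>y. indicator (cball x \<epsilon>) y * (1 - support_fn c (\<gamma> (T y))) \<partial>lborel)
       * (\<integral>y. indicator (cball x \<epsilon>) y * norm (\<gamma> (T y) - \<gamma> c) \<partial>lborel)) \<le> ennreal C * ?I" by blast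
  qed
qed

text \<open>\<open>F\<close> is \<Psi> of the mollified field and \<open>f\<close> its divergence.
  The estimate of \<open>f\<close> is restricted to balls inside \<Omega>, because only there is the
  kernel an admissible test function and the mollification divergence free at the centre; elsewhere
  \<open>f\<close> is merely bounded.\<close>

lemma entropy_regularization:
  assumes \<kappa>: "\<kappa> > 0" and \<Phi>: "ENT \<gamma> \<Phi>"
  obtains C where "C \<ge> 0"
    "\<And>T \<Omega> \<epsilon>. \<lbrakk>T \<in> borel_measurable borel; div_zero \<Omega> (\<lambda>x. \<gamma> (T x)); 0 < \<epsilon>\<rbrakk> \<Longrightarrow>
      \<exists>F f. continuous_on UNIV F \<and> f \<in> borel_measurable borel \<and> (\<exists>K. \<forall>x. \<bar>f x\<bar> \<le> K) \<and>
        (\<forall>\<phi>. test_fn \<Omega> \<phi> \<longrightarrow> (\<integral>x. frechet_derivative \<phi> (at x) (F x) \<partial>lborel) = - (\<integral>x. \<phi> x * f x \<partial>lborel)) \<and>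
        (\<forall>x. norm (F x - \<Phi> (\<gamma> (T x))) \<le> C / \<epsilon> ^ 2 * (\<integral>y. indicator (cball x \<epsilon>) y * norm (\<gamma> (T y) - \<gamma> (T x)) \<partial>lborel)) \<and>
        (\<forall>x. cball x \<epsilon> \<subseteq> \<Omega> \<longrightarrow> ennreal \<bar>f x\<bar> \<le> ennreal (C / \<epsilon> ^ 5) *
           (\<integral>\<^sup>+y\<in>cball x \<epsilon>. (\<integral>\<^sup>+z\<in>cball x \<epsilon>. ennreal (circle_cost \<kappa> (T y) (T z)) \<partial>lborel) \<partial>lborel))"
proof -
  obtain \<Psi> D l C0 where C0: "C0 \<ge> 0" and \<Psi>': "\<And>z. (\<Psi> has_derivative D z) (at z)" and \<Psi>\<gamma>: "\<And>t. \<Psi> (\<gamma> t) = \<Phi> (\<gamma> t)"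
    and Dl: "\<And>z v. N z \<le> 1 \<Longrightarrow> norm (D z v - l z *\<^sub>R v) \<le> C0 * (1 - N z) * norm v"
    and l: "\<And>z. N z \<le> 1 \<Longrightarrow> \<bar>l z\<bar> \<le> C0"
    by (rule entropy_extension[OF \<Phi>]) (rule that)
  obtain K where K: "K \<ge> 0" and kernel: "\<And>\<epsilon>. 0 < \<epsilon> \<Longrightarrow> \<exists>k. smooth_R2 k \<and> (\<forall>z. 0 \<le> k z) \<and> (\<forall>z. \<epsilon> \<le> norm z \<longrightarrow> k z = 0) \<and>
     (\<integral>z. k z \<partial>lborel) = 1 \<and> (\<forall>z. k z \<le> K / \<epsilon> ^ 2) \<and>
     (\<forall>z v. \<bar>frechet_derivative k (at z) v\<bar> \<le> K / \<epsilon> ^ 3 * norm v)"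
    by (rule scaled_kernel_exists) (rule that)
  obtain R where R: "R \<ge> 0" "\<And>t. norm (\<gamma> t) \<le> R" by (rule norm_gamma_bounded) (rule that)
  obtain C1 where C1: "C1 \<ge> 0" and key: "\<And>(T :: complex \<Rightarrow> real) x \<epsilon>. \<lbrakk>T \<in> borel_measurable borel; 0 < \<epsilon>\<rbrakk> \<Longrightarrow> \<exists>c. ennreal
      ((\<integral>y. indicator (cball x \<epsilon>) y * (1 - support_fn c (\<gamma> (T y))) \<partial>lborel)
       * (\<integral>y. indicator (cball x \<epsilon>) y * norm (\<gamma> (T y) - \<gamma> c) \<partial>lborel))
      \<le> ennreal C1 * (\<integral>\<^sup>+y\<in>cball x \<epsilon>. (\<integral>\<^sup>+z\<in>cball x \<epsilon>. ennreal (circle_cost \<kappa> (T y) (T z)) \<partial>lborel) \<partial>lborel)"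
    by (rule uniform_deficit_times_spread[OF \<kappa>]) (rule that)
  \<comment> \<open>The first summand is the Lipschitz constant of \<Psi> times the kernel bound.
    The second combines two partial derivatives, one kernel bound in each of the two factors, and
    the constant of the product estimate.\<close>
  define C where "C = 2 * C0 * K + 2 * C0 * K ^ 2 * C1"
  have Ds: "norm (D z v) \<le> 2 * C0 * norm v" if z: "N z \<le> 1" for z v
  proof -
    have "norm (D z v) \<le> norm (D z v - l z *\<^sub>R v) + norm (l z *\<^sub>R v)"
      using norm_triangle_ineq[of "D z v - l z *\<^sub>R v" "l z *\<^sub>R v"] by simp
    also have "\<dots> \<le> C0 * 1 * norm v + C0 * norm v"
      using l[OF z] z N_nonneg[of z] C0
      by (intro add_mono order_trans[OF Dl[OF z]] mult_right_mono mult_left_mono) (auto intro!: mult_right_mono)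
    finally show ?thesis by simp
  qed
  \<comment> \<open>The differential is controlled on the closed unit ball only; its convexity is
    what permits the mean value inequality.\<close>
  have \<Psi>lip: "norm (\<Psi> z - \<Psi> w) \<le> 2 * C0 * norm (z - w)" if "N z \<le> 1" "N w \<le> 1" for z w
  proof (rule differentiable_bound[OF convex_N_ball(2)[of 1]])
    show "(\<Psi> has_derivative D u) (at u within {z. N z \<le> 1})" for u
      using \<Psi>' by (rule has_derivative_at_withinI)
    show "onorm (D u) \<le> 2 * C0" if "u \<in> {z. N z \<le> 1}" for u
      using Ds[of u] that by (intro onorm_le) auto
  qed (use that in auto)
  show thesis
  proof (rule that[of C])
    show "0 \<le> C" using C0 K C1 by (simp add: C_def)
  next
    fix T :: "complex \<Rightarrow> real" and \<Omega> and \<epsilon> :: real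
    assume [measurable]: "T \<in> borel_measurable borel" and dz: "div_zero \<Omega> (\<lambda>x. \<gamma> (T x))" and e: "0 < \<epsilon>"
    obtain k where k: "smooth_R2 k" "\<And>z. 0 \<le> k z" and ksupp: "\<And>z. \<epsilon> \<le> norm z \<Longrightarrow> k z = 0"
      and k1: "(\<integral>z. k z \<partial>lborel) = 1" and kle: "\<And>z. k z \<le> K / \<epsilon> ^ 2"
      and dkle: "\<And>z v. \<bar>frechet_derivative k (at z) v\<bar> \<le> K / \<epsilon> ^ 3 * norm v"
      using kernel[OF e] by blast
    define d where "d v z = frechet_derivative k (at z) v" for v z
    have kd: "k differentiable (at z)" for z using smooth_R2_D(1)[OF k(1)] by (auto simp: differentiable_def)
    have [measurable]: "k \<in> borel_measurable borel" "d v \<in> borel_measurable borel" for v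
      unfolding d_def using smooth_R2_D[OF k(1)] smooth_R2_D(2)[OF smooth_R2_D(3)[OF k(1)]]
      by (auto intro: borel_measurable_continuous_onI)
    have cl: "closure {z. k z \<noteq> 0} \<subseteq> cball 0 \<epsilon>"
    proof (rule closure_minimal)
      show "{z. k z \<noteq> 0} \<subseteq> cball 0 \<epsilon>"
      proof
        fix z assume "z \<in> {z. k z \<noteq> 0}"
        then show "z \<in> cball 0 \<epsilon>" using ksupp[of z] by (cases "\<epsilon> \<le> norm z") auto
      qed
    qed simp
    have xyc: "x - y \<notin> cball 0 \<epsilon>" if "y \<notin> cball x \<epsilon>" for x y :: complex
      using that by (simp add: dist_norm norm_minus_commute)
    have k0: "k (x - y) = 0" if "y \<notin> cball x \<epsilon>" for x y
      using ksupp[of "x - y"] xyc[OF that] by simp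
    have d0: "d v (x - y) = 0" if "y \<notin> cball x \<epsilon>" for v x y
    proof -
      have "x - y \<notin> closure {z. k z \<noteq> 0}" using cl xyc[OF that] by blast
      from fun_cong[OF frechet_derivative_eq_0_outside_support[OF this]] show ?thesis by (simp add: d_def)
    qed
    have kint: "integrable lborel (\<lambda>y. k (x - y) *\<^sub>R g y)"
      if [measurable]: "g \<in> borel_measurable borel" and g: "\<And>y. norm (g y) \<le> G" for g :: "complex \<Rightarrow> 'b::{banach, second_countable_topology}" and G x
    proof (rule integrable_bounded_cball(1)[of _ \<epsilon> "K / \<epsilon> ^ 2 * G" x])
      show "norm (k (x - y) *\<^sub>R g y) \<le> K / \<epsilon> ^ 2 * G" for y
        unfolding norm_scaleR using k(2)[of "x - y"] kle[of "x - y"] g[of y] K by (intro mult_mono) auto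
      show "k (x - y) *\<^sub>R g y = 0" if "y \<notin> cball x \<epsilon>" for y using k0[OF that] by simp
    qed (use e in \<open>measurable, simp\<close>)
    have dint: "integrable lborel (\<lambda>y. d v (x - y) *\<^sub>R g y)"
      if [measurable]: "g \<in> borel_measurable borel" and g: "\<And>y. norm (g y) \<le> G" for g :: "complex \<Rightarrow> 'b::{banach, second_countable_topology}" and G v x
    proof (rule integrable_bounded_cball(1)[of _ \<epsilon> "K / \<epsilon> ^ 3 * norm v * G" x])
      show "norm (d v (x - y) *\<^sub>R g y) \<le> K / \<epsilon> ^ 3 * norm v * G" for y
        unfolding norm_scaleR using dkle[of "x - y" v] g[of y] K e by (intro mult_mono) (auto simp: d_def)
      show "d v (x - y) *\<^sub>R g y = 0" if "y \<notin> cball x \<epsilon>" for y using d0[OF that] by simp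
    qed (use e in \<open>measurable, simp\<close>)
    have refl_int: "(\<integral>y. g (x - y) \<partial>lborel) = (\<integral>z. g z \<partial>lborel)" if [measurable]: "g \<in> borel_measurable borel" for g :: "complex \<Rightarrow> real" and x
    proof -
      have "(\<integral>z. g z \<partial>lborel) = (\<integral>z. g z \<partial>density (distr lborel borel (\<lambda>y. x + (- 1) *\<^sub>R y)) (\<lambda>_. ennreal (\<bar>- 1\<bar> ^ DIM(complex))))"
        using lborel_affine[of "- 1" x] by simp
      also have "\<dots> = (\<integral>y. g (x - y) \<partial>lborel)"
        by (subst integral_density) (auto simp: integral_distr)
      finally show ?thesis ..
    qed
    have k1x: "(\<integral>y. k (x - y) \<partial>lborel) = 1" for x using refl_int[of k x] k1 by simp
    have d1x: "(\<integral>y. d v (x - y) \<partial>lborel) = 0" for v x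
    proof -
      have "(\<integral>z. d v z \<partial>lborel) = 0"
        unfolding d_def by (rule integral_derivative_eq_0(2)[OF smooth_R2_D(1)[OF k(1)] dkle ksupp])
      then show ?thesis using refl_int[of "d v" x] by simp
    qed
    define m where "m y = \<gamma> (T y)" for y
    have [measurable]: "m \<in> borel_measurable borel" unfolding m_def by measurable
    have mR: "norm (m y) \<le> R" for y using R by (simp add: m_def)
    have Nm: "N (m y) = 1" for y by (simp add: m_def N_gamma)
    define M where "M x = (\<integral>y. k (x - y) *\<^sub>R m y \<partial>lborel)" for x
    define M1 where "M1 v x = (\<integral>y. d v (x - y) *\<^sub>R m y \<partial>lborel)" for v x
    have M': "(M has_derivative (\<lambda>v. Re v *\<^sub>R M1 1 x + Im v *\<^sub>R M1 \<i> x)) (at x)" for x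
      unfolding M_def M1_def d_def by (rule convolution_has_derivative[where B = R]) (use k(1) ksupp e mR in \<open>auto\<close>)
    have sf: "support_fn c (M x) = (\<integral>y. k (x - y) * support_fn c (m y) \<partial>lborel)" for c x
    proof -
      have "support_fn c (M x) = (\<integral>y. support_fn c (k (x - y) *\<^sub>R m y) \<partial>lborel)"
        unfolding M_def by (rule integral_bounded_linear[OF bounded_linear_support_fn kint[of m R x, OF _ mR], symmetric]) measurable
      then show ?thesis using linear_scale[OF bounded_linear.linear[OF bounded_linear_support_fn]] by simp
    qed
    have sfb: "\<bar>support_fn c (m y)\<bar> \<le> 1" for c y
      using support_fn_le[of c "m y"] support_fn_ge[of "m y" c] by (simp add: Nm abs_le_iff)
    have ksf: "integrable lborel (\<lambda>y. k (x - y) * support_fn c (m y))" for c x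
      using kint[of "\<lambda>y. support_fn c (m y)" 1 x] sfb by simp
    have ki: "integrable lborel (\<lambda>y. k (x - y))" for x
      using kint[of "\<lambda>_. 1::real" 1 x] by simp
    have di: "integrable lborel (\<lambda>y. d v (x - y))" for v x
      using dint[of "\<lambda>_. 1::real" 1 v x] by simp
    \<comment> \<open>Unit mass and linearity make the deficit of the average the average of the
      deficits, a property that \<open>N\<close> itself lacks.\<close>
    have deficit: "1 - support_fn c (M x) = (\<integral>y. k (x - y) * (1 - support_fn c (m y)) \<partial>lborel)" for c x
      using ki[of x] ksf[of x c] k1x[of x] by (simp add: sf right_diff_distrib)
    have NM: "N (M x) \<le> 1" for x
    proof (cases "M x = 0")
      case True
      then show ?thesis using N_eq_0[of 0] by simp
    next
      case False
      then obtain c where c: "support_fn c (M x) = N (M x)" using N_eq_support_fn by blast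
      have "0 \<le> 1 - support_fn c (M x)"
        unfolding deficit using k(2) sfb[of c] by (intro integral_nonneg_AE AE_I2 mult_nonneg_nonneg) (auto simp: abs_le_iff)
      then show ?thesis using c by simp
    qed
    define F where "F x = \<Psi> (M x)" for x
    define DF where "DF x v = D (M x) (Re v *\<^sub>R M1 1 x + Im v *\<^sub>R M1 \<i> x)" for x v
    have F': "(F has_derivative DF x) (at x)" for x
      unfolding F_def DF_def by (rule has_derivative_compose[OF M' \<Psi>'])
    have Fc: "continuous_on UNIV F"
      using F' by (meson continuous_at_imp_continuous_on has_derivative_continuous)
    define f where "f x = Re (DF x 1) + Im (DF x \<i>)" for x
    define B where "B = (K / \<epsilon> ^ 3 * R) * (pi * \<epsilon> ^ 2)"
    have M1b: "norm (M1 v x) \<le> B" if v: "norm v = 1" for v x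
      unfolding M1_def B_def
    proof (rule integrable_bounded_cball(2)[of _ _ _ x])
      show "norm (d v (x - y) *\<^sub>R m y) \<le> K / \<epsilon> ^ 3 * R" for y
        unfolding norm_scaleR using dkle[of "x - y" v] mR[of y] K e v by (intro mult_mono) (auto simp: d_def)
      show "d v (x - y) *\<^sub>R m y = 0" if "y \<notin> cball x \<epsilon>" for y using d0[OF that] by simp
    qed (use e in \<open>measurable, simp\<close>)
    have B0: "0 \<le> B" using order_trans[OF norm_ge_zero M1b[of 1 0]] by simp
    have DFb: "norm (DF x v) \<le> (4 * C0 * B) * norm v" for x v
    proof -
      have "norm (Re v *\<^sub>R M1 1 x + Im v *\<^sub>R M1 \<i> x) \<le> \<bar>Re v\<bar> * norm (M1 1 x) + \<bar>Im v\<bar> * norm (M1 \<i> x)"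
        by (rule order_trans[OF norm_triangle_ineq]) simp
      also have "\<dots> \<le> norm v * B + norm v * B"
        by (intro add_mono mult_mono abs_Re_le_cmod abs_Im_le_cmod M1b) auto
      finally have "2 * C0 * norm (Re v *\<^sub>R M1 1 x + Im v *\<^sub>R M1 \<i> x) \<le> 2 * C0 * (2 * B * norm v)"
        using C0 by (intro mult_left_mono) auto
      then show ?thesis unfolding DF_def using Ds[OF NM[of x]] by (intro order_trans[OF Ds[OF NM]]) (simp add: mult_ac)
    qed
    have Mb: "norm (M x) \<le> (K / \<epsilon> ^ 2 * R) * (pi * \<epsilon> ^ 2)" for x
      unfolding M_def
    proof (rule integrable_bounded_cball(2)[of _ _ _ x])
      show "norm (k (x - y) *\<^sub>R m y) \<le> K / \<epsilon> ^ 2 * R" for y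
        unfolding norm_scaleR using k(2)[of "x - y"] kle[of "x - y"] mR[of y] K by (intro mult_mono) auto
      show "k (x - y) *\<^sub>R m y = 0" if "y \<notin> cball x \<epsilon>" for y using k0[OF that] by simp
    qed (use e in \<open>measurable, simp\<close>)
    define BF where "BF = 2 * C0 * ((K / \<epsilon> ^ 2 * R) * (pi * \<epsilon> ^ 2) + R) + norm (\<Psi> (\<gamma> 0))"
    have FBF: "norm (F x) \<le> BF" for x
    proof -
      have "norm (F x) \<le> norm (\<Psi> (M x) - \<Psi> (\<gamma> 0)) + norm (\<Psi> (\<gamma> 0))"
        unfolding F_def by (metis add.commute norm_triangle_sub)
      also have "\<dots> \<le> 2 * C0 * norm (M x - \<gamma> 0) + norm (\<Psi> (\<gamma> 0))"
        using \<Psi>lip[OF NM, of "\<gamma> 0" x] by (simp add: N_gamma)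
      also have "2 * C0 * norm (M x - \<gamma> 0) \<le> 2 * C0 * ((K / \<epsilon> ^ 2 * R) * (pi * \<epsilon> ^ 2) + R)"
        using C0 Mb[of x] R(2)[of 0] by (intro mult_left_mono order_trans[OF norm_triangle_ineq4]) auto
      finally show ?thesis by (simp add: BF_def)
    qed
    define KK where "KK = max BF (4 * C0 * B)"
    have parts: "(\<integral>x. frechet_derivative \<phi> (at x) (F x) \<partial>lborel) = - (\<integral>x. \<phi> x * f x \<partial>lborel)"
      if "test_fn \<Omega> \<phi>" for \<phi>
      unfolding f_def
    proof (rule integral_test_fn_divergence(2)[OF that F'])
      show "norm (DF x v) \<le> KK * norm v" for x v
        by (rule order_trans[OF DFb]) (auto simp: KK_def intro!: mult_right_mono)
      show "norm (F x) \<le> KK" for x using FBF[of x] by (simp add: KK_def)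
    qed
    have fb: "\<bar>f x\<bar> \<le> 8 * C0 * B" for x
      using abs_Re_le_cmod[of "DF x 1"] abs_Im_le_cmod[of "DF x \<i>"] DFb[of x 1] DFb[of x \<i>]
      by (simp add: f_def)
    have fm: "f \<in> borel_measurable borel"
    proof -
      have "((\<lambda>x. Re (F x)) has_derivative (\<lambda>v. Re (DF x v))) (at x)"
        "((\<lambda>x. Im (F x)) has_derivative (\<lambda>v. Im (DF x v))) (at x)" for x
        using bounded_linear.has_derivative[OF bounded_linear_Re F'] bounded_linear.has_derivative[OF bounded_linear_Im F'] by auto
      from borel_measurable_directional_derivative[OF this(1)] borel_measurable_directional_derivative[OF this(2)]
      show ?thesis unfolding f_def by measurable
    qed
    show "\<exists>F f. continuous_on UNIV F \<and> f \<in> borel_measurable borel \<and> (\<exists>K. \<forall>x. \<bar>f x\<bar> \<le> K) \<and>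
        (\<forall>\<phi>. test_fn \<Omega> \<phi> \<longrightarrow> (\<integral>x. frechet_derivative \<phi> (at x) (F x) \<partial>lborel) = - (\<integral>x. \<phi> x * f x \<partial>lborel)) \<and>
        (\<forall>x. norm (F x - \<Phi> (\<gamma> (T x))) \<le> C / \<epsilon> ^ 2 * (\<integral>y. indicator (cball x \<epsilon>) y * norm (\<gamma> (T y) - \<gamma> (T x)) \<partial>lborel)) \<and>
        (\<forall>x. cball x \<epsilon> \<subseteq> \<Omega> \<longrightarrow> ennreal \<bar>f x\<bar> \<le> ennreal (C / \<epsilon> ^ 5) *
           (\<integral>\<^sup>+y\<in>cball x \<epsilon>. (\<integral>\<^sup>+z\<in>cball x \<epsilon>. ennreal (circle_cost \<kappa> (T y) (T z)) \<partial>lborel) \<partial>lborel))"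
    proof (intro exI conjI allI impI)
      show "continuous_on UNIV F" by (rule Fc)
      show "f \<in> borel_measurable borel" by (rule fm)
      show "\<bar>f x\<bar> \<le> 8 * C0 * B" for x by (rule fb)
      show "(\<integral>x. frechet_derivative \<phi> (at x) (F x) \<partial>lborel) = - (\<integral>x. \<phi> x * f x \<partial>lborel)" if "test_fn \<Omega> \<phi>" for \<phi>
        by (rule parts[OF that])
      show "norm (F x - \<Phi> (\<gamma> (T x))) \<le> C / \<epsilon> ^ 2 * (\<integral>y. indicator (cball x \<epsilon>) y * norm (\<gamma> (T y) - \<gamma> (T x)) \<partial>lborel)" for x
      proof -
        have bm: "norm (m y - m x) \<le> R + R" for y by (rule order_trans[OF norm_triangle_ineq4 add_mono[OF mR mR]])
        have i1: "integrable lborel (\<lambda>y. k (x - y) *\<^sub>R (m y - m x))" by (rule kint[of _ "R + R"]) (use bm in simp_all)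
        have i2: "integrable lborel (\<lambda>y. indicator (cball x \<epsilon>) y * norm (m y - m x))"
          by (rule integrable_bounded_cball(1)[of _ \<epsilon> "R + R" x])
             (use e bm R(1) in \<open>measurable, auto simp: indicator_def\<close>)
        have "M x - m x = (\<integral>y. k (x - y) *\<^sub>R (m y - m x) \<partial>lborel)"
          using kint[of m R x, OF _ mR] ki[of x] k1x[of x] by (simp add: M_def scaleR_diff_right)
        then have "norm (M x - m x) \<le> (\<integral>y. norm (k (x - y) *\<^sub>R (m y - m x)) \<partial>lborel)"
          by (metis integral_norm_bound)
        also have "\<dots> \<le> (\<integral>y. K / \<epsilon> ^ 2 * (indicator (cball x \<epsilon>) y * norm (m y - m x)) \<partial>lborel)"
        proof (rule integral_mono)
          show "norm (k (x - y) *\<^sub>R (m y - m x)) \<le> K / \<epsilon> ^ 2 * (indicator (cball x \<epsilon>) y * norm (m y - m x))" for y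
          proof (cases "y \<in> cball x \<epsilon>")
            case True
            then show ?thesis
              using k(2)[of "x - y"] mult_right_mono[OF kle[of "x - y"] norm_ge_zero[of "m y - m x"]] by simp
          next
            case False
            then show ?thesis using k0[OF False] by simp
          qed
        qed (rule integrable_norm[OF i1] integrable_mult_right[OF i2])+
        also have "\<dots> = K / \<epsilon> ^ 2 * (\<integral>y. indicator (cball x \<epsilon>) y * norm (m y - m x) \<partial>lborel)" (is "_ = _ * ?J")
          by simp
        finally have 1: "norm (M x - m x) \<le> K / \<epsilon> ^ 2 * ?J" .
        have J0: "0 \<le> ?J" by (intro integral_nonneg_AE) auto
        have "norm (F x - \<Phi> (\<gamma> (T x))) \<le> 2 * C0 * norm (M x - m x)"
          using \<Psi>lip[OF NM[of x], of "m x"] by (simp add: F_def m_def N_gamma \<Psi>\<gamma>)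
        also have "\<dots> \<le> 2 * C0 * (K / \<epsilon> ^ 2 * ?J)" using 1 C0 by (intro mult_left_mono) auto
        also have "\<dots> = (2 * C0 * K) / \<epsilon> ^ 2 * ?J" by simp
        also have "\<dots> \<le> C / \<epsilon> ^ 2 * ?J"
          using J0 C0 K C1 by (intro mult_right_mono divide_right_mono) (auto simp: C_def)
        finally show ?thesis by (simp add: m_def)
      qed
      show "ennreal \<bar>f x\<bar> \<le> ennreal (C / \<epsilon> ^ 5) *
           (\<integral>\<^sup>+y\<in>cball x \<epsilon>. (\<integral>\<^sup>+z\<in>cball x \<epsilon>. ennreal (circle_cost \<kappa> (T y) (T z)) \<partial>lborel) \<partial>lborel)"
        (is "_ \<le> _ * ?I") if sub: "cball x \<epsilon> \<subseteq> \<Omega>" for x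
      proof -
        obtain c where c: "ennreal
          ((\<integral>y. indicator (cball x \<epsilon>) y * (1 - support_fn c (\<gamma> (T y))) \<partial>lborel)
           * (\<integral>y. indicator (cball x \<epsilon>) y * norm (\<gamma> (T y) - \<gamma> c) \<partial>lborel)) \<le> ennreal C1 * ?I"
          using key[OF _ e, of T x] by auto
        define E1 where "E1 = (\<integral>y. indicator (cball x \<epsilon>) y * (1 - support_fn c (m y)) \<partial>lborel)"
        define E2 where "E2 = (\<integral>y. indicator (cball x \<epsilon>) y * norm (m y - \<gamma> c) \<partial>lborel)"
        have E: "ennreal (E1 * E2) \<le> ennreal C1 * ?I" using c by (simp add: E1_def E2_def m_def)
        have E1i: "integrable lborel (\<lambda>y. indicator (cball x \<epsilon>) y * (1 - support_fn c (m y)))"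
          by (rule integrable_bounded_cball(1)[of _ \<epsilon> 2 x])
             (use e sfb[of c] in \<open>measurable, auto simp: indicator_def abs_le_iff\<close>)
        have bm: "norm (m y - \<gamma> c) \<le> R + R" for y by (rule order_trans[OF norm_triangle_ineq4 add_mono[OF mR R(2)]])
        have E2i: "integrable lborel (\<lambda>y. indicator (cball x \<epsilon>) y * norm (m y - \<gamma> c))"
          by (rule integrable_bounded_cball(1)[of _ \<epsilon> "R + R" x])
             (use e bm R(1) in \<open>measurable, auto simp: indicator_def\<close>)
        have E10: "0 \<le> E1" "0 \<le> E2"
          unfolding E1_def E2_def using sfb[of c] by (auto intro!: integral_nonneg_AE AE_I2 mult_nonneg_nonneg simp: abs_le_iff)
        \<comment> \<open>Every support functional bounds \<open>N\<close> from below, so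
          \<open>c\<close> may be the reference angle supplied by \<open>key\<close>.\<close>
        have def_le: "1 - N (M x) \<le> K / \<epsilon> ^ 2 * E1"
        proof -
          have "1 - N (M x) \<le> 1 - support_fn c (M x)" using support_fn_le by simp
          also have "\<dots> \<le> (\<integral>y. K / \<epsilon> ^ 2 * (indicator (cball x \<epsilon>) y * (1 - support_fn c (m y))) \<partial>lborel)"
            unfolding deficit
          proof (rule integral_mono)
            show "integrable lborel (\<lambda>y. k (x - y) * (1 - support_fn c (m y)))"
              using ki[of x] ksf[of x c] by (simp add: right_diff_distrib)
            show "k (x - y) * (1 - support_fn c (m y)) \<le> K / \<epsilon> ^ 2 * (indicator (cball x \<epsilon>) y * (1 - support_fn c (m y)))" for y
            proof (cases "y \<in> cball x \<epsilon>")
              case True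
              then show ?thesis
                using mult_right_mono[OF kle[of "x - y"], of "1 - support_fn c (m y)"] sfb[of c y] by (simp add: abs_le_iff)
            next
              case False
              then show ?thesis using k0[OF False] by simp
            qed
          qed (rule integrable_mult_right[OF E1i])
          finally show ?thesis by (simp add: E1_def)
        qed
        \<comment> \<open>Subtracting the constant \<gamma> c is free because the derivative of the
          kernel has integral 0.\<close>
        have M1_le: "norm (M1 v x) \<le> K / \<epsilon> ^ 3 * E2" if v: "norm v = 1" for v
        proof -
          have i1: "integrable lborel (\<lambda>y. d v (x - y) *\<^sub>R (m y - \<gamma> c))" by (rule dint[of _ "R + R"]) (use bm in simp_all)
          have "M1 v x = (\<integral>y. d v (x - y) *\<^sub>R (m y - \<gamma> c) \<partial>lborel)"
            using dint[of m R v x, OF _ mR] di[of v x] d1x[of v x] by (simp add: M1_def scaleR_diff_right)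
          then have "norm (M1 v x) \<le> (\<integral>y. norm (d v (x - y) *\<^sub>R (m y - \<gamma> c)) \<partial>lborel)"
            by (metis integral_norm_bound)
          also have "\<dots> \<le> (\<integral>y. K / \<epsilon> ^ 3 * (indicator (cball x \<epsilon>) y * norm (m y - \<gamma> c)) \<partial>lborel)"
          proof (rule integral_mono)
            show "norm (d v (x - y) *\<^sub>R (m y - \<gamma> c)) \<le> K / \<epsilon> ^ 3 * (indicator (cball x \<epsilon>) y * norm (m y - \<gamma> c))" for y
            proof (cases "y \<in> cball x \<epsilon>")
              case True
              then show ?thesis
                using mult_right_mono[OF dkle[of "x - y" v] norm_ge_zero[of "m y - \<gamma> c"]] v by (simp add: d_def)
            next
              case False
              then show ?thesis using d0[OF False] by simp
            qed
          qed (rule integrable_norm[OF i1] integrable_mult_right[OF E2i])+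
          finally show ?thesis by (simp add: E2_def)
        qed
        \<comment> \<open>Test the equation with the reflected kernel y -> k (x - y), whose support
          lies in the ball and hence in \<Omega>. The sign from the reflection is harmless.\<close>
        have div0: "Re (M1 1 x) + Im (M1 \<i> x) = 0"
        proof -
          define \<phi> where "\<phi> y = k (x - y)" for y
          have sm: "smooth_R2 \<phi>"
            using smooth_R2_scaled_affine[OF k(1), of 1 "- 1" x] by (simp add: \<phi>_def[abs_def])
          have "{y. \<phi> y \<noteq> 0} \<subseteq> cball x \<epsilon>" unfolding \<phi>_def using k0[of _ x] by blast
          then have c: "closure {y. \<phi> y \<noteq> 0} \<subseteq> cball x \<epsilon>" by (intro closure_minimal) auto
          then have "compact (closure {y. \<phi> y \<noteq> 0})"
            using bounded_subset[OF bounded_cball c] by (simp add: compact_eq_bounded_closed)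
          then have "test_fn \<Omega> \<phi>" using sm c sub by (auto simp: test_fn_def)
          then have 0: "(LINT y|lebesgue. frechet_derivative \<phi> (at y) (m y)) = 0"
            using dz by (simp add: div_zero_def m_def)
          have fd: "frechet_derivative \<phi> (at y) v = - (Re v * d 1 (x - y) + Im v * d \<i> (x - y))" for y v
          proof -
            have "(\<phi> has_derivative (\<lambda>v. frechet_derivative k (at (x - y)) (- v))) (at y)"
              unfolding \<phi>_def
              by (rule has_derivative_compose[of "\<lambda>y. x - y" "\<lambda>v. - v" y UNIV k])
                 (auto intro!: derivative_eq_intros smooth_R2_D(1)[OF k(1)])
            from frechet_derivative_at[OF this, symmetric] show ?thesis
              using frechet_derivative_Re_Im[OF kd, of "x - y" "- v"] by (simp add: d_def)
          qed
          have "(\<integral>y. - (Re (m y) * d 1 (x - y) + Im (m y) * d \<i> (x - y)) \<partial>lborel) = 0"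
            using 0 unfolding fd by (subst (asm) integral_completion) auto
          then have 1: "(\<integral>y. Re (d 1 (x - y) *\<^sub>R m y) + Im (d \<i> (x - y) *\<^sub>R m y) \<partial>lborel) = 0"
            unfolding Bochner_Integration.integral_minus by (simp add: mult.commute)
          have i: "integrable lborel (\<lambda>y. d v (x - y) *\<^sub>R m y)" for v by (rule dint[of m R v x, OF _ mR]) measurable
          show ?thesis
            using 1 integral_bounded_linear[OF bounded_linear_Re i[of 1]] integral_bounded_linear[OF bounded_linear_Im i[of \<i>]]
              Bochner_Integration.integral_add[OF integrable_bounded_linear[OF bounded_linear_Re i[of 1]] integrable_bounded_linear[OF bounded_linear_Im i[of \<i>]]]
            by (simp add: M1_def)
        qed
        define w where "w = M x"
        have DF1: "DF x 1 = D w (M1 1 x)" "DF x \<i> = D w (M1 \<i> x)" by (simp_all add: DF_def w_def)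
        \<comment> \<open>Adding and subtracting l times the divergence of the mollified field,
          which is 0, leaves only the part of the differential that is controlled by the
          deficit.\<close>
        have "f x = Re (D w (M1 1 x) - l w *\<^sub>R M1 1 x) + Im (D w (M1 \<i> x) - l w *\<^sub>R M1 \<i> x)
            + l w * (Re (M1 1 x) + Im (M1 \<i> x))"
          by (simp add: f_def DF1 algebra_simps)
        then have "f x = Re (D w (M1 1 x) - l w *\<^sub>R M1 1 x) + Im (D w (M1 \<i> x) - l w *\<^sub>R M1 \<i> x)"
          by (simp only: div0 mult_zero_right add_0_right)
        then have "\<bar>f x\<bar> \<le> norm (D w (M1 1 x) - l w *\<^sub>R M1 1 x) + norm (D w (M1 \<i> x) - l w *\<^sub>R M1 \<i> x)"
          using abs_Re_le_cmod[of "D w (M1 1 x) - l w *\<^sub>R M1 1 x"] abs_Im_le_cmod[of "D w (M1 \<i> x) - l w *\<^sub>R M1 \<i> x"]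
          by linarith
        also have "\<dots> \<le> C0 * (1 - N w) * norm (M1 1 x) + C0 * (1 - N w) * norm (M1 \<i> x)"
          using Dl[OF NM[of x]] by (intro add_mono) (simp_all add: w_def)
        also have "\<dots> \<le> C0 * (K / \<epsilon> ^ 2 * E1) * (K / \<epsilon> ^ 3 * E2) + C0 * (K / \<epsilon> ^ 2 * E1) * (K / \<epsilon> ^ 3 * E2)"
        proof (intro add_mono mult_mono mult_left_mono M1_le)
          show "1 - N w \<le> K / \<epsilon> ^ 2 * E1" "1 - N w \<le> K / \<epsilon> ^ 2 * E1" using def_le by (simp_all add: w_def)
        qed (use C0 K e E10 NM[of x] in \<open>auto simp: w_def\<close>)
        also have "\<dots> = (2 * C0 * K ^ 2) / \<epsilon> ^ 5 * (E1 * E2)"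
          using e by (simp add: power2_eq_square power3_eq_cube eval_nat_numeral)
        finally have "ennreal \<bar>f x\<bar> \<le> ennreal ((2 * C0 * K ^ 2) / \<epsilon> ^ 5) * ennreal (E1 * E2)"
          using C0 e E10 by (simp add: ennreal_leI flip: ennreal_mult)
        also have "\<dots> \<le> ennreal ((2 * C0 * K ^ 2) / \<epsilon> ^ 5) * (ennreal C1 * ?I)"
          by (rule mult_left_mono[OF E]) simp
        also have "\<dots> = ennreal ((2 * C0 * K ^ 2) / \<epsilon> ^ 5 * C1) * ?I"
        proof -
          have "0 \<le> 2 * C0 * K ^ 2 / \<epsilon> ^ 5" using C0 e by simp
          from ennreal_mult[OF this C1] show ?thesis by (simp only: mult.assoc)
        qed
        also have "\<dots> \<le> ennreal (C / \<epsilon> ^ 5) * ?I"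
          using C0 e C1 K by (intro mult_right_mono ennreal_leI) (auto simp: C_def divide_right_mono)
        finally show ?thesis .
      qed
    qed
  qed
qed

end

section \<open>Entropy productions as measures\<close>

lemma nn_integral_lborel_translate:
  fixes f :: "complex \<Rightarrow> ennreal"
  assumes "f \<in> borel_measurable borel"
  shows "(\<integral>\<^sup>+y. f y \<partial>lborel) = (\<integral>\<^sup>+h. f (z + h) \<partial>lborel)"
  using nn_integral_distr[of "(+) z" lborel borel f] assms by (simp add: lborel_distr_plus)

text \<open>Substituting y = z + h and exchanging the integrals brings in the bound on translates:
  each |h| \<le> r contributes at most L r, and such \<open>h\<close> fill an area pi r^2.\<close>

lemma nn_integral_near_diagonal:
  fixes g :: "complex \<Rightarrow> complex \<Rightarrow> ennreal"
  assumes [measurable]: "(\<lambda>p. g (fst p) (snd p)) \<in> borel_measurable (borel \<Otimes>\<^sub>M borel)" "A \<in> sets borel"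
    and L: "\<And>h. norm h \<le> r \<Longrightarrow> (\<integral>\<^sup>+x\<in>A. g (x + h) x \<partial>lborel) \<le> ennreal (L * norm h)"
    and r: "0 \<le> r" "0 \<le> L"
  shows "(\<integral>\<^sup>+z\<in>A. (\<integral>\<^sup>+y\<in>cball z r. g y z \<partial>lborel) \<partial>lborel) \<le> ennreal (L * r * (pi * r ^ 2))"
proof -
  have gm[measurable]: "(\<lambda>x. g (u x) (v x)) \<in> borel_measurable M"
    if [measurable]: "u \<in> borel_measurable M" "v \<in> borel_measurable M" for u v and M :: "'z measure"
    using measurable_compose[of "\<lambda>x. (u x, v x)" M "borel \<Otimes>\<^sub>M borel" "\<lambda>p. g (fst p) (snd p)"] by simp
  have [measurable]: "Measurable.pred borel (\<lambda>h. h \<in> cball (z::complex) r)" for z by simp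
  have [measurable]: "Measurable.pred borel (\<lambda>x. x \<in> A)" by simp
  have "(\<integral>\<^sup>+z\<in>A. (\<integral>\<^sup>+y\<in>cball z r. g y z \<partial>lborel) \<partial>lborel)
      = (\<integral>\<^sup>+z. (\<integral>\<^sup>+h. g (z + h) z * indicator (cball 0 r) h * indicator A z \<partial>lborel) \<partial>lborel)"
  proof (rule nn_integral_cong)
    fix z
    have "(\<integral>\<^sup>+y\<in>cball z r. g y z \<partial>lborel) = (\<integral>\<^sup>+h. g (z + h) z * indicator (cball z r) (z + h) \<partial>lborel)"
      by (rule nn_integral_lborel_translate) measurable
    also have "\<dots> = (\<integral>\<^sup>+h. g (z + h) z * indicator (cball 0 r) h \<partial>lborel)"
      by (simp add: indicator_def dist_norm)
    finally show "(\<integral>\<^sup>+y\<in>cball z r. g y z \<partial>lborel) * indicator A z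
        = (\<integral>\<^sup>+h. g (z + h) z * indicator (cball 0 r) h * indicator A z \<partial>lborel)"
      by (simp add: nn_integral_multc)
  qed
  also have "\<dots> = (\<integral>\<^sup>+h. (\<integral>\<^sup>+z. g (z + h) z * indicator (cball 0 r) h * indicator A z \<partial>lborel) \<partial>lborel)"
    by (rule lborel_pair.Fubini') (simp only: split_beta', measurable)
  also have "\<dots> \<le> (\<integral>\<^sup>+h. ennreal (L * r) * indicator (cball 0 r) h \<partial>(lborel :: complex measure))"
  proof (rule nn_integral_mono)
    fix h :: complex
    show "(\<integral>\<^sup>+z. g (z + h) z * indicator (cball 0 r) h * indicator A z \<partial>lborel) \<le> ennreal (L * r) * indicator (cball 0 r) h"
    proof (cases "norm h \<le> r")
      case True
      have "(\<integral>\<^sup>+z. g (z + h) z * indicator (cball 0 r) h * indicator A z \<partial>lborel) = (\<integral>\<^sup>+x\<in>A. g (x + h) x \<partial>lborel)"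
        using True by simp
      also have "\<dots> \<le> ennreal (L * norm h)" by (rule L[OF True])
      also have "\<dots> \<le> ennreal (L * r)" using True r by (intro ennreal_leI mult_left_mono) auto
      finally show ?thesis using True by simp
    qed simp
  qed
  also have "\<dots> = ennreal (L * r) * ennreal (pi * r ^ 2)"
    using r by (simp add: nn_integral_cmult_indicator measure_cball_complex)
  also have "\<dots> = ennreal (L * r * (pi * r ^ 2))" using r by (simp add: ennreal_mult)
  finally show ?thesis .
qed

text \<open>Two points of a ball of radius r are at distance at most 2r, and a given pair is counted
  for centres of total area at most pi r^2. The previous estimate at radius 2r yields (L 2r) (4 pi
  r^2) (pi r^2), which is the constant.\<close>

lemma nn_integral_pairs_in_ball:
  fixes g :: "complex \<Rightarrow> complex \<Rightarrow> ennreal"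
  assumes gm0[measurable]: "(\<lambda>p. g (fst p) (snd p)) \<in> borel_measurable (borel \<Otimes>\<^sub>M borel)" and [measurable]: "A \<in> sets borel"
    and L: "\<And>h. norm h \<le> 2 * r \<Longrightarrow> (\<integral>\<^sup>+x\<in>A. g (x + h) x \<partial>lborel) \<le> ennreal (L * norm h)"
    and r: "0 \<le> r" "0 \<le> L" and K: "\<And>x. x \<in> K \<Longrightarrow> cball x r \<subseteq> A"
  shows "(\<integral>\<^sup>+x\<in>K. (\<integral>\<^sup>+y\<in>cball x r. (\<integral>\<^sup>+z\<in>cball x r. g y z \<partial>lborel) \<partial>lborel) \<partial>lborel)
     \<le> ennreal (8 * pi ^ 2 * L * r ^ 5)"
proof -
  have gm[measurable]: "(\<lambda>x. g (u x) (v x)) \<in> borel_measurable M"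
    if [measurable]: "u \<in> borel_measurable M" "v \<in> borel_measurable M" for u v and M :: "'z measure"
    using measurable_compose[of "\<lambda>x. (u x, v x)" M "borel \<Otimes>\<^sub>M borel" "\<lambda>p. g (fst p) (snd p)"] by simp
  have [measurable]: "Measurable.pred borel (\<lambda>x. x \<in> A)" by simp
  have bm[measurable]: "Measurable.pred borel (\<lambda>h. h \<in> cball (x::complex) s)" for x s by simp
  define H where "H z = (\<integral>\<^sup>+y\<in>cball z (2 * r). g y z \<partial>lborel) * indicator A z" for z
  have Hm[measurable]: "H \<in> borel_measurable borel"
    unfolding H_def mem_cball indicator_def by measurable
  have le: "(\<integral>\<^sup>+y\<in>cball x r. (\<integral>\<^sup>+z\<in>cball x r. g y z \<partial>lborel) \<partial>lborel) \<le> (\<integral>\<^sup>+z\<in>cball x r. H z \<partial>lborel)"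
    if x: "x \<in> K" for x
  proof -
    have "(\<integral>\<^sup>+y\<in>cball x r. (\<integral>\<^sup>+z\<in>cball x r. g y z \<partial>lborel) \<partial>lborel)
        = (\<integral>\<^sup>+y. (\<integral>\<^sup>+z. g y z * indicator (cball x r) z * indicator (cball x r) y \<partial>lborel) \<partial>lborel)"
      by (intro nn_integral_cong nn_integral_multc[symmetric]) measurable
    also have "\<dots> = (\<integral>\<^sup>+z. (\<integral>\<^sup>+y. g y z * indicator (cball x r) z * indicator (cball x r) y \<partial>lborel) \<partial>lborel)"
      by (rule lborel_pair.Fubini') (simp only: split_beta', measurable)
    also have "\<dots> \<le> (\<integral>\<^sup>+z\<in>cball x r. H z \<partial>lborel)"
    proof (rule nn_integral_mono)
      fix z
      show "(\<integral>\<^sup>+y. g y z * indicator (cball x r) z * indicator (cball x r) y \<partial>lborel) \<le> H z * indicator (cball x r) z"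
      proof (cases "z \<in> cball x r")
        case True
        have "dist z y \<le> 2 * r" if "dist x y \<le> r" for y
          using dist_triangle[of z y x] True that by (simp add: dist_commute)
        then have "(\<integral>\<^sup>+y. g y z * indicator (cball x r) z * indicator (cball x r) y \<partial>lborel) \<le> (\<integral>\<^sup>+y\<in>cball z (2 * r). g y z \<partial>lborel)"
          by (intro nn_integral_mono) (auto simp: indicator_def)
        moreover have "z \<in> A" using K[OF x] True by blast
        ultimately show ?thesis using True by (simp add: H_def)
      qed simp
    qed
    finally show ?thesis .
  qed
  have "(\<integral>\<^sup>+x\<in>K. (\<integral>\<^sup>+y\<in>cball x r. (\<integral>\<^sup>+z\<in>cball x r. g y z \<partial>lborel) \<partial>lborel) \<partial>lborel)
      \<le> (\<integral>\<^sup>+x. (\<integral>\<^sup>+z. H z * indicator (cball x r) z \<partial>lborel) \<partial>lborel)"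
    using le by (intro nn_integral_mono) (auto simp: indicator_def)
  also have "\<dots> = (\<integral>\<^sup>+z. (\<integral>\<^sup>+x. H z * indicator (cball x r) z \<partial>lborel) \<partial>lborel)"
    by (rule lborel_pair.Fubini') (simp only: split_beta' mem_cball indicator_def, measurable)
  also have "\<dots> = (\<integral>\<^sup>+z. ennreal (pi * r ^ 2) * H z \<partial>lborel)"
  proof (rule nn_integral_cong)
    fix z
    have "(\<integral>\<^sup>+x. H z * indicator (cball x r) z \<partial>lborel) = (\<integral>\<^sup>+x. H z * indicator (cball z r) x \<partial>lborel)"
      by (simp add: indicator_def dist_commute)
    then show "(\<integral>\<^sup>+x. H z * indicator (cball x r) z \<partial>lborel) = ennreal (pi * r ^ 2) * H z"
      using r by (simp add: nn_integral_cmult_indicator measure_cball_complex mult.commute)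
  qed
  also have "\<dots> = ennreal (pi * r ^ 2) * (\<integral>\<^sup>+z. H z \<partial>lborel)" by (rule nn_integral_cmult) measurable
  also have "\<dots> \<le> ennreal (pi * r ^ 2) * ennreal (L * (2 * r) * (pi * (2 * r) ^ 2))"
    unfolding H_def using r by (intro mult_left_mono nn_integral_near_diagonal[OF gm0 _ L]) auto
  also have "\<dots> = ennreal (8 * pi ^ 2 * L * r ^ 5)"
    using r by (simp add: ennreal_mult[symmetric] power_mult_distrib) (simp add: eval_nat_numeral mult_ac)
  finally show ?thesis .
qed

text \<open>The margin 2 \<delta> matches the diameter of the balls around points of
  \<open>K\<close>: translations by less than 2 \<delta> keep \<open>A\<close> inside
  \<Omega>.\<close>

lemma compact_neighbourhood:
  fixes K :: "complex set"
  assumes "compact K" "K \<subseteq> \<Omega>" "open \<Omega>" "K \<noteq> {}"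
  obtains \<delta> A where "0 < \<delta>" "open A" "compact (closure A)" "closure A \<subseteq> \<Omega>"
    "\<And>x. x \<in> K \<Longrightarrow> cball x \<delta> \<subseteq> A" "\<And>x y. \<lbrakk>x \<in> A; y \<notin> \<Omega>\<rbrakk> \<Longrightarrow> 2 * \<delta> \<le> dist x y"
proof -
  obtain d where d: "d > 0" "\<And>x y. \<lbrakk>x \<in> K; y \<notin> \<Omega>\<rbrakk> \<Longrightarrow> d \<le> dist x y"
  proof -
    have "K \<inter> - \<Omega> = {}" using assms(2) by blast
    from separate_compact_closed[OF assms(1) closed_Compl[OF assms(3)] this] show ?thesis
      using that by (metis ComplI)
  qed
  \<comment> \<open>Half of the distance \<open>d\<close> is spent on the 2 \<delta>-neighbourhood
    \<open>A\<close>, the other half remains as margin.\<close>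
  define \<delta> where "\<delta> = d / 4"
  have \<delta>: "0 < \<delta>" "d = 4 * \<delta>" using d by (auto simp: \<delta>_def)
  define A where "A = {x. infdist x K < 2 * \<delta>}"
  have near: "\<exists>k\<in>K. infdist x K = dist x k" for x
    using infdist_attains_inf[OF compact_imp_closed[OF assms(1)] assms(4), of x] by metis
  have cl: "closure A \<subseteq> {x. infdist x K \<le> 2 * \<delta>}"
    by (rule closure_minimal) (auto simp: A_def intro!: closed_Collect_le continuous_intros)
  have sub: "{x. infdist x K \<le> 2 * \<delta>} \<subseteq> \<Omega>"
  proof
    fix x assume "x \<in> {x. infdist x K \<le> 2 * \<delta>}"
    then obtain k where "k \<in> K" "dist x k \<le> 2 * \<delta>" using near[of x] by auto
    then show "x \<in> \<Omega>" using d(2)[of k x] \<delta> by (auto simp: dist_commute)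
  qed
  show thesis
  proof (rule that[of \<delta> A])
    show "open A" unfolding A_def by (intro open_Collect_less continuous_intros)
    obtain R where R: "\<And>k. k \<in> K \<Longrightarrow> norm k \<le> R" using compact_imp_bounded[OF assms(1)] unfolding bounded_iff by auto
    have "bounded A"
    proof (rule boundedI)
      fix x assume "x \<in> A"
      then obtain k where k: "k \<in> K" "dist x k < 2 * \<delta>" using near[of x] by (auto simp: A_def)
      then show "norm x \<le> R + 2 * \<delta>"
        using norm_triangle_sub[of x k] R[OF k(1)] by (simp add: dist_norm)
    qed
    then show "compact (closure A)" by (simp add: compact_closure)
    show "closure A \<subseteq> \<Omega>" using cl sub by blast
    show "cball x \<delta> \<subseteq> A" if "x \<in> K" for x
    proof
      fix y assume "y \<in> cball x \<delta>"
      then have "infdist y K \<le> \<delta>" using infdist_le2[OF that, of y \<delta>] by (simp add: dist_commute)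
      then show "y \<in> A" using \<delta> by (simp add: A_def)
    qed
    show "2 * \<delta> \<le> dist x y" if "x \<in> A" "y \<notin> \<Omega>" for x y
    proof -
      obtain k where k: "k \<in> K" "infdist x K = dist x k" using near[of x] by blast
      moreover have "infdist x K < 2 * \<delta>" using that(1) by (simp add: A_def)
      ultimately have k: "k \<in> K" "dist x k < 2 * \<delta>" by simp_all
      show ?thesis using d(2)[OF k(1) that(2)] k(2) \<delta> dist_triangle[of k y x] by (simp add: dist_commute)
    qed
  qed (use \<delta> in simp)
qed

context unit_curve
begin

section \<open>The limit of small mollification scale\<close>

lemma Phi_gamma_bounded:
  assumes "ENT \<gamma> \<Phi>"
  obtains B where "\<And>t. norm (\<Phi> (\<gamma> t)) \<le> B"
proof -
  have "range \<gamma> \<subseteq> \<gamma> ` {0..2 * pi}"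
  proof
    fix z assume "z \<in> range \<gamma>"
    then obtain t where t: "z = \<gamma> t" by blast
    obtain k where "t + 2 * pi * of_int k \<in> {0..<2 * pi}" by (rule reduce_mod_2pi)
    then show "z \<in> \<gamma> ` {0..2 * pi}"
      using gamma_periodic_int[of t k] t by (intro image_eqI[of _ _ "t + 2 * pi * of_int k"]) auto
  qed
  then have "range \<gamma> = \<gamma> ` {0..2 * pi}" by blast
  then have "compact (range \<gamma>)" using compact_continuous_image[OF gamma_continuous compact_Icc] by metis
  then have "bounded (\<Phi> ` range \<gamma>)"
    using assms by (intro compact_imp_bounded compact_continuous_image[of "range \<gamma>" \<Phi>]) (simp_all add: ENT_def)
  then show thesis using that unfolding bounded_iff by auto
qed

text \<open>Points with lifts closer than \<eta> are covered by the first term; for the others the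
  cost is bounded below while the distance is at most 2 pi. The cost bound can thereby replace
  continuity of translations when the regularized fields are shown to converge.\<close>

lemma gamma_diff_le_circle_cost:
  assumes "\<kappa> > 0" "0 < \<eta>"
  obtains c where "0 \<le> c" "\<And>a b. norm (\<gamma> a - \<gamma> b) \<le> \<eta> + c * circle_cost \<kappa> a b"
proof -
  obtain \<kappa>' where \<kappa>': "\<kappa>' > 0" "\<And>a b. (\<exists>k. \<bar>a - (b + 2 * pi * of_int k)\<bar> < \<eta>) \<or> \<kappa>' \<le> circle_cost \<kappa> a b"
    by (rule circle_cost_dichotomy[OF assms]) (rule that)
  show thesis
  proof (rule that[of "2 * pi / \<kappa>'"])
    show "0 \<le> 2 * pi / \<kappa>'" using \<kappa>' by simp
    fix a b
    have cc: "0 \<le> circle_cost \<kappa> a b" using assms by (intro circle_cost_nonneg) simp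
    consider k where "\<bar>a - (b + 2 * pi * of_int k)\<bar> < \<eta>" | "\<kappa>' \<le> circle_cost \<kappa> a b" using \<kappa>'(2) by blast
    then show "norm (\<gamma> a - \<gamma> b) \<le> \<eta> + 2 * pi / \<kappa>' * circle_cost \<kappa> a b"
    proof cases
      case 1
      have "norm (\<gamma> a - \<gamma> b) \<le> \<eta>"
        using norm_gamma_diff_le[of a "b + 2 * pi * of_int k"] 1 by (simp add: gamma_periodic_int)
      moreover have "0 \<le> 2 * pi / \<kappa>' * circle_cost \<kappa> a b" using \<kappa>'(1) cc by simp
      ultimately show ?thesis by linarith
    next
      case 2
      have "2 * pi \<le> 2 * pi / \<kappa>' * circle_cost \<kappa> a b" using 2 \<kappa>'(1) by (simp add: field_simps)
      then show ?thesis using norm_gamma_diff_le_2pi[of a b] assms(2) by linarith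
    qed
  qed
qed

text \<open>The cost bound is used twice. It bounds the densities in L^1 on compact sets, since
  \<epsilon>^-5 meets \<epsilon>^5, so that they have weak limits. It also shows that the
  regularized fields converge to the entropy of the original field when tested with a gradient,
  which identifies the limit.\<close>

lemma entropy_production_is_measure:
  assumes \<Omega>: "open \<Omega>" "bounded \<Omega>" and T[measurable]: "T \<in> borel_measurable borel"
    and dz: "div_zero \<Omega> (\<lambda>x. \<gamma> (T x))" and \<kappa>: "\<kappa> > 0"
    and tb: "\<And>K. \<lbrakk>compact K; K \<subseteq> \<Omega>; K \<noteq> {}\<rbrakk> \<Longrightarrow> \<exists>\<delta> A L. 0 < \<delta> \<and> 0 \<le> L \<and> A \<in> sets borel \<and> A \<subseteq> \<Omega> \<and>
      (\<forall>x\<in>K. cball x \<delta> \<subseteq> A) \<and>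
      (\<forall>h. norm h < 2 * \<delta> \<longrightarrow> (\<integral>\<^sup>+x\<in>A. ennreal (circle_cost \<kappa> (T (x + h)) (T x)) \<partial>lborel) \<le> ennreal (L * norm h))"
    and \<Phi>: "ENT \<gamma> \<Phi>"
  obtains \<mu>1 \<mu>2 :: "complex measure" where "sets \<mu>1 = sets borel" "sets \<mu>2 = sets borel"
    "emeasure \<mu>1 (UNIV - \<Omega>) = 0" "emeasure \<mu>2 (UNIV - \<Omega>) = 0"
    "\<And>K. \<lbrakk>compact K; K \<subseteq> \<Omega>\<rbrakk> \<Longrightarrow> emeasure \<mu>1 K < \<infinity> \<and> emeasure \<mu>2 K < \<infinity>"
    "\<And>\<phi>. test_fn \<Omega> \<phi> \<Longrightarrow> (\<integral>x. frechet_derivative \<phi> (at x) (\<Phi> (\<gamma> (T x))) \<partial>lborel)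
       = - ((\<integral>x. \<phi> x \<partial>\<mu>1) - (\<integral>x. \<phi> x \<partial>\<mu>2))"
proof -
  obtain C where C: "C \<ge> 0" and reg: "\<And>T \<Omega> \<epsilon>. \<lbrakk>T \<in> borel_measurable borel; div_zero \<Omega> (\<lambda>x. \<gamma> (T x)); 0 < \<epsilon>\<rbrakk> \<Longrightarrow>
      \<exists>F f. continuous_on UNIV F \<and> f \<in> borel_measurable borel \<and> (\<exists>K. \<forall>x. \<bar>f x\<bar> \<le> K) \<and>
        (\<forall>\<phi>. test_fn \<Omega> \<phi> \<longrightarrow> (\<integral>x. frechet_derivative \<phi> (at x) (F x) \<partial>lborel) = - (\<integral>x. \<phi> x * f x \<partial>lborel)) \<and>
        (\<forall>x. norm (F x - \<Phi> (\<gamma> (T x))) \<le> C / \<epsilon> ^ 2 * (\<integral>y. indicator (cball x \<epsilon>) y * norm (\<gamma> (T y) - \<gamma> (T x)) \<partial>lborel)) \<and>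
        (\<forall>x. cball x \<epsilon> \<subseteq> \<Omega> \<longrightarrow> ennreal \<bar>f x\<bar> \<le> ennreal (C / \<epsilon> ^ 5) *
           (\<integral>\<^sup>+y\<in>cball x \<epsilon>. (\<integral>\<^sup>+z\<in>cball x \<epsilon>. ennreal (circle_cost \<kappa> (T y) (T z)) \<partial>lborel) \<partial>lborel))"
    by (rule entropy_regularization[OF \<kappa> \<Phi>]) (rule that)
  define \<epsilon> where "\<epsilon> n = inverse (real (Suc n))" for n
  have \<epsilon>: "0 < \<epsilon> n" for n by (simp add: \<epsilon>_def)
  have \<epsilon>0: "\<epsilon> \<longlonglongrightarrow> 0" unfolding \<epsilon>_def by (rule LIMSEQ_inverse_real_of_nat)
  define Q where "Q n F f \<longleftrightarrow> continuous_on UNIV F \<and> f \<in> borel_measurable borel \<and> (\<exists>K. \<forall>x. \<bar>f x\<bar> \<le> K) \<and>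
        (\<forall>\<phi>. test_fn \<Omega> \<phi> \<longrightarrow> (\<integral>x. frechet_derivative \<phi> (at x) (F x) \<partial>lborel) = - (\<integral>x. \<phi> x * f x \<partial>lborel)) \<and>
        (\<forall>x. norm (F x - \<Phi> (\<gamma> (T x))) \<le> C / \<epsilon> n ^ 2 * (\<integral>y. indicator (cball x (\<epsilon> n)) y * norm (\<gamma> (T y) - \<gamma> (T x)) \<partial>lborel)) \<and>
        (\<forall>x. cball x (\<epsilon> n) \<subseteq> \<Omega> \<longrightarrow> ennreal \<bar>f x\<bar> \<le> ennreal (C / \<epsilon> n ^ 5) *
           (\<integral>\<^sup>+y\<in>cball x (\<epsilon> n). (\<integral>\<^sup>+z\<in>cball x (\<epsilon> n). ennreal (circle_cost \<kappa> (T y) (T z)) \<partial>lborel) \<partial>lborel))"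
    for n and F :: "complex \<Rightarrow> complex" and f :: "complex \<Rightarrow> real"
  have "\<forall>n. \<exists>F f. Q n F f" using reg[OF T dz \<epsilon>] unfolding Q_def by blast
  then obtain F f where Q: "\<And>n. Q n (F n) (f n)" by metis
  have Fc: "continuous_on UNIV (F n)" and fm[measurable]: "f n \<in> borel_measurable borel" and fb: "\<exists>K. \<forall>x. \<bar>f n x\<bar> \<le> K"
    and parts: "test_fn \<Omega> \<phi> \<Longrightarrow> (\<integral>x. frechet_derivative \<phi> (at x) (F n x) \<partial>lborel) = - (\<integral>x. \<phi> x * f n x \<partial>lborel)"
    and Fclose: "norm (F n x - \<Phi> (\<gamma> (T x))) \<le> C / \<epsilon> n ^ 2 * (\<integral>y. indicator (cball x (\<epsilon> n)) y * norm (\<gamma> (T y) - \<gamma> (T x)) \<partial>lborel)"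
    and fle: "cball x (\<epsilon> n) \<subseteq> \<Omega> \<Longrightarrow> ennreal \<bar>f n x\<bar> \<le> ennreal (C / \<epsilon> n ^ 5) *
           (\<integral>\<^sup>+y\<in>cball x (\<epsilon> n). (\<integral>\<^sup>+z\<in>cball x (\<epsilon> n). ennreal (circle_cost \<kappa> (T y) (T z)) \<partial>lborel) \<partial>lborel)" for n \<phi> x
    using Q[of n] unfolding Q_def by blast+
  have ccm[measurable]: "(\<lambda>p. ennreal (circle_cost \<kappa> (T (fst p)) (T (snd p)))) \<in> borel_measurable (borel \<Otimes>\<^sub>M borel)"
    by measurable
  have bnd: "\<exists>B. \<forall>n. (\<integral>\<^sup>+x\<in>K. ennreal \<bar>f n x\<bar> \<partial>lborel) \<le> ennreal B" if K: "compact K" "K \<subseteq> \<Omega>" for K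
  proof (cases "K = {}")
    case True
    then show ?thesis by auto
  next
    case False
    have [measurable]: "K \<in> sets borel" using K(1) by (simp add: borel_compact)
    obtain \<delta> A L where "0 < \<delta>" "0 \<le> L" and [measurable]: "A \<in> sets borel" and A: "A \<subseteq> \<Omega>"
      and KA: "\<forall>x\<in>K. cball x \<delta> \<subseteq> A"
      and L: "\<forall>h. norm h < 2 * \<delta> \<longrightarrow> (\<integral>\<^sup>+x\<in>A. ennreal (circle_cost \<kappa> (T (x + h)) (T x)) \<partial>lborel) \<le> ennreal (L * norm h)"
      using tb[OF K False] by blast
    \<comment> \<open>The condition \<open>\<epsilon> n < \<delta>\<close> keeps the balls inside
      \<open>A\<close> and all differences of their points below 2 \<delta>.\<close>
    have large: "(\<integral>\<^sup>+x\<in>K. ennreal \<bar>f n x\<bar> \<partial>lborel) \<le> ennreal (C * (8 * pi ^ 2 * L))" if n: "\<epsilon> n < \<delta>" for n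
    proof -
      define I where "I = (\<lambda>x. \<integral>\<^sup>+y\<in>cball x (\<epsilon> n). (\<integral>\<^sup>+z\<in>cball x (\<epsilon> n). ennreal (circle_cost \<kappa> (T y) (T z)) \<partial>lborel) \<partial>lborel)"
      have sub: "cball x (\<epsilon> n) \<subseteq> A" if "x \<in> K" for x
        using KA that n by force
      have [measurable]: "I \<in> borel_measurable borel"
        unfolding I_def mem_cball indicator_def by measurable
      have "(\<integral>\<^sup>+x\<in>K. ennreal \<bar>f n x\<bar> \<partial>lborel) \<le> (\<integral>\<^sup>+x. ennreal (C / \<epsilon> n ^ 5) * (I x * indicator K x) \<partial>lborel)"
      proof (rule nn_integral_mono)
        fix x
        show "ennreal \<bar>f n x\<bar> * indicator K x \<le> ennreal (C / \<epsilon> n ^ 5) * (I x * indicator K x)"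
          using fle[of x n] sub[of x] A by (cases "x \<in> K") (auto simp: I_def)
      qed
      also have "\<dots> = ennreal (C / \<epsilon> n ^ 5) * (\<integral>\<^sup>+x\<in>K. I x \<partial>lborel)"
        by (rule nn_integral_cmult) measurable
      also have "\<dots> \<le> ennreal (C / \<epsilon> n ^ 5) * ennreal (8 * pi ^ 2 * L * \<epsilon> n ^ 5)"
        unfolding I_def using L n \<epsilon>[of n] \<open>0 \<le> L\<close> sub by (intro mult_left_mono nn_integral_pairs_in_ball[OF ccm \<open>A \<in> sets borel\<close>]) auto
      also have "\<dots> = ennreal (C * (8 * pi ^ 2 * L))"
        using C \<epsilon>[of n] \<open>0 \<le> L\<close> by (simp flip: ennreal_mult)
      finally show ?thesis .
    qed
    obtain n0 where n0: "\<And>n. n \<ge> n0 \<Longrightarrow> \<epsilon> n < \<delta>"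
      using order_tendstoD(2)[OF \<epsilon>0 \<open>0 < \<delta>\<close>] by (auto simp: eventually_sequentially)
    obtain k where k: "\<And>n x. \<bar>f n x\<bar> \<le> k n" using fb by metis
    have k0: "0 \<le> k n" for n using order_trans[OF abs_ge_zero k[of n 0]] .
    have mK: "emeasure lborel K < \<infinity>" using compact_imp_bounded[OF K(1)] by (rule emeasure_bounded_finite)
    \<comment> \<open>For the finitely many remaining scales mere boundedness of \<open>f n\<close>
      is enough; the finite sum in \<open>B\<close> accounts for them.\<close>
    have small: "(\<integral>\<^sup>+x\<in>K. ennreal \<bar>f n x\<bar> \<partial>lborel) \<le> ennreal (k n * measure lborel K)" for n
    proof -
      have "(\<integral>\<^sup>+x\<in>K. ennreal \<bar>f n x\<bar> \<partial>lborel) \<le> (\<integral>\<^sup>+x. ennreal (k n) * indicator K x \<partial>lborel)"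
        using k by (intro nn_integral_mono) (auto simp: indicator_def ennreal_leI)
      also have "\<dots> = ennreal (k n) * emeasure lborel K" by (simp add: nn_integral_cmult_indicator)
      also have "\<dots> = ennreal (k n * measure lborel K)"
        using mK k0 by (simp add: emeasure_eq_ennreal_measure ennreal_mult less_top)
      finally show ?thesis .
    qed
    define B where "B = C * (8 * pi ^ 2 * L) + (\<Sum>n<n0. k n * measure lborel K)"
    show ?thesis
    proof (intro exI[of _ B] allI)
      fix n
      show "(\<integral>\<^sup>+x\<in>K. ennreal \<bar>f n x\<bar> \<partial>lborel) \<le> ennreal B"
      proof (cases "n < n0")
        case True
        have "k n * measure lborel K \<le> (\<Sum>n<n0. k n * measure lborel K)"
          using True k0 by (intro member_le_sum) auto
        moreover have "0 \<le> C * (8 * pi ^ 2 * L)" using C \<open>0 \<le> L\<close> by simp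
        ultimately have "k n * measure lborel K \<le> B" unfolding B_def by linarith
        then show ?thesis using small[of n] by (meson ennreal_leI order_trans)
      next
        case False
        have "0 \<le> (\<Sum>n<n0. k n * measure lborel K)" using k0 by (intro sum_nonneg) auto
        then show ?thesis using large[OF n0[of n]] False by (intro order_trans[OF large[OF n0]] ennreal_leI) (auto simp: B_def)
      qed
    qed
  qed
  obtain r \<mu>1 \<mu>2 where r: "strict_mono (r :: nat \<Rightarrow> nat)" and \<mu>: "sets \<mu>1 = sets borel" "sets \<mu>2 = sets borel"
    "emeasure \<mu>1 (UNIV - \<Omega>) = 0" "emeasure \<mu>2 (UNIV - \<Omega>) = 0"
    "\<And>K. \<lbrakk>compact K; K \<subseteq> \<Omega>\<rbrakk> \<Longrightarrow> emeasure \<mu>1 K < \<infinity> \<and> emeasure \<mu>2 K < \<infinity>"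
    and lim: "\<And>\<phi>. \<lbrakk>continuous_on UNIV \<phi>; compact (closure {x. \<phi> x \<noteq> 0}); closure {x. \<phi> x \<noteq> 0} \<subseteq> \<Omega>\<rbrakk> \<Longrightarrow>
       (\<lambda>n. \<integral>x. \<phi> x * f (r n) x \<partial>lborel) \<longlonglongrightarrow> (\<integral>x. \<phi> x \<partial>\<mu>1) - (\<integral>x. \<phi> x \<partial>\<mu>2)"
    by (rule locally_bounded_densities_compact[of \<Omega> f, OF \<Omega> fm]) (erule (1) bnd, rule that)
  have "continuous_on UNIV (\<lambda>t. \<Phi> (\<gamma> t))"
    by (rule continuous_on_compose2[of "range \<gamma>" \<Phi> UNIV \<gamma>])
       (use \<Phi> gamma_continuous[of UNIV] in \<open>simp_all add: ENT_def\<close>)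
  then have Pm[measurable]: "(\<lambda>t. \<Phi> (\<gamma> t)) \<in> borel_measurable borel" by (rule borel_measurable_continuous_onI)
  have conv: "(\<lambda>n. \<integral>x. frechet_derivative \<phi> (at x) (F n x) \<partial>lborel) \<longlonglongrightarrow> (\<integral>x. frechet_derivative \<phi> (at x) (\<Phi> (\<gamma> (T x))) \<partial>lborel)"
    if \<phi>: "test_fn \<Omega> \<phi>" for \<phi>
  proof -
    let ?S = "closure {x. \<phi> x \<noteq> 0}"
    have sm: "smooth_R2 \<phi>" and S: "compact ?S" "?S \<subseteq> \<Omega>" using \<phi> by (auto simp: test_fn_def)
    have [measurable]: "?S \<in> sets borel" by simp
    have z: "\<phi> x = 0" if "x \<notin> ?S" for x using that closure_subset[of "{x. \<phi> x \<noteq> 0}"] by auto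
    obtain B where B: "B \<ge> 0" "\<And>x v. \<bar>frechet_derivative \<phi> (at x) v\<bar> \<le> B * norm v"
      by (rule smooth_compact_support_C2_bounds[OF sm S(1)]) (erule z, rule that)
    show ?thesis
    proof (cases "?S = {}")
      case True
      then have "frechet_derivative \<phi> (at x) = (\<lambda>_. 0)" for x
        by (intro frechet_derivative_eq_0_outside_support) simp
      then show ?thesis by simp
    next
      case False
      obtain \<delta> A L where "0 < \<delta>" "0 \<le> L" and [measurable]: "A \<in> sets borel" and KA: "\<forall>x\<in>?S. cball x \<delta> \<subseteq> A"
        and L: "\<forall>h. norm h < 2 * \<delta> \<longrightarrow> (\<integral>\<^sup>+x\<in>A. ennreal (circle_cost \<kappa> (T (x + h)) (T x)) \<partial>lborel) \<le> ennreal (L * norm h)"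
        using tb[OF S False] by blast
      have SA: "?S \<subseteq> A"
      proof
        fix x assume "x \<in> ?S"
        then have "cball x \<delta> \<subseteq> A" using KA by blast
        then show "x \<in> A" using \<open>0 < \<delta>\<close> by (meson centre_in_cball less_imp_le subsetD)
      qed
      have mS: "emeasure lborel ?S < \<infinity>" using compact_imp_bounded[OF S(1)] by (rule emeasure_bounded_finite)
      define W where "W = measure lborel ?S"
      have W: "0 \<le> W" "emeasure lborel ?S = ennreal W"
        using mS by (auto simp: W_def emeasure_eq_ennreal_measure less_top)
      obtain R where R: "\<And>t. norm (\<Phi> (\<gamma> t)) \<le> R" by (rule Phi_gamma_bounded[OF \<Phi>]) (rule that)
      have R0: "0 \<le> R" using order_trans[OF norm_ge_zero R] .
      define P where "P x = \<Phi> (\<gamma> (T x))" for x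
      have [measurable]: "P \<in> borel_measurable borel"
        unfolding P_def using measurable_compose[OF T Pm] by (simp add: o_def)
      have PR: "norm (P x) \<le> R" for x by (simp add: P_def R)
      let ?d = "\<lambda>v x. frechet_derivative \<phi> (at x) v"
      have dm[measurable]: "?d v \<in> borel_measurable borel" for v
        using smooth_R2_D(2)[OF smooth_R2_D(3)[OF sm]] by (rule borel_measurable_continuous_onI)
      have dRI: "?d v x = Re v * ?d 1 x + Im v * ?d \<i> x" for v x
        using frechet_derivative_Re_Im[of \<phi> x v] smooth_R2_D(1)[OF sm] by (auto simp: differentiable_def)
      have d0: "?d v x = 0" if "x \<notin> ?S" for v x
        using fun_cong[OF frechet_derivative_eq_0_outside_support[OF that]] .
      have lin: "?d (v - w) x = ?d v x - ?d w x" for v w x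
        using linear_diff[OF has_derivative_linear[OF smooth_R2_D(1)[OF sm]]] .
      have Fint: "integrable lborel (\<lambda>x. ?d (F n x) x)" for n
      proof -
        have c: "continuous_on UNIV (\<lambda>x. ?d (F n x) x)"
          by (subst dRI) (intro continuous_intros Fc smooth_R2_D(2) smooth_R2_D(3) sm)
        have "integrable lborel (\<lambda>x. indicator ?S x *\<^sub>R ?d (F n x) x)"
          by (rule borel_integrable_compact[OF S(1) continuous_on_subset[OF c subset_UNIV]])
        moreover have "(\<lambda>x. indicator ?S x *\<^sub>R ?d (F n x) x) = (\<lambda>x. ?d (F n x) x)"
          using d0 by (auto simp: indicator_def fun_eq_iff)
        ultimately show ?thesis by metis
      qed
      have Pint: "integrable lborel (\<lambda>x. ?d (P x) x)"
      proof (rule Bochner_Integration.integrable_bound)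
        show "integrable lborel (\<lambda>x. B * R * indicator ?S x)"
          using mS by (intro integrable_mult_right integrable_real_indicator) auto
        show "(\<lambda>x. ?d (P x) x) \<in> borel_measurable lborel" by (subst dRI) measurable
        show "AE x in lborel. norm (?d (P x) x) \<le> norm (B * R * indicator ?S x)"
        proof (rule AE_I2)
          fix x
          have "\<bar>?d (P x) x\<bar> \<le> B * R" using B(1) by (intro order_trans[OF B(2)] mult_left_mono PR)
          then show "norm (?d (P x) x) \<le> norm (B * R * indicator ?S x)"
            using d0[of x "P x"] B(1) R0 by (cases "x \<in> ?S") auto
        qed
      qed
      define J where "J n = (\<integral>x. ?d (F n x) x \<partial>lborel) - (\<integral>x. ?d (P x) x \<partial>lborel)" for n
      \<comment> \<open>The mean oscillation over the ball splits into \<eta> times its area and a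
        cost part. The latter integrates to order \<epsilon>^3 near the diagonal; after division by
        \<epsilon>^2 one factor \<epsilon> remains.\<close>
      have Jle: "\<bar>J n\<bar> \<le> B * C * pi * (W * \<eta> + c * L * \<epsilon> n)"
        if \<eta>: "0 < \<eta>" and c: "0 \<le> c" "\<And>a b. norm (\<gamma> a - \<gamma> b) \<le> \<eta> + c * circle_cost \<kappa> a b" and n: "\<epsilon> n < 2 * \<delta>" for n \<eta> c
      proof -
        have [measurable]: "F n \<in> borel_measurable borel" using Fc by (rule borel_measurable_continuous_onI)
        have Jn: "J n = (\<integral>x. ?d (F n x - P x) x \<partial>lborel)"
          unfolding J_def lin by (rule Bochner_Integration.integral_diff[OF Fint Pint, symmetric])
        have e: "0 < \<epsilon> n" by (rule \<epsilon>)
        let ?g = "\<lambda>y x. norm (\<gamma> (T y) - \<gamma> (T x))"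
        have cc0: "0 \<le> circle_cost \<kappa> a b" for a b using \<kappa> by (intro circle_cost_nonneg) simp
        have [measurable]: "Measurable.pred borel (\<lambda>y. y \<in> cball x (\<epsilon> n))" for x :: complex by simp
        have inner: "ennreal (\<integral>y. indicator (cball x (\<epsilon> n)) y * ?g y x \<partial>lborel)
           \<le> ennreal (\<eta> * (pi * \<epsilon> n ^ 2)) + ennreal c * (\<integral>\<^sup>+y\<in>cball x (\<epsilon> n). ennreal (circle_cost \<kappa> (T y) (T x)) \<partial>lborel)" for x
        proof -
          have "integrable lborel (\<lambda>y. indicator (cball x (\<epsilon> n)) y * ?g y x)"
            by (rule integrable_bounded_cball(1)[of _ "\<epsilon> n" "2 * pi" x])
               (use e norm_gamma_diff_le_2pi in \<open>auto simp: indicator_def\<close>)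
          then have "ennreal (\<integral>y. indicator (cball x (\<epsilon> n)) y * ?g y x \<partial>lborel) = (\<integral>\<^sup>+y. ennreal (indicator (cball x (\<epsilon> n)) y * ?g y x) \<partial>lborel)"
            by (intro nn_integral_eq_integral[symmetric]) auto
          also have "\<dots> \<le> (\<integral>\<^sup>+y. ennreal \<eta> * indicator (cball x (\<epsilon> n)) y + ennreal c * (ennreal (circle_cost \<kappa> (T y) (T x)) * indicator (cball x (\<epsilon> n)) y) \<partial>lborel)"
            using c \<eta> cc0 by (intro nn_integral_mono) (auto simp: indicator_def ennreal_leI simp flip: ennreal_mult ennreal_plus)
          also have "\<dots> = ennreal \<eta> * emeasure lborel (cball x (\<epsilon> n)) + ennreal c * (\<integral>\<^sup>+y\<in>cball x (\<epsilon> n). ennreal (circle_cost \<kappa> (T y) (T x)) \<partial>lborel)"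
            by (subst nn_integral_add) (auto simp: nn_integral_cmult_indicator nn_integral_cmult)
          also have "ennreal \<eta> * emeasure lborel (cball x (\<epsilon> n)) = ennreal (\<eta> * (pi * \<epsilon> n ^ 2))"
            using e \<eta> by (simp add: measure_cball_complex ennreal_mult)
          finally show ?thesis .
        qed
        define H where "H x = (\<integral>\<^sup>+y\<in>cball x (\<epsilon> n). ennreal (circle_cost \<kappa> (T y) (T x)) \<partial>lborel)" for x
        have [measurable]: "H \<in> borel_measurable borel" unfolding H_def mem_cball indicator_def by measurable
        have "(\<integral>\<^sup>+x\<in>A. H x \<partial>lborel) \<le> ennreal (L * \<epsilon> n * (pi * \<epsilon> n ^ 2))"
          unfolding H_def using L n e \<open>0 \<le> L\<close> by (intro nn_integral_near_diagonal[OF ccm \<open>A \<in> sets borel\<close>, simplified]) auto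
        moreover have "(\<integral>\<^sup>+x\<in>?S. H x \<partial>lborel) \<le> (\<integral>\<^sup>+x\<in>A. H x \<partial>lborel)"
          using SA by (intro nn_integral_mono) (auto simp: indicator_def)
        ultimately have HS: "(\<integral>\<^sup>+x\<in>?S. H x \<partial>lborel) \<le> ennreal (L * \<epsilon> n * (pi * \<epsilon> n ^ 2))" by (rule order_trans[rotated])
        have "ennreal \<bar>J n\<bar> \<le> (\<integral>\<^sup>+x. ennreal \<bar>?d (F n x - P x) x\<bar> \<partial>lborel)"
          unfolding Jn using integral_norm_bound_ennreal[of lborel "\<lambda>x. ?d (F n x - P x) x"]
            Bochner_Integration.integrable_diff[OF Fint Pint] by (simp add: lin)
        also have "\<dots> \<le> (\<integral>\<^sup>+x. ennreal (B * (C / \<epsilon> n ^ 2)) * ((ennreal (\<eta> * (pi * \<epsilon> n ^ 2)) + ennreal c * H x) * indicator ?S x) \<partial>lborel)"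
        proof (rule nn_integral_mono)
          fix x
          show "ennreal \<bar>?d (F n x - P x) x\<bar> \<le> ennreal (B * (C / \<epsilon> n ^ 2)) * ((ennreal (\<eta> * (pi * \<epsilon> n ^ 2)) + ennreal c * H x) * indicator ?S x)"
          proof (cases "x \<in> ?S")
            case True
            have "\<bar>?d (F n x - P x) x\<bar> \<le> B * (C / \<epsilon> n ^ 2 * (\<integral>y. indicator (cball x (\<epsilon> n)) y * ?g y x \<partial>lborel))"
              using B(1) Fclose[of n x] by (intro order_trans[OF B(2)] mult_left_mono) (auto simp: P_def)
            then have "ennreal \<bar>?d (F n x - P x) x\<bar> \<le> ennreal (B * (C / \<epsilon> n ^ 2) * (\<integral>y. indicator (cball x (\<epsilon> n)) y * ?g y x \<partial>lborel))"
              by (intro ennreal_leI) (simp add: mult.assoc)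
            also have "\<dots> = ennreal (B * (C / \<epsilon> n ^ 2)) * ennreal (\<integral>y. indicator (cball x (\<epsilon> n)) y * ?g y x \<partial>lborel)"
              using B(1) C e by (intro ennreal_mult integral_nonneg_AE) auto
            also have "\<dots> \<le> ennreal (B * (C / \<epsilon> n ^ 2)) * (ennreal (\<eta> * (pi * \<epsilon> n ^ 2)) + ennreal c * H x)"
              unfolding H_def by (rule mult_left_mono[OF inner]) simp
            finally show ?thesis using True by simp
          next
            case False
            then show ?thesis by (simp add: d0)
          qed
        qed
        also have "\<dots> = ennreal (B * (C / \<epsilon> n ^ 2)) * (\<integral>\<^sup>+x. (ennreal (\<eta> * (pi * \<epsilon> n ^ 2)) * indicator ?S x + ennreal c * (H x * indicator ?S x)) \<partial>lborel)"
          by (subst nn_integral_cmult) (auto simp: distrib_right mult.assoc)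
        also have "\<dots> = ennreal (B * (C / \<epsilon> n ^ 2)) * (ennreal (\<eta> * (pi * \<epsilon> n ^ 2)) * ennreal W + ennreal c * (\<integral>\<^sup>+x\<in>?S. H x \<partial>lborel))"
          by (subst nn_integral_add) (auto simp: nn_integral_cmult_indicator nn_integral_cmult W(2))
        also have "\<dots> \<le> ennreal (B * (C / \<epsilon> n ^ 2)) * (ennreal (\<eta> * (pi * \<epsilon> n ^ 2)) * ennreal W + ennreal c * ennreal (L * \<epsilon> n * (pi * \<epsilon> n ^ 2)))"
          by (intro mult_left_mono add_left_mono HS) auto
        also have "\<dots> = ennreal (B * (C / \<epsilon> n ^ 2) * (\<eta> * (pi * \<epsilon> n ^ 2) * W + c * (L * \<epsilon> n * (pi * \<epsilon> n ^ 2))))"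
        proof -
          have "ennreal a * (ennreal b * ennreal w + ennreal u * ennreal v) = ennreal (a * (b * w + u * v))"
            if "0 \<le> a" "0 \<le> b" "0 \<le> w" "0 \<le> u" "0 \<le> v" for a b w u v :: real
            using that by (simp del: ennreal_plus add: ennreal_mult[symmetric] ennreal_plus[symmetric])
          then show ?thesis using B(1) C e \<eta> W(1) c(1) \<open>0 \<le> L\<close> by simp
        qed
        also have "B * (C / \<epsilon> n ^ 2) * (\<eta> * (pi * \<epsilon> n ^ 2) * W + c * (L * \<epsilon> n * (pi * \<epsilon> n ^ 2))) = B * C * pi * (W * \<eta> + c * L * \<epsilon> n)"
          using e by (simp add: field_simps)
        finally show ?thesis
          using B(1) C W(1) \<eta> c(1) \<open>0 \<le> L\<close> e by (subst (asm) ennreal_le_iff) auto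
      qed
      have "J \<longlonglongrightarrow> 0"
      proof (rule LIMSEQ_I)
        fix e :: real assume e: "0 < e"
        \<comment> \<open>The summand 1 keeps the denominator positive when the product is 0. With
          this \<eta> the first part of \<open>Jle\<close> is at most e/2, whatever the resulting
          \<open>c\<close>.\<close>
        define \<eta> where "\<eta> = e / (2 * (B * C * pi * W + 1))"
        have BC: "0 \<le> B * C * pi" using B(1) C by simp
        have \<eta>: "0 < \<eta>" using e BC W(1) by (auto simp: \<eta>_def intro!: divide_pos_pos add_nonneg_pos)
        obtain c where c: "0 \<le> c" "\<And>a b. norm (\<gamma> a - \<gamma> b) \<le> \<eta> + c * circle_cost \<kappa> a b"
          by (rule gamma_diff_le_circle_cost[OF \<kappa> \<eta>]) (rule that)
        have "(\<lambda>n. B * C * pi * c * L * \<epsilon> n) \<longlonglongrightarrow> B * C * pi * c * L * 0" by (intro tendsto_intros \<epsilon>0)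
        then have "\<forall>\<^sub>F n in sequentially. B * C * pi * c * L * \<epsilon> n < e / 2" using e by (intro order_tendstoD(2)) auto
        moreover have "\<forall>\<^sub>F n in sequentially. \<epsilon> n < 2 * \<delta>" using \<open>0 < \<delta>\<close> by (intro order_tendstoD(2)[OF \<epsilon>0]) auto
        ultimately have "\<forall>\<^sub>F n in sequentially. norm (J n - 0) < e"
        proof eventually_elim
          case (elim n)
          have "B * C * pi * W * \<eta> \<le> (B * C * pi * W + 1) * \<eta>" using \<eta> by (intro mult_right_mono) auto
          also have "\<dots> = e / 2"
          proof -
            have "0 < B * C * pi * W + 1" using mult_nonneg_nonneg[OF BC W(1)] by linarith
            moreover have "d * (e / (2 * d)) = e / 2" if "0 < d" for d :: real using that by simp
            ultimately show ?thesis unfolding \<eta>_def by blast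
          qed
          finally show ?case
            using Jle[OF \<eta> c elim(2)] elim(1) by (simp add: distrib_left mult.assoc)
        qed
        then show "\<exists>n0. \<forall>n\<ge>n0. norm (J n - 0) < e" by (simp add: eventually_sequentially)
      qed
      then have "(\<lambda>n. J n + (\<integral>x. ?d (P x) x \<partial>lborel)) \<longlonglongrightarrow> 0 + (\<integral>x. ?d (P x) x \<partial>lborel)"
        by (intro tendsto_add tendsto_const)
      then show ?thesis by (simp add: J_def P_def)
    qed
  qed
  show thesis
  proof (rule that[OF \<mu>])
    fix \<phi> assume \<phi>: "test_fn \<Omega> \<phi>"
    have "(\<lambda>n. - (\<integral>x. \<phi> x * f (r n) x \<partial>lborel)) \<longlonglongrightarrow> - ((\<integral>x. \<phi> x \<partial>\<mu>1) - (\<integral>x. \<phi> x \<partial>\<mu>2))"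
      using \<phi> smooth_R2_D(2) unfolding test_fn_def by (intro tendsto_minus lim) auto
    moreover have "(\<lambda>n. - (\<integral>x. \<phi> x * f (r n) x \<partial>lborel)) \<longlonglongrightarrow> (\<integral>x. frechet_derivative \<phi> (at x) (\<Phi> (\<gamma> (T x))) \<partial>lborel)"
      using LIMSEQ_subseq_LIMSEQ[OF conv[OF \<phi>] r] by (simp add: o_def parts[OF \<phi>])
    ultimately show "(\<integral>x. frechet_derivative \<phi> (at x) (\<Phi> (\<gamma> (T x))) \<partial>lborel)
       = - ((\<integral>x. \<phi> x \<partial>\<mu>1) - (\<integral>x. \<phi> x \<partial>\<mu>2))"
      by (rule LIMSEQ_unique[rotated])
  qed
qed

end

section \<open>Borel representatives and almost everywhere equality\<close>

lemma AE_lborel_translate: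
  fixes h :: complex
  assumes "AE x in lborel. P x"
  shows "AE x in lborel. P (x + h)"
proof -
  obtain M where M: "{x \<in> space lborel. \<not> P x} \<subseteq> M" "emeasure lborel M = 0" "M \<in> sets lborel"
    using assms by (rule AE_E)
  have "emeasure lborel {x. h + x \<in> M} = emeasure (distr lborel borel ((+) h)) M"
    using M(3) by (subst emeasure_distr) (auto simp: vimage_def)
  then have "emeasure lborel {x. h + x \<in> M} = 0" using M(2) by (simp add: lborel_distr_plus)
  moreover have "{x. h + x \<in> M} \<in> sets lborel"
    using measurable_sets[of "(+) h" borel borel M] M(3) by (simp add: vimage_def)
  ultimately show ?thesis
    by (intro AE_I[of _ _ "{x. h + x \<in> M}"]) (use M(1) in \<open>auto simp: add.commute\<close>)
qed

context unit_curve
begin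

lemma measurable_gamma_inverse:
  obtains \<tau> :: "complex \<Rightarrow> real" where "\<tau> \<in> borel_measurable borel" "\<And>z. N z = 1 \<Longrightarrow> \<gamma> (\<tau> z) = z"
proof -
  define \<tau> where "\<tau> z = (if N z = 1 then (THE t. t \<in> {0..<2 * pi} \<and> \<gamma> t = z) else 0)" for z
  have ex: "\<exists>t. t \<in> {0..<2 * pi} \<and> \<gamma> t = z" if "N z = 1" for z
  proof -
    have "z \<in> range \<gamma>" unfolding gamma_range using that by simp
    then obtain t where t: "z = \<gamma> t" by (rule rangeE)
    obtain k where "t + 2 * pi * of_int k \<in> {0..<2 * pi}" by (rule reduce_mod_2pi)
    then show ?thesis using gamma_periodic_int[of t k] t by blast
  qed
  have \<tau>: "\<tau> z \<in> {0..<2 * pi} \<and> \<gamma> (\<tau> z) = z" if "N z = 1" for z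
  proof -
    have "\<exists>!t. t \<in> {0..<2 * pi} \<and> \<gamma> t = z"
    proof (rule ex_ex1I[OF ex[OF that]])
      fix s t assume st: "s \<in> {0..<2 * pi} \<and> \<gamma> s = z" "t \<in> {0..<2 * pi} \<and> \<gamma> t = z"
      then show "s = t" by (intro inj_onD[OF gamma_inj, of s t]) simp_all
    qed
    from theI'[OF this] show ?thesis using that by (simp add: \<tau>_def)
  qed
  have range: "0 \<le> \<tau> z" "\<tau> z < 2 * pi" for z
    using \<tau>[of z] pi_gt_zero by (cases "N z = 1"; simp add: \<tau>_def)+
  have "\<tau> \<in> borel_measurable borel"
    unfolding borel_measurable_iff_le
  proof
    fix a
    have cl: "closed (\<gamma> ` {0..a})"
      by (intro compact_imp_closed compact_continuous_image gamma_continuous) simp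
    have Nc: "{z. N z \<noteq> 1} \<in> sets borel"
    proof -
      have "open {z. N z \<noteq> 1}"
        by (intro open_Collect_neq continuous_N continuous_on_const)
      then show ?thesis by simp
    qed
    consider "a < 0" | "2 * pi \<le> a" | "0 \<le> a" "a < 2 * pi" by linarith
    then show "{z \<in> space borel. \<tau> z \<le> a} \<in> sets borel"
    proof cases
      case 1
      then have "{z \<in> space borel. \<tau> z \<le> a} = {}" using range(1) by (auto simp: not_le intro: less_le_trans)
      then show ?thesis by simp
    next
      case 2
      then have "{z \<in> space borel. \<tau> z \<le> a} = UNIV" using order_trans[OF less_imp_le[OF range(2)]] by auto
      then show ?thesis by simp
    next
      case 3
      have "{z \<in> space borel. \<tau> z \<le> a} = \<gamma> ` {0..a} \<union> {z. N z \<noteq> 1}"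
      proof (intro equalityI subsetI)
        fix z assume "z \<in> {z \<in> space borel. \<tau> z \<le> a}"
        then have z: "\<tau> z \<le> a" by simp
        show "z \<in> \<gamma> ` {0..a} \<union> {z. N z \<noteq> 1}"
        proof (cases "N z = 1")
          case True
          then show ?thesis using \<tau>[OF True] z by (intro UnI1 image_eqI[of _ _ "\<tau> z"]) auto
        qed simp
      next
        fix z assume z: "z \<in> \<gamma> ` {0..a} \<union> {z. N z \<noteq> 1}"
        have "\<tau> z \<le> a"
        proof (cases "N z = 1")
          case True
          then obtain t where t: "t \<in> {0..a}" "z = \<gamma> t" using z by auto
          then have "t = \<tau> z" using \<tau>[OF True] 3 by (intro inj_onD[OF gamma_inj]) auto
          then show ?thesis using t by simp
        qed (use 3 in \<open>simp add: \<tau>_def\<close>)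
        then show "z \<in> {z \<in> space borel. \<tau> z \<le> a}" by simp
      qed
      then show ?thesis using cl Nc by simp
    qed
  qed
  then show thesis using \<tau> by (intro that[of \<tau>]) auto
qed

text \<open>The real and imaginary parts of the Lebesgue measurable field have Borel versions, to
  which the Borel inverse of \<gamma> is applied. The product measurability required by Fubini then
  holds for the angle.\<close>

lemma borel_angle_exists:
  assumes "set_borel_measurable lebesgue \<Omega> m" "AE x in lebesgue. x \<in> \<Omega> \<longrightarrow> N (m x) = 1"
  obtains T where "T \<in> borel_measurable borel" "AE x in lborel. x \<in> \<Omega> \<longrightarrow> \<gamma> (T x) = m x"
proof -
  obtain \<tau> where [measurable]: "\<tau> \<in> borel_measurable borel" and \<tau>: "\<And>z. N z = 1 \<Longrightarrow> \<gamma> (\<tau> z) = z"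
    by (rule measurable_gamma_inverse) (rule that)
  define u where "u x = indicator \<Omega> x *\<^sub>R m x" for x
  have u: "u \<in> borel_measurable lebesgue" using assms(1) by (simp add: set_borel_measurable_def u_def[abs_def])
  have "(\<lambda>x. Re (u x)) \<in> borel_measurable lebesgue" "(\<lambda>x. Im (u x)) \<in> borel_measurable lebesgue"
    using u by measurable
  then obtain p q where [measurable]: "p \<in> borel_measurable lborel" "q \<in> borel_measurable lborel"
    and pq: "AE x in lborel. Re (u x) = p x" "AE x in lborel. Im (u x) = q x"
    using completion_ex_borel_measurable_real by metis
  show thesis
  proof (rule that[of "\<lambda>x. \<tau> (Complex (p x) (q x))"])
    have "(\<lambda>x. Complex (p x) (q x)) \<in> borel_measurable borel"
      unfolding Complex_eq by measurable
    then show "(\<lambda>x. \<tau> (Complex (p x) (q x))) \<in> borel_measurable borel" by measurable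
    show "AE x in lborel. x \<in> \<Omega> \<longrightarrow> \<gamma> (\<tau> (Complex (p x) (q x))) = m x"
      using pq assms(2)[unfolded AE_completion_iff]
    proof eventually_elim
      case (elim x)
      have "Complex (p x) (q x) = u x" using elim by (simp add: complex_eq_iff)
      then show ?case using elim(3) \<tau> by (auto simp: u_def)
    qed
  qed
qed

text \<open>Nothing is known about \<open>m\<close> outside \<Omega>, but there the derivative of
  the test function vanishes. Hence both integrands agree almost everywhere, and the Borel one can
  be integrated against \<open>lborel\<close>.\<close>

lemma lebesgue_integral_test_fn_cong:
  assumes \<phi>: "test_fn \<Omega> \<phi>" and T: "T \<in> borel_measurable borel" and ae: "AE x in lborel. x \<in> \<Omega> \<longrightarrow> \<gamma> (T x) = m x"
    and P: "(\<lambda>t. P (\<gamma> t)) \<in> borel_measurable borel"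
  shows "(LINT x|lebesgue. frechet_derivative \<phi> (at x) (P (m x))) = (\<integral>x. frechet_derivative \<phi> (at x) (P (\<gamma> (T x))) \<partial>lborel)"
proof -
  have sm: "smooth_R2 \<phi>" and sub: "closure {x. \<phi> x \<noteq> 0} \<subseteq> \<Omega>" using \<phi> by (auto simp: test_fn_def)
  have [measurable]: "(\<lambda>x. frechet_derivative \<phi> (at x) v) \<in> borel_measurable borel" for v
    using smooth_R2_D(2)[OF smooth_R2_D(3)[OF sm]] by (rule borel_measurable_continuous_onI)
  have [measurable]: "(\<lambda>x. P (\<gamma> (T x))) \<in> borel_measurable borel" using measurable_compose[OF T P] by (simp add: o_def)
  define a b where "a x = frechet_derivative \<phi> (at x) (P (m x))" and "b x = frechet_derivative \<phi> (at x) (P (\<gamma> (T x)))" for x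
  have "b x = Re (P (\<gamma> (T x))) * frechet_derivative \<phi> (at x) 1 + Im (P (\<gamma> (T x))) * frechet_derivative \<phi> (at x) \<i>" for x
    unfolding b_def using frechet_derivative_Re_Im[of \<phi> x] smooth_R2_D(1)[OF sm] by (auto simp: differentiable_def)
  then have bm: "b \<in> borel_measurable borel" by (subst measurable_cong) (auto intro!: borel_measurable_add borel_measurable_times)
  have ab: "AE x in lebesgue. b x = a x"
    unfolding AE_completion_iff using ae
  proof eventually_elim
    case (elim x)
    show ?case
    proof (cases "x \<in> \<Omega>")
      case True
      then show ?thesis using elim by (simp add: a_def b_def)
    next
      case False
      then have "x \<notin> closure {x. \<phi> x \<noteq> 0}" using sub by blast
      from frechet_derivative_eq_0_outside_support[OF this] show ?thesis by (simp add: a_def b_def)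
    qed
  qed
  have bl: "b \<in> borel_measurable lebesgue" using bm by (simp add: measurable_completion)
  have al: "a \<in> borel_measurable lebesgue" using bl ab by (rule borel_measurable_AE)
  have "(LINT x|lebesgue. a x) = (LINT x|lebesgue. b x)"
    by (rule integral_cong_AE[OF al bl]) (use ab in \<open>auto elim: eventually_mono\<close>)
  also have "\<dots> = (\<integral>x. b x \<partial>lborel)" using bm by (intro integral_completion) simp
  finally show ?thesis by (simp add: a_def b_def)
qed

end

theorem theorem1p8:
  fixes N :: "complex \<Rightarrow> real" and \<gamma> :: "real \<Rightarrow> complex" and \<alpha> :: "real \<Rightarrow> real"
    and \<Omega> :: "complex set" and m :: "complex \<Rightarrow> complex"
  assumes "is_norm_R2 N" and "strictly_convex_norm N"
    and "\<forall>p. p \<noteq> 0 \<longrightarrow> real_analytic_at N p"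
    and "arclength_param N \<gamma>" and "angle_fn \<gamma> \<alpha>"
    and "bounded \<Omega>" and "open \<Omega>"
    and "set_borel_measurable lebesgue \<Omega> m"
    and "AE x in lebesgue. x \<in> \<Omega> \<longrightarrow> N (m x) = 1"
    and "div_zero \<Omega> m"
    and "\<forall>\<Omega>'. open \<Omega>' \<and> compact (closure \<Omega>') \<and> closure \<Omega>' \<subseteq> \<Omega> \<longrightarrow>
           (SUP h\<in>{h. 0 < norm h \<and> norm h < setdist \<Omega>' (frontier \<Omega>)}.
              ennreal (1 / norm h) *
              (\<integral>\<^sup>+ x\<in>\<Omega>'. ennreal (Pi_cost \<gamma> \<alpha> (m (x + h)) (m x)) \<partial>lebesgue)) < \<infinity>"
  shows "\<forall>\<Phi>. ENT \<gamma> \<Phi> \<longrightarrow> div_is_Mloc \<Omega> (\<lambda>x. \<Phi> (m x))"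
proof (intro allI impI)
  fix \<Phi> assume \<Phi>: "ENT \<gamma> \<Phi>"
  interpret unit_curve N \<gamma> \<alpha> using assms(1,2,4,5) by (rule unit_curve.intro)
  \<comment> \<open>With \<eta> = pi the two constraints force |a - b| = pi, so \<kappa> is a
    positive lower bound for the cost of half-period arcs, as \<open>circle_cost\<close>
    requires.\<close>
  obtain \<kappa> where \<kappa>: "\<kappa> > 0" and \<kappa>le: "\<And>a b. \<lbrakk>pi \<le> \<bar>a - b\<bar>; \<bar>a - b\<bar> \<le> pi\<rbrakk> \<Longrightarrow> \<kappa> \<le> arc_cost a b"
    by (rule arc_cost_lower_bound[OF pi_gt_zero]) (rule that)
  have le_Pi: "circle_cost \<kappa> a b \<le> Pi_cost \<gamma> \<alpha> (\<gamma> a) (\<gamma> b)" for a b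
    by (rule circle_cost_le_Pi_cost) (simp add: \<kappa>le)
  obtain T where T[measurable]: "T \<in> borel_measurable borel" and ae: "AE x in lborel. x \<in> \<Omega> \<longrightarrow> \<gamma> (T x) = m x"
    by (rule borel_angle_exists[OF assms(8,9)]) (rule that)
  have dz: "div_zero \<Omega> (\<lambda>x. \<gamma> (T x))"
    unfolding div_zero_def
  proof (intro allI impI)
    fix \<phi> assume \<phi>: "test_fn \<Omega> \<phi>"
    have "(LINT x|lebesgue. frechet_derivative \<phi> (at x) (\<gamma> (T x))) = (\<integral>x. frechet_derivative \<phi> (at x) (\<gamma> (T x)) \<partial>lborel)"
      using lebesgue_integral_test_fn_cong[OF \<phi> T, of "\<lambda>x. \<gamma> (T x)" "\<lambda>z. z"] by simp
    also have "\<dots> = (LINT x|lebesgue. frechet_derivative \<phi> (at x) (m x))"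
      using lebesgue_integral_test_fn_cong[OF \<phi> T ae, of "\<lambda>z. z"] by simp
    also have "\<dots> = 0" using assms(10) \<phi> by (simp add: div_zero_def)
    finally show "(LINT x|lebesgue. frechet_derivative \<phi> (at x) (\<gamma> (T x))) = 0" .
  qed
  have tb: "\<exists>\<delta> A L. 0 < \<delta> \<and> 0 \<le> L \<and> A \<in> sets borel \<and> A \<subseteq> \<Omega> \<and>
      (\<forall>x\<in>K. cball x \<delta> \<subseteq> A) \<and>
      (\<forall>h. norm h < 2 * \<delta> \<longrightarrow> (\<integral>\<^sup>+x\<in>A. ennreal (circle_cost \<kappa> (T (x + h)) (T x)) \<partial>lborel) \<le> ennreal (L * norm h))"
    if K: "compact K" "K \<subseteq> \<Omega>" "K \<noteq> {}" for K
  proof -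
    obtain \<delta> A where \<delta>: "0 < \<delta>" and A: "open A" "compact (closure A)" "closure A \<subseteq> \<Omega>"
      and KA: "\<And>x. x \<in> K \<Longrightarrow> cball x \<delta> \<subseteq> A" and far: "\<And>x y. \<lbrakk>x \<in> A; y \<notin> \<Omega>\<rbrakk> \<Longrightarrow> 2 * \<delta> \<le> dist x y"
      by (rule compact_neighbourhood[OF K(1,2) assms(7) K(3)]) (rule that)
    have [measurable]: "A \<in> sets borel" using A(1) by simp
    define S where "S = (SUP h\<in>{h. 0 < norm h \<and> norm h < setdist A (frontier \<Omega>)}.
              ennreal (1 / norm h) * (\<integral>\<^sup>+ x\<in>A. ennreal (Pi_cost \<gamma> \<alpha> (m (x + h)) (m x)) \<partial>lebesgue))"
    have "S < \<infinity>" using assms(11) A unfolding S_def by blast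
    then obtain s where s: "0 \<le> s" "S = ennreal s" by (cases S) auto
    \<comment> \<open>This makes every nonzero \<open>h\<close> below 2 \<delta> admissible in the
      supremum. Both sets must be nonempty, since \<open>setdist\<close> is 0 otherwise; the
      frontier is nonempty because \<Omega> is bounded and contains \<open>K\<close>.\<close>
    have sd: "2 * \<delta> \<le> setdist A (frontier \<Omega>)"
    proof (rule le_setdistI)
      obtain k where "k \<in> K" using K(3) by blast
      then have "k \<in> A" using KA[of k] \<delta> by force
      then show "A \<noteq> {}" by blast
      have "\<Omega> \<noteq> {}" "\<Omega> \<noteq> UNIV" using K assms(6) not_bounded_UNIV by auto
      then show "frontier \<Omega> \<noteq> {}" using frontier_not_empty by blast
      show "2 * \<delta> \<le> dist x y" if "x \<in> A" "y \<in> frontier \<Omega>" for x y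
        using that far assms(7) by (auto simp: frontier_def interior_open)
    qed
    have tr: "(\<integral>\<^sup>+x\<in>A. ennreal (circle_cost \<kappa> (T (x + h)) (T x)) \<partial>lborel) \<le> ennreal (s * norm h)" if h: "norm h < 2 * \<delta>" for h
    proof (cases "h = 0")
      \<comment> \<open>The supremum excludes h = 0; there the cost of a value with itself is
        0.\<close>
      case True
      then show ?thesis by (simp add: circle_cost_self)
    next
      case False
      \<comment> \<open>Monotonicity of the nonnegative integral holds for arbitrary integrands, so
        no measurability of \<open>Pi_cost\<close> is involved. Equality of the field with its Borel
        version is used at \<open>x\<close> and at \<open>x + h\<close>, hence the translated null
        set.\<close>
      have "(\<integral>\<^sup>+x\<in>A. ennreal (circle_cost \<kappa> (T (x + h)) (T x)) \<partial>lborel)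
          \<le> (\<integral>\<^sup>+ x\<in>A. ennreal (Pi_cost \<gamma> \<alpha> (m (x + h)) (m x)) \<partial>lborel)"
      proof (rule nn_integral_mono_AE)
        show "AE x in lborel. ennreal (circle_cost \<kappa> (T (x + h)) (T x)) * indicator A x
            \<le> ennreal (Pi_cost \<gamma> \<alpha> (m (x + h)) (m x)) * indicator A x"
          using ae AE_lborel_translate[OF ae, of h]
        proof eventually_elim
          case (elim x)
          show ?case
          proof (cases "x \<in> A")
            case True
            have "x \<in> \<Omega>" using True A(3) closure_subset by blast
            moreover have "x + h \<in> \<Omega>"
              using far[OF True, of "x + h"] h by (cases "x + h \<in> \<Omega>") (auto simp: dist_norm)
            ultimately have "m x = \<gamma> (T x)" "m (x + h) = \<gamma> (T (x + h))" using elim by auto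
            then show ?thesis using le_Pi by (auto intro!: mult_right_mono ennreal_leI)
          qed simp
        qed
      qed
      also have "\<dots> = (\<integral>\<^sup>+ x\<in>A. ennreal (Pi_cost \<gamma> \<alpha> (m (x + h)) (m x)) \<partial>lebesgue)" (is "_ = ?I")
        by (rule nn_integral_completion[symmetric])
      \<comment> \<open>Multiplying and dividing by |h| exhibits the difference quotient whose
        supremum is finite by hypothesis.\<close>
      also have "\<dots> = ennreal (norm h) * (ennreal (1 / norm h) * ?I)"
        using False by (simp add: mult.assoc[symmetric] ennreal_mult[symmetric])
      also have "\<dots> \<le> ennreal (norm h) * S"
        unfolding S_def using False h sd by (intro mult_left_mono SUP_upper) auto
      also have "\<dots> = ennreal (s * norm h)" using s by (simp add: ennreal_mult mult.commute)
      finally show ?thesis .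
    qed
    show ?thesis
      using \<delta> s(1) \<open>A \<in> sets borel\<close> A(3) closure_subset[of A] KA tr by (intro exI[of _ \<delta>] exI[of _ A] exI[of _ s]) blast
  qed
  obtain \<mu>1 \<mu>2 :: "complex measure" where \<mu>: "sets \<mu>1 = sets borel" "sets \<mu>2 = sets borel"
    "emeasure \<mu>1 (UNIV - \<Omega>) = 0" "emeasure \<mu>2 (UNIV - \<Omega>) = 0"
    "\<And>K. \<lbrakk>compact K; K \<subseteq> \<Omega>\<rbrakk> \<Longrightarrow> emeasure \<mu>1 K < \<infinity> \<and> emeasure \<mu>2 K < \<infinity>"
    "\<And>\<phi>. test_fn \<Omega> \<phi> \<Longrightarrow> (\<integral>x. frechet_derivative \<phi> (at x) (\<Phi> (\<gamma> (T x))) \<partial>lborel)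
       = - ((\<integral>x. \<phi> x \<partial>\<mu>1) - (\<integral>x. \<phi> x \<partial>\<mu>2))"
    by (rule entropy_production_is_measure[OF assms(7,6) T dz \<kappa> _ \<Phi>]) (erule (2) tb, rule that)
  have "continuous_on UNIV (\<lambda>t. \<Phi> (\<gamma> t))"
    by (rule continuous_on_compose2[of "range \<gamma>" \<Phi> UNIV \<gamma>])
       (use \<Phi> gamma_continuous[of UNIV] in \<open>simp_all add: ENT_def\<close>)
  then have "(\<lambda>t. \<Phi> (\<gamma> t)) \<in> borel_measurable borel" by (rule borel_measurable_continuous_onI)
  note cong = lebesgue_integral_test_fn_cong[OF _ T ae this]
  show "div_is_Mloc \<Omega> (\<lambda>x. \<Phi> (m x))"
    unfolding div_is_Mloc_def
  proof (intro exI conjI allI impI)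
    show "(LINT x|lebesgue. frechet_derivative \<phi> (at x) (\<Phi> (m x))) = - ((\<integral>x. \<phi> x \<partial>\<mu>1) - (\<integral>x. \<phi> x \<partial>\<mu>2))"
      if "test_fn \<Omega> \<phi>" for \<phi>
      using cong[OF that] \<mu>(6)[OF that] by simp
  qed (use \<mu> in auto)
qed

end
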